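(* Consider, for the conservation law $u_t+\nabla\cdot\mathbf F(u)=0$ on $\Omega$, the flux-limited update of macro-element mean values $$\bar u_h^{n+1}|_M=\bar u_h^n|_M-\frac{\Delta t}{|I_M|}\sum_{\xi\in\mathcal F_h^M}\int_\xi\widehat F_\xi^{\rm MPP}\,ds,\qquad \widehat F_\xi^{\rm MPP}=\theta_\xi\,\widehat F^{\mathcal H}_\xi(u_h)+(1-\theta_\xi)\,\widehat F^{\mathcal L}_\xi(\bar u_h^n),\qquad M\in\mathcal M_h .$$ Assume that $\bar u_h^n|_M\in[u^{\min},u^{\max}]$ for all $M\in\mathcal M_h$ (and that prescribed inflow boundary states lie in $[u^{\min},u^{\max}]$), and that the time step $\Delta t>0$ satisfies $$\max_{M\in\mathcal M_h}\frac{|\partial I_M|}{|I_M|}\,\lambda\,\Delta t\le 1,$$ where $\lambda$ is the global parameter of the low-order Lax--Friedrichs flux $\widehat F^{\mathcal L}$. Let the limiter parameters $\theta_\xi$ be chosen by the rule $\theta_\xi=\min\{\theta_\xi^M,\theta_\xi^{M_i}\}$ if $\xi$ is shared by macro-elements $M$ and $M_i$, and $\theta_\xi=\theta_\xi^M$ if $\xi$ is part of $\Gamma$, with $\theta_\xi^M$ as defined in the context. Then the updated macro-element mean values satisfy $$\bar u_h^{n+1}|_M\in[u^{\min},u^{\max}]\qquad\text{for all } M\in\mathcal M_h .$$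
   Context: $\Omega\subset\mathbb R^d$, $d\ge2$, is a bounded convex domain with polygonal or smooth boundary $\Gamma$ and outward unit normal $\mathbf n_\Gamma$; $\mathbf F\in C^1(\mathbb R)^d$; $u^{\min}$, $u^{\max}$ are the minimum and maximum of the initial data $u_0$. **Mesh, macro-elements, space.** $\Omega$ is embedded in a background Cartesian mesh $\mathcal T_{B,h}$ (mesh size $h$) of quasi-uniform, shape-regular elements; $\mathcal T_h=\{K\in\mathcal T_{B,h}:K\cap\Omega\ne\emptyset\}$, $\mathcal T_\Gamma=\{K\in\mathcal T_h:K\cap\Gamma\ne\emptyset\}$; $\mathcal E_h$ is the set of interior facets of $\mathcal T_h$; $\mathcal F_h=\{e\cap\Omega:e\in\mathcal E_h\}\cup\{K\cap\Gamma:K\in\mathcal T_\Gamma\}$; $\mathcal V_h^r=\{v_h:v_h|_K\in P^r(K)\ \forall K\in\mathcal T_h\}$. Fix $0<\delta\le1$. The elements of $\mathcal T_h$ are partitioned into macro-elements $M$ (collection $\mathcal M_h$), each consisting of one root cell $K$ (with $|K\cap\Omega|/|K|\ge\delta$), either alone or together with neighboring elements having small intersection with $\Omega$. $\mathcal E_M$ is the set of facets interior to $M$, $\mathcal E_{\rm stab}=\bigcup_M\mathcal E_M$, and $I_M=M\cap\Omega$. Macro-element interfaces: $$\mathcal F_h^{\mathcal M}=\{e\cap\Omega:e=M_1\cap M_2,\ M_1\neq M_2\in\mathcal M_h\}\cup\{K\cap\Gamma:K\in\mathcal T_\Gamma\};$$ $\mathcal F_h^M$ consists of those $\xi\in\mathcal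 F_h^{\mathcal M}$ belonging to $M$; they make up $\partial I_M$, and $|\partial I_M|=\sum_{\xi\in\mathcal F_h^M}|\xi|$. In the update for $M$, $\mathbf n_\xi$ points out of $I_M$. **Mean values.** $u_h^n\in\mathcal V_h^r$ is the solution at time $t_n$, $\bar u_h^n|_M=\frac1{|I_M|}\int_{I_M}u_h^n\,dx$, and $\bar u_h^n$ is the piecewise constant function of these values. **Low-order flux.** $\widehat F^{\mathcal L}_\xi(\bar u_h^n)=\frac12(\mathbf F(\bar u^-)+\mathbf F(\bar u^+))\cdot\mathbf n_\xi-\frac\lambda2(\bar u^+-\bar u^-)$, where $\bar u^-=\bar u_h^n|_M$, and $\bar u^+=\bar u_h^n|_{M_i}$ if $\xi$ is shared with $M_i$; on $\Gamma$, $\bar u^+$ is the boundary state prescribed by the boundary condition (inflow datum $g$ on the inflow boundary $\Gamma^-$, interior value on the outflow boundary $\Gamma^+$, periodic neighbor value for periodic conditions). $\lambda$ is one global constant with $|\mathbf F'(v)\cdot\mathbf n_\xi|\le\lambda$ for all $v\in[u^{\min},u^{\max}]$ and all $\xi$. **High-order flux.** $\widehat F_\xi(u)=\frac12(\mathbf F(u^-)+\mathbf F(u^+))\cdot\mathbf n_\xi-\frac{\lambda_\xi}2(u^+-u^-)$ with traces $u^\pm$ ("$-$" inside, "$+$" outside with respect to $\mathbf n_\xi$; on $\Gamma$ the exterior trace is $g$ on inflow and $u^-$ on outflow), $\lambda_\xi=C_\xi\alpha_\xi$, $\alpha_\xi=\max|\mathbf F'(v)\cdot\mathbf n_\xi|$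 over $v$ between $u^-$ and $u^+$, with $C_\xi=1$ on interior and outflow interfaces and $C_\xi>1$ on inflow interfaces. The high-order flux in the limiter is $$\widehat F^{\mathcal H}_\xi(u_h)=\begin{cases}\widehat F_\xi(u_h^n), & \text{forward Euler},\\ \frac16\widehat F_\xi(u_h^n)+\frac16\widehat F_\xi(u_h^{(1)})+\frac46\widehat F_\xi(u_h^{(2)}), &\text{third-order SSP Runge--Kutta},\end{cases}$$ where $u_h^{(1)}=u_h^n+\Delta tL(u_h^n)$, $u_h^{(2)}=u_h^n+\frac14\Delta t(L(u_h^n)+L(u_h^{(1)}))$, and $L(u_h)\in\mathcal V_h^r$ is defined by $(L(u_h),v_h)_\Omega+\gamma_1s_{h,1}(L(u_h),v_h)=-a_h(u_h,v_h)-\gamma_0s_{h,0}(u_h,v_h)$ for all $v_h\in\mathcal V_h^r$, with stabilization constants $\gamma_0,\gamma_1>0$, $$a_h(u_h,v_h)=-\sum_{K\in\mathcal T_h}(\mathbf F(u_h),\nabla v_h)_{K\cap\Omega}-\sum_{\xi\in\mathcal F_h}\int_\xi\widehat F_\xi(u_h)[v_h]_\xi\,ds,$$ $$s_{h,m}(u_h,v_h)=\sum_{e\in\mathcal E_{\rm stab}}\alpha_M^{1-m}\sum_{k=0}^r\frac{h^{2k+m}}{(2k+1)(k!)^2}\int_e[\partial_n^ku_h]_e[\partial_n^kv_h]_e\,ds,\quad m\in\{0,1\},$$ $[w]_\xi=w^+-w^-$ (test functions have exterior trace $0$ on $\Gamma$), and $\alpha_M$ the maximum of $|\partial(\mathbf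 F(u)\cdot\mathbf n)/\partial u|$ over the interfaces contained in the macro-element $M$ with $e\in\mathcal E_M$. **Limiter parameters.** For each $M\in\mathcal M_h$ define $$\mathbb B^{\min}=\bar u_h^n|_M-\frac{\Delta t}{|I_M|}\sum_{\xi\in\mathcal F_h^M}\int_\xi\widehat F^{\mathcal L}_\xi(\bar u_h^n)\,ds-u^{\min},\qquad \mathbb B^{\max}=u^{\max}-\bar u_h^n|_M+\frac{\Delta t}{|I_M|}\sum_{\xi\in\mathcal F_h^M}\int_\xi\widehat F^{\mathcal L}_\xi(\bar u_h^n)\,ds,$$ $$\beta_\xi=\int_\xi\bigl(\widehat F^{\mathcal H}_\xi(u_h)-\widehat F^{\mathcal L}_\xi(\bar u_h^n)\bigr)ds,\qquad \mathbb C^{\min}=\frac{\Delta t}{|I_M|}\sum_{\xi\in\mathcal F_h^M}\max(\beta_\xi,0),\qquad \mathbb C^{\max}=\frac{\Delta t}{|I_M|}\sum_{\xi\in\mathcal F_h^M}\max(-\beta_\xi,0).$$ With $\epsilon=10^{-40}$, for $\xi\in\mathcal F_h^M$ set $$\Lambda^{\min}_{0,\xi}=\begin{cases}\min\{1,\mathbb B^{\min}/(\mathbb C^{\min}+\epsilon)\},&\beta_\xi\ge0,\\1,&\text{else},\end{cases}\qquad \Lambda^{\max}_{0,\xi}=\begin{cases}\min\{1,\mathbb B^{\max}/(\mathbb C^{\max}+\epsilon)\},&\beta_\xi\le0,\\1,&\text{else},\end{cases}$$ and $\theta_\xi^M=\min\{\Lambda^{\min}_{0,\xi},\Lambda^{\max}_{0,\xi}\}$.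 *)

theory Defs
  imports "HOL-Analysis.Analysis"
begin

section \<open>Surface measure\<close>

text \<open>
  The surface element \<open>ds\<close> is the normalised Hausdorff measure of dimension \<open>d - 1\<close>, restricted
  to the Borel sets.  The outer measure is a metric outer measure, so \<open>measure_of\<close> below receives a
  countably additive function.  The definition is only meant for \<open>s \<ge> 1\<close> (empty members of
  a covering then contribute \<open>0\<close>).
\<close>

definition hausdorff_content :: "nat \<Rightarrow> real \<Rightarrow> 'a::metric_space set \<Rightarrow> ennreal" where
  "hausdorff_content s \<epsilon> A =
     (INF C \<in> {C :: nat \<Rightarrow> 'a set. A \<subseteq> (\<Union>i. C i) \<and> (\<forall>i. bounded (C i) \<and> diameter (C i) \<le> \<epsilon>)}.
        \<Sum>i. ennreal (unit_ball_vol (real s) * (diameter (C i) / 2) ^ s))"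

definition hausdorff_outer :: "nat \<Rightarrow> 'a::metric_space set \<Rightarrow> ennreal" where
  "hausdorff_outer s A = (SUP \<epsilon> \<in> {0<..}. hausdorff_content s \<epsilon> A)"

definition hausdorff :: "nat \<Rightarrow> 'a::metric_space measure" where
  "hausdorff s = measure_of UNIV (sets borel) (hausdorff_outer s)"

definition surf :: "(real ^ 'd) measure" where
  "surf = hausdorff (CARD('d) - 1)"


section \<open>Domains\<close>

definition C1_boundary :: "(real ^ 'd) set \<Rightarrow> bool" where
  "C1_boundary \<Omega> \<longleftrightarrow>
     (\<forall>x \<in> frontier \<Omega>. \<exists>U \<rho> \<rho>'. open U \<and> x \<in> U \<and>
        (\<forall>y \<in> U. GDERIV \<rho> y :> \<rho>' y \<and> \<rho>' y \<noteq> 0) \<and> continuous_on U \<rho>' \<and>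
        \<Omega> \<inter> U = {y \<in> U. \<rho> y < 0})"

definition convex_domain :: "(real ^ 'd) set \<Rightarrow> bool" where
  "convex_domain \<Omega> \<longleftrightarrow> \<Omega> \<noteq> {} \<and> open \<Omega> \<and> bounded \<Omega> \<and> convex \<Omega> \<and>
     (polytope (closure \<Omega>) \<or> C1_boundary \<Omega>)"

text \<open>
  For convex \<open>\<Omega>\<close> the outward unit normals at a boundary point are the unit supporting vectors.
  Where there are several of them (the edges of a polytope, a null set for the surface measure) the
  value is \<open>0\<close> by convention.
\<close>

definition outer_normal :: "(real ^ 'd) set \<Rightarrow> real ^ 'd \<Rightarrow> real ^ 'd" where
  "outer_normal \<Omega> x =
     (let P = (\<lambda>\<nu>. norm \<nu> = 1 \<and> (\<forall>y \<in> \<Omega>. \<nu> \<bullet> (y - x) \<le> 0))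
      in if \<exists>!\<nu>. P \<nu> then THE \<nu>. P \<nu> else 0)"


section \<open>Data of the discretisation\<close>

type_synonym 'd idx = "'d \<Rightarrow> int"

text \<open>
  A piecewise polynomial is a family of polynomial functions on the whole space, one for each
  (index of a) cell; \<open>u k\<close> is the extension of the restriction of \<open>u\<close> to the cell \<open>k\<close>.  The traces
  from the two sides of a facet are then the values of the two polynomials.
\<close>

type_synonym 'd pw = "'d idx \<Rightarrow> real ^ 'd \<Rightarrow> real"

record ('d::finite) cut_dg =
  Omega   :: "(real ^ 'd) set"                \<comment> \<open>\<open>\<Omega>\<close>\<close>
  flux    :: "real \<Rightarrow> real ^ 'd"              \<comment> \<open>\<open>F\<close>\<close>
  init    :: "real ^ 'd \<Rightarrow> real"              \<comment> \<open>\<open>u\<^sub>0\<close>\<close>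
  grid    :: "'d \<Rightarrow> int \<Rightarrow> real"              \<comment> \<open>grid coordinates in each direction\<close>
  msize   :: real                             \<comment> \<open>\<open>h\<close>\<close>
  frac    :: real                             \<comment> \<open>\<open>\<delta>\<close>\<close>
  macros  :: "'d idx set set"                 \<comment> \<open>macro-elements, as sets of cells\<close>
  deg     :: nat                              \<comment> \<open>\<open>r\<close>\<close>
  inflow  :: "(real ^ 'd) set"                \<comment> \<open>\<open>\<Gamma>\<^sup>-\<close>\<close>
  outflow :: "(real ^ 'd) set"                \<comment> \<open>\<open>\<Gamma>\<^sup>+\<close>\<close>
  period  :: "(real ^ 'd) set"                \<comment> \<open>part of \<open>\<Gamma>\<close> with periodic conditions\<close>
  datum   :: "real ^ 'd \<Rightarrow> real"              \<comment> \<open>\<open>g\<close>\<close>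
  partner :: "real ^ 'd \<Rightarrow> real ^ 'd"         \<comment> \<open>periodic identification of boundary points\<close>
  Cin     :: "'d idx \<Rightarrow> real"                 \<comment> \<open>\<open>C\<^sub>\<xi>\<close> on inflow interfaces\<close>
  gamma0  :: real
  gamma1  :: real
  lam     :: real                             \<comment> \<open>\<open>\<lambda>\<close>\<close>
  dt      :: real                             \<comment> \<open>\<open>\<Delta>t\<close>\<close>

abbreviation bdry :: "('d::finite, 'm) cut_dg_scheme \<Rightarrow> (real ^ 'd) set" where
  "bdry S \<equiv> frontier (Omega S)"

definition u_min :: "('d::finite) cut_dg \<Rightarrow> real" where
  "u_min S = (INF x \<in> Omega S. init S x)"

definition u_max :: "('d::finite) cut_dg \<Rightarrow> real" where
  "u_max S = (SUP x \<in> Omega S. init S x)"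


section \<open>Mesh and macro-elements\<close>

text \<open>
  The background mesh is a tensor-product grid, extended to the whole space (only the cells that
  meet \<open>\<Omega>\<close> are ever used).  Quasi-uniformity and shape regularity say that all edge lengths are
  comparable to \<open>h\<close>.
\<close>

definition background_mesh :: "('d::finite) cut_dg \<Rightarrow> bool" where
  "background_mesh S \<longleftrightarrow> 0 < msize S \<and>
     (\<exists>c > 0. \<forall>i j. c * msize S \<le> grid S i (j + 1) - grid S i j \<and>
                    grid S i (j + 1) - grid S i j \<le> msize S)"

definition cell :: "('d::finite) cut_dg \<Rightarrow> 'd idx \<Rightarrow> (real ^ 'd) set" where
  "cell S k = cbox (\<chi> i. grid S i (k i)) (\<chi> i. grid S i (k i + 1))"

definition active :: "('d::finite) cut_dg \<Rightarrow> 'd idx set" where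
  "active S = {k. cell S k \<inter> Omega S \<noteq> {}}"

definition cut_cells :: "('d::finite) cut_dg \<Rightarrow> 'd idx set" where
  "cut_cells S = {k \<in> active S. cell S k \<inter> bdry S \<noteq> {}}"

text \<open>\<open>next_cell k k'\<close>: the cells share a facet, and \<open>k'\<close> lies on its positive side.\<close>

definition next_cell :: "'d idx \<Rightarrow> 'd idx \<Rightarrow> bool" where
  "next_cell k k' \<longleftrightarrow> (\<exists>i. k' = k(i := k i + 1))"

definition adjacent :: "'d idx \<Rightarrow> 'd idx \<Rightarrow> bool" where
  "adjacent k k' \<longleftrightarrow> next_cell k k' \<or> next_cell k' k"

definition cut_ratio :: "('d::finite) cut_dg \<Rightarrow> 'd idx \<Rightarrow> real" where
  "cut_ratio S k = measure lborel (cell S k \<inter> Omega S) / measure lborel (cell S k)"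

definition macro_elements :: "('d::finite) cut_dg \<Rightarrow> bool" where
  "macro_elements S \<longleftrightarrow> 0 < frac S \<and> frac S \<le> 1 \<and> partition_on (active S) (macros S) \<and>
     (\<forall>M \<in> macros S. \<exists>k\<^sub>0 \<in> M. frac S \<le> cut_ratio S k\<^sub>0 \<and>
        (\<forall>k \<in> M - {k\<^sub>0}. cut_ratio S k < frac S \<and>
           (k\<^sub>0, k) \<in> {(k, k'). k \<in> M \<and> k' \<in> M \<and> adjacent k k'}\<^sup>*))"

definition macro_of :: "('d::finite) cut_dg \<Rightarrow> 'd idx \<Rightarrow> 'd idx set" where
  "macro_of S k = (THE M. M \<in> macros S \<and> k \<in> M)"

definition macro_region :: "('d::finite) cut_dg \<Rightarrow> 'd idx set \<Rightarrow> (real ^ 'd) set" where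
  "macro_region S M = (\<Union>k \<in> M. cell S k) \<inter> Omega S"

definition macro_vol :: "('d::finite) cut_dg \<Rightarrow> 'd idx set \<Rightarrow> real" where
  "macro_vol S M = measure lborel (macro_region S M)"


section \<open>Facets and interfaces\<close>

text \<open>
  \<open>Inner k k'\<close> is the cut facet \<open>K \<inter> K' \<inter> \<Omega>\<close> of two adjacent cells, oriented from \<open>k\<close> (the
  "\<open>-\<close>" side) to \<open>k'\<close> (the "\<open>+\<close>" side); \<open>Outer k\<close> is \<open>K \<inter> \<Gamma>\<close>.
\<close>

datatype 'd facet = Inner "'d idx" "'d idx" | Outer "'d idx"

primrec facet_set :: "('d::finite) cut_dg \<Rightarrow> 'd facet \<Rightarrow> (real ^ 'd) set" where
  "facet_set S (Inner k k') = cell S k \<inter> cell S k' \<inter> Omega S"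
| "facet_set S (Outer k) = cell S k \<inter> bdry S"

primrec normal :: "('d::finite) cut_dg \<Rightarrow> 'd facet \<Rightarrow> real ^ 'd \<Rightarrow> real ^ 'd" where
  "normal S (Inner k k') x = (\<chi> i. of_int (k' i - k i))"
| "normal S (Outer k) x = outer_normal (Omega S) x"

definition mesh_facets :: "('d::finite) cut_dg \<Rightarrow> 'd facet set" where
  "mesh_facets S = {Inner k k' | k k'. k \<in> active S \<and> k' \<in> active S \<and> next_cell k k'}
                 \<union> Outer ` cut_cells S"

definition inner_pairs :: "'d idx set \<Rightarrow> ('d idx \<times> 'd idx) set" where
  "inner_pairs M = {(k, k'). k \<in> M \<and> k' \<in> M \<and> next_cell k k'}"

text \<open>
  Interfaces of macro-elements: \<open>Shared M N\<close> is \<open>M \<inter> N \<inter> \<Omega>\<close> seen from \<open>M\<close> (the normal points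
  from \<open>M\<close> to \<open>N\<close>), \<open>OnBdry k\<close> is \<open>K \<inter> \<Gamma>\<close>.  The intersection of two macro-elements may consist of
  several mesh facets with different normals; it is a union of facets that overlap in null
  sets only, and integrals over it are sums over these facets.
\<close>

datatype 'd face = Shared "'d idx set" "'d idx set" | OnBdry "'d idx"

primrec facets_of :: "'d face \<Rightarrow> 'd facet set" where
  "facets_of (Shared M N) = {Inner k k' | k k'. k \<in> M \<and> k' \<in> N \<and> adjacent k k'}"
| "facets_of (OnBdry k) = {Outer k}"

definition faces :: "('d::finite) cut_dg \<Rightarrow> 'd idx set \<Rightarrow> 'd face set" where
  "faces S M = {Shared M N | N. N \<in> macros S \<and> N \<noteq> M \<and> facets_of (Shared M N) \<noteq> {}}
             \<union> OnBdry ` (M \<inter> cut_cells S)"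

definition face_integral ::
    "('d::finite) cut_dg \<Rightarrow> 'd face \<Rightarrow> ('d facet \<Rightarrow> real ^ 'd \<Rightarrow> real) \<Rightarrow> real" where
  "face_integral S \<xi> f = (\<Sum>e \<in> facets_of \<xi>. LINT x:facet_set S e|surf. f e x)"

definition face_area :: "('d::finite) cut_dg \<Rightarrow> 'd face \<Rightarrow> real" where
  "face_area S \<xi> = face_integral S \<xi> (\<lambda>e x. 1)"

definition perimeter :: "('d::finite) cut_dg \<Rightarrow> 'd idx set \<Rightarrow> real" where
  "perimeter S M = (\<Sum>\<xi> \<in> faces S M. face_area S \<xi>)"


section \<open>Discrete space and mean values\<close>

definition polys :: "nat \<Rightarrow> (real ^ 'd \<Rightarrow> real) set" where
  "polys r = {p. \<exists>c. \<forall>x. p x =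
     (\<Sum>\<alpha> \<in> {\<alpha> :: 'd \<Rightarrow> nat. (\<Sum>i \<in> UNIV. \<alpha> i) \<le> r}. c \<alpha> * (\<Prod>i \<in> UNIV. x $ i ^ \<alpha> i))}"

definition Vh :: "('d::finite) cut_dg \<Rightarrow> 'd pw set" where
  "Vh S = {v. \<forall>k \<in> active S. v k \<in> polys (deg S)}"

definition mean :: "('d::finite) cut_dg \<Rightarrow> 'd pw \<Rightarrow> 'd idx set \<Rightarrow> real" where
  "mean S u M = (\<Sum>k \<in> M. LINT x:cell S k \<inter> Omega S|lborel. u k x) / macro_vol S M"

definition mean_fun :: "('d::finite) cut_dg \<Rightarrow> 'd pw \<Rightarrow> 'd pw" where
  "mean_fun S u = (\<lambda>k x. mean S u (macro_of S k))"


section \<open>Boundary conditions and traces\<close>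

text \<open>
  The periodic part of the boundary carries an identification by finitely many translations of
  pieces with opposite normals.
\<close>

definition boundary_conditions :: "('d::finite) cut_dg \<Rightarrow> bool" where
  "boundary_conditions S \<longleftrightarrow>
     inflow S \<union> outflow S \<union> period S = bdry S \<and>
     inflow S \<inter> outflow S = {} \<and> inflow S \<inter> period S = {} \<and> outflow S \<inter> period S = {} \<and>
     inflow S \<in> sets borel \<and> outflow S \<in> sets borel \<and> period S \<in> sets borel \<and>
     datum S \<in> borel_measurable (restrict_space borel (inflow S)) \<and>
     partner S \<in> borel_measurable (restrict_space borel (period S)) \<and>
     (\<forall>x \<in> period S. partner S x \<in> period S \<and> partner S (partner S x) = x \<and>
        outer_normal (Omega S) (partner S x) = - outer_normal (Omega S) x) \<and>
     finite ((\<lambda>x. partner S x - x) ` period S)"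

definition cell_at :: "('d::finite) cut_dg \<Rightarrow> real ^ 'd \<Rightarrow> 'd idx" where
  "cell_at S x = (SOME k. k \<in> active S \<and> x \<in> cell S k)"

primrec trace_in :: "'d pw \<Rightarrow> 'd facet \<Rightarrow> real ^ 'd \<Rightarrow> real" where
  "trace_in u (Inner k k') x = u k x"
| "trace_in u (Outer k) x = u k x"

primrec trace_out :: "('d::finite) cut_dg \<Rightarrow> 'd pw \<Rightarrow> 'd facet \<Rightarrow> real ^ 'd \<Rightarrow> real" where
  "trace_out S u (Inner k k') x = u k' x"
| "trace_out S u (Outer k) x =
     (if x \<in> inflow S then datum S x
      else if x \<in> period S then u (cell_at S (partner S x)) (partner S x)
      else u k x)"

text \<open>Jump of a test function, whose exterior trace on \<open>\<Gamma>\<close> is \<open>0\<close>.\<close>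

primrec test_jump :: "'d pw \<Rightarrow> 'd facet \<Rightarrow> real ^ 'd \<Rightarrow> real" where
  "test_jump v (Inner k k') x = v k' x - v k x"
| "test_jump v (Outer k) x = 0 - v k x"


section \<open>Numerical fluxes\<close>

definition speed :: "('d::finite) cut_dg \<Rightarrow> real ^ 'd \<Rightarrow> real \<Rightarrow> real" where
  "speed S n v = \<bar>vector_derivative (flux S) (at v) \<bullet> n\<bar>"

definition max_speed :: "('d::finite) cut_dg \<Rightarrow> real ^ 'd \<Rightarrow> real \<Rightarrow> real \<Rightarrow> real" where
  "max_speed S n a b = (SUP v \<in> closed_segment a b. speed S n v)"

definition lax_friedrichs ::
    "('d::finite) cut_dg \<Rightarrow> real \<Rightarrow> real ^ 'd \<Rightarrow> real \<Rightarrow> real \<Rightarrow> real" where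
  "lax_friedrichs S l n a b = (1/2) * ((flux S a + flux S b) \<bullet> n) - l / 2 * (b - a)"

definition low_flux :: "('d::finite) cut_dg \<Rightarrow> 'd pw \<Rightarrow> 'd facet \<Rightarrow> real ^ 'd \<Rightarrow> real" where
  "low_flux S u e x =
     (let w = mean_fun S u
      in lax_friedrichs S (lam S) (normal S e x) (trace_in w e x) (trace_out S w e x))"

primrec C_facet :: "('d::finite) cut_dg \<Rightarrow> 'd facet \<Rightarrow> real ^ 'd \<Rightarrow> real" where
  "C_facet S (Inner k k') x = 1"
| "C_facet S (Outer k) x = (if x \<in> inflow S then Cin S k else 1)"

definition num_flux :: "('d::finite) cut_dg \<Rightarrow> 'd pw \<Rightarrow> 'd facet \<Rightarrow> real ^ 'd \<Rightarrow> real" where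
  "num_flux S u e x =
     (let n = normal S e x; a = trace_in u e x; b = trace_out S u e x
      in lax_friedrichs S (C_facet S e x * max_speed S n a b) n a b)"


section \<open>The semi-discrete operator\<close>

definition dir_deriv :: "nat \<Rightarrow> real ^ 'd \<Rightarrow> (real ^ 'd \<Rightarrow> real) \<Rightarrow> real ^ 'd \<Rightarrow> real" where
  "dir_deriv j n p x = (deriv ^^ j) (\<lambda>t. p (x + t *\<^sub>R n)) 0"

definition grad :: "(real ^ 'd \<Rightarrow> real) \<Rightarrow> real ^ 'd \<Rightarrow> real ^ 'd" where
  "grad p x = (\<chi> i. dir_deriv 1 (axis i 1) p x)"

definition inner_prod :: "('d::finite) cut_dg \<Rightarrow> 'd pw \<Rightarrow> 'd pw \<Rightarrow> real" where
  "inner_prod S u v = (\<Sum>k \<in> active S. LINT x:cell S k \<inter> Omega S|lborel. u k x * v k x)"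

definition a_form :: "('d::finite) cut_dg \<Rightarrow> 'd pw \<Rightarrow> 'd pw \<Rightarrow> real" where
  "a_form S u v =
     - (\<Sum>k \<in> active S. LINT x:cell S k \<inter> Omega S|lborel. flux S (u k x) \<bullet> grad (v k) x)
     - (\<Sum>e \<in> mesh_facets S. LINT x:facet_set S e|surf. num_flux S u e x * test_jump v e x)"

definition alpha_macro :: "('d::finite) cut_dg \<Rightarrow> 'd pw \<Rightarrow> 'd idx set \<Rightarrow> real" where
  "alpha_macro S u M =
     (SUP ((k, k'), x) \<in> {((k, k'), x). (k, k') \<in> inner_pairs M \<and> x \<in> facet_set S (Inner k k')}.
        max_speed S (normal S (Inner k k') x) (u k x) (u k' x))"

definition jump_deriv ::
    "('d::finite) cut_dg \<Rightarrow> nat \<Rightarrow> 'd pw \<Rightarrow> 'd idx \<Rightarrow> 'd idx \<Rightarrow> real ^ 'd \<Rightarrow> real" where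
  "jump_deriv S j u k k' x =
     (let n = normal S (Inner k k') x in dir_deriv j n (u k') x - dir_deriv j n (u k) x)"

text \<open>The stabilisation acts on the full facets, not only on their parts inside \<open>\<Omega>\<close>.\<close>

definition s_form :: "('d::finite) cut_dg \<Rightarrow> nat \<Rightarrow> 'd pw \<Rightarrow> 'd pw \<Rightarrow> real" where
  "s_form S m u v =
     (\<Sum>M \<in> macros S. \<Sum>(k, k') \<in> inner_pairs M. alpha_macro S u M ^ (1 - m) *
        (\<Sum>j \<le> deg S. msize S ^ (2 * j + m) / ((2 * real j + 1) * (fact j)\<^sup>2) *
           (LINT x:cell S k \<inter> cell S k'|surf. jump_deriv S j u k k' x * jump_deriv S j v k k' x)))"

text \<open>\<open>is_L S u w\<close>: the function \<open>w\<close> is \<open>L(u)\<close>.\<close>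

definition is_L :: "('d::finite) cut_dg \<Rightarrow> 'd pw \<Rightarrow> 'd pw \<Rightarrow> bool" where
  "is_L S u w \<longleftrightarrow> w \<in> Vh S \<and>
     (\<forall>v \<in> Vh S. inner_prod S w v + gamma1 S * s_form S 1 w v = - a_form S u v - gamma0 S * s_form S 0 u v)"

text \<open>The two admissible choices: forward Euler, and third-order SSP Runge--Kutta.\<close>

definition high_flux ::
    "('d::finite) cut_dg \<Rightarrow> 'd pw \<Rightarrow> ('d facet \<Rightarrow> real ^ 'd \<Rightarrow> real) \<Rightarrow> bool" where
  "high_flux S u FH \<longleftrightarrow>
     FH = num_flux S u \<or>
     (\<exists>w w1 u1 u2. is_L S u w \<and> u1 = (\<lambda>k x. u k x + dt S * w k x) \<and>
        is_L S u1 w1 \<and> u2 = (\<lambda>k x. u k x + 1/4 * dt S * (w k x + w1 k x)) \<and>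
        FH = (\<lambda>e x. 1/6 * num_flux S u e x + 1/6 * num_flux S u1 e x + 4/6 * num_flux S u2 e x))"


section \<open>Limiter\<close>

definition low_total :: "('d::finite) cut_dg \<Rightarrow> 'd pw \<Rightarrow> 'd idx set \<Rightarrow> real" where
  "low_total S u M = (\<Sum>\<xi> \<in> faces S M. face_integral S \<xi> (low_flux S u))"

definition B_min :: "('d::finite) cut_dg \<Rightarrow> 'd pw \<Rightarrow> 'd idx set \<Rightarrow> real" where
  "B_min S u M = mean S u M - dt S / macro_vol S M * low_total S u M - u_min S"

definition B_max :: "('d::finite) cut_dg \<Rightarrow> 'd pw \<Rightarrow> 'd idx set \<Rightarrow> real" where
  "B_max S u M = u_max S - mean S u M + dt S / macro_vol S M * low_total S u M"

context
  fixes S :: "('d::finite) cut_dg" and u :: "'d pw" and FH :: "'d facet \<Rightarrow> real ^ 'd \<Rightarrow> real"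
begin

definition beta :: "'d face \<Rightarrow> real" where
  "beta \<xi> = face_integral S \<xi> (\<lambda>e x. FH e x - low_flux S u e x)"

definition C_min :: "'d idx set \<Rightarrow> real" where
  "C_min M = dt S / macro_vol S M * (\<Sum>\<xi> \<in> faces S M. max (beta \<xi>) 0)"

definition C_max :: "'d idx set \<Rightarrow> real" where
  "C_max M = dt S / macro_vol S M * (\<Sum>\<xi> \<in> faces S M. max (- beta \<xi>) 0)"

definition Lambda_min :: "'d idx set \<Rightarrow> 'd face \<Rightarrow> real" where
  "Lambda_min M \<xi> = (if beta \<xi> \<ge> 0 then min 1 (B_min S u M / (C_min M + 1 / 10 ^ 40)) else 1)"

definition Lambda_max :: "'d idx set \<Rightarrow> 'd face \<Rightarrow> real" where
  "Lambda_max M \<xi> = (if beta \<xi> \<le> 0 then min 1 (B_max S u M / (C_max M + 1 / 10 ^ 40)) else 1)"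

definition theta_macro :: "'d idx set \<Rightarrow> 'd face \<Rightarrow> real" where
  "theta_macro M \<xi> = min (Lambda_min M \<xi>) (Lambda_max M \<xi>)"

text \<open>
  Seen from \<open>N\<close>, the interface \<open>Shared M N\<close> is \<open>Shared N M\<close>, with the opposite normal.
\<close>

primrec theta :: "'d face \<Rightarrow> real" where
  "theta (Shared M N) = min (theta_macro M (Shared M N)) (theta_macro N (Shared N M))"
| "theta (OnBdry k) = theta_macro (macro_of S k) (OnBdry k)"

definition mpp_flux :: "'d face \<Rightarrow> 'd facet \<Rightarrow> real ^ 'd \<Rightarrow> real" where
  "mpp_flux \<xi> e x = theta \<xi> * FH e x + (1 - theta \<xi>) * low_flux S u e x"

definition mpp_update :: "'d idx set \<Rightarrow> real" where
  "mpp_update M = mean S u M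
     - dt S / macro_vol S M * (\<Sum>\<xi> \<in> faces S M. face_integral S \<xi> (mpp_flux \<xi>))"

end

end

theory Submission
  imports Defs
begin

text \<open>
  The update of a macro-element is its low-order update minus a multiple of the sum of the limited
  corrections \<open>\<theta>\<^sub>\<xi> \<beta>\<^sub>\<xi>\<close>. The numbers \<open>B_min\<close> and \<open>B_max\<close> are the distances of the low-order
  update from the two bounds, and \<open>\<theta>\<^sub>\<xi>\<close> is chosen so that the corrections of one sign use up at most
  this distance (\<open>limited_sum_le\<close>). What has to be shown is that the distances are nonnegative, that is,
  that the low-order scheme obeys the maximum principle (\<open>low_order_bounds\<close>).

  Let \<open>a\<close> be the mean value in the macro-element. The Lax--Friedrichs flux through a facet minus
  \<open>n \<bullet> F a\<close> lies between \<open>- \<lambda> (u\<^sub>m\<^sub>a\<^sub>x - a)\<close> and \<open>\<lambda> (a - u\<^sub>m\<^sub>i\<^sub>n)\<close>, because \<open>\<lambda>\<close> bounds the wave speeds.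
  Integrated over the surface, with the time step restriction, this is the maximum principle, provided
  that subtracting \<open>n \<bullet> F a\<close> does not change the total flux. The integral of the normal over the surface of
  a macro-element must therefore vanish (\<open>macro_balance\<close>). Here the surface measure is a Hausdorff measure
  and the domain is a general convex set cut by a grid, and most of the work goes into this identity.

  It is proved for the boundary of every bounded convex open set \<open>C\<close> (\<open>closed_surface_integral\<close>). For a
  unit vector \<open>v\<close>, the integral of \<open>n \<bullet> v\<close> over the part of the boundary where it is positive is the area of
  the shadow of \<open>C\<close> in the direction \<open>v\<close>, and the part where it is negative gives minus the area of the same
  shadow. That the integral is the area of a projection is exact for hyperplanes
  (\<open>measure_surf_proj_along\<close>); there surface measure is proportional to Lebesgue measure by the uniqueness
  of invariant measures, and as the factor is the same for all hyperplanes, it cancels. The general case follows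
  by approximation: where the normals lie within \<open>\<epsilon>\<close> of a vector \<open>p\<close>, convexity forces the boundary to be
  flat up to \<open>\<epsilon>\<close> (\<open>gauss_preimage_flat\<close>), and the projection to the hyperplane of \<open>p\<close> is nearly isometric.
  The same idea shows that points with several normals form a null set (\<open>surf_ridge_null\<close>).

  Applied to the intersection of the domain with the interior of a cell, the identity gives the balance of a
  cut cell (\<open>cut_box_surface_integral\<close>), and in the sum over the cells of a macro-element the
  facets in its interior cancel. Finally, all fluxes are integrable over all facets
  (\<open>fluxes_integrable\<close>, \<open>high_flux_integrable\<close>), so that the integrals may be split.
\<close>

section \<open>Surface measure under Lipschitz maps\<close>

text \<open>
  Images of a covering of \<open>A\<close> cover \<open>f ` A\<close>, and each diameter grows by a factor of at most \<open>L\<close>.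
\<close>

lemma hausdorff_content_lipschitz_image:
  fixes f :: "'a::metric_space \<Rightarrow> 'b::metric_space"
  assumes s: "1 \<le> s" and L: "0 < L"
    and lip: "\<And>x y. \<lbrakk>x \<in> A; y \<in> A\<rbrakk> \<Longrightarrow> dist (f x) (f y) \<le> L * dist x y"
  shows "hausdorff_content s (L * \<epsilon>) (f ` A) \<le> ennreal (L ^ s) * hausdorff_content s \<epsilon> A"
proof -
  let ?V = "unit_ball_vol (real s)"
  let ?covers = "\<lambda>\<epsilon> A. {C :: nat \<Rightarrow> _ set. A \<subseteq> (\<Union>i. C i) \<and> (\<forall>i. bounded (C i) \<and> diameter (C i) \<le> \<epsilon>)}"
  have "hausdorff_content s (L * \<epsilon>) (f ` A) / ennreal (L ^ s)
      \<le> (\<Sum>i. ennreal (?V * (diameter (C i) / 2) ^ s))" if C: "C \<in> ?covers \<epsilon> A" for C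
  proof -
    \<comment> \<open>Intersecting with \<open>A\<close> first, because \<open>f\<close> is Lipschitz on \<open>A\<close> only.\<close>
    define D where "D i = f ` (C i \<inter> A)" for i
    have bD: "bounded (D i)" and dD: "diameter (D i) \<le> L * diameter (C i)" for i
    proof -
      have *: "dist (f x) (f y) \<le> L * diameter (C i)" if "x \<in> C i \<inter> A" "y \<in> C i \<inter> A" for x y
      proof -
        have "dist (f x) (f y) \<le> L * dist x y" using lip that by auto
        also have "\<dots> \<le> L * diameter (C i)"
          using C that L by (intro mult_left_mono diameter_bounded_bound) auto
        finally show ?thesis .
      qed
      show "bounded (D i)"
        unfolding D_def bounded_two_points using * by (intro exI[of _ "L * diameter (C i)"]) auto
      have "0 \<le> L * diameter (C i)" using L C by (auto intro!: mult_nonneg_nonneg diameter_ge_0)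
      then show "diameter (D i) \<le> L * diameter (C i)"
        unfolding diameter_def[of "D i"] using * by (auto intro!: cSUP_least simp: D_def)
    qed
    have "D \<in> ?covers (L * \<epsilon>) (f ` A)"
    proof -
      have "f ` A \<subseteq> (\<Union>i. D i)" using C unfolding D_def by blast
      moreover have "diameter (D i) \<le> L * \<epsilon>" for i
        using dD[of i] C L by (auto intro: order_trans[OF _ mult_left_mono])
      ultimately show ?thesis using bD by auto
    qed
    then have "hausdorff_content s (L * \<epsilon>) (f ` A) \<le> (\<Sum>i. ennreal (?V * (diameter (D i) / 2) ^ s))"
      unfolding hausdorff_content_def by (rule INF_lower)
    also have "\<dots> \<le> (\<Sum>i. ennreal (L ^ s) * ennreal (?V * (diameter (C i) / 2) ^ s))"
    proof (intro suminf_le summableI)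
      fix i
      have "?V * (diameter (D i) / 2) ^ s \<le> ?V * (L * diameter (C i) / 2) ^ s"
        using dD[of i] bD[of i]
        by (intro mult_left_mono power_mono divide_right_mono divide_nonneg_nonneg diameter_ge_0) auto
      also have "\<dots> = L ^ s * (?V * (diameter (C i) / 2) ^ s)"
        by (simp add: power_mult_distrib power_divide)
      finally show "ennreal (?V * (diameter (D i) / 2) ^ s)
          \<le> ennreal (L ^ s) * ennreal (?V * (diameter (C i) / 2) ^ s)"
        using L C
        by (subst ennreal_mult[symmetric])
          (auto intro!: ennreal_leI mult_nonneg_nonneg zero_le_power divide_nonneg_nonneg diameter_ge_0 simp del: power_divide)
    qed
    also have "\<dots> = ennreal (L ^ s) * (\<Sum>i. ennreal (?V * (diameter (C i) / 2) ^ s))"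
      by (rule ennreal_suminf_cmult)
    finally show ?thesis
      using L by (subst divide_le_posI_ennreal) (auto simp: mult.commute)
  qed
  then have "hausdorff_content s (L * \<epsilon>) (f ` A) / ennreal (L ^ s) \<le> hausdorff_content s \<epsilon> A"
    unfolding hausdorff_content_def[of s \<epsilon> A] by (intro INF_greatest)
  then have "ennreal (L ^ s) * (hausdorff_content s (L * \<epsilon>) (f ` A) / ennreal (L ^ s))
      \<le> ennreal (L ^ s) * hausdorff_content s \<epsilon> A"
    by (intro mult_left_mono) auto
  then show ?thesis
    using L mult_divide_eq_ennreal[of "ennreal (L ^ s)" "hausdorff_content s (L * \<epsilon>) (f ` A)"]
    by (simp add: ennreal_times_divide mult.commute[of "ennreal (L ^ s)" "hausdorff_content s (L * \<epsilon>) (f ` A)"])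
qed

lemma hausdorff_outer_lipschitz_image:
  fixes f :: "'a::metric_space \<Rightarrow> 'b::metric_space"
  assumes s: "1 \<le> s" and L: "0 < L"
    and lip: "\<And>x y. \<lbrakk>x \<in> A; y \<in> A\<rbrakk> \<Longrightarrow> dist (f x) (f y) \<le> L * dist x y"
  shows "hausdorff_outer s (f ` A) \<le> ennreal (L ^ s) * hausdorff_outer s A"
  unfolding hausdorff_outer_def[of s "f ` A"]
proof (rule SUP_least)
  fix \<epsilon> :: real assume "\<epsilon> \<in> {0<..}"
  then have "\<epsilon> / L \<in> {0<..}" using L by auto
  have "hausdorff_content s \<epsilon> (f ` A) = hausdorff_content s (L * (\<epsilon> / L)) (f ` A)" using L by simp
  also have "\<dots> \<le> ennreal (L ^ s) * hausdorff_content s (\<epsilon> / L) A"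
    by (rule hausdorff_content_lipschitz_image[OF s L lip])
  also have "\<dots> \<le> ennreal (L ^ s) * hausdorff_outer s A"
    unfolding hausdorff_outer_def using \<open>\<epsilon> / L \<in> _\<close> by (intro mult_left_mono SUP_upper) auto
  finally show "hausdorff_content s \<epsilon> (f ` A) \<le> ennreal (L ^ s) * hausdorff_outer s A" .
qed

lemma hausdorff_content_le_finite_cover:
  fixes A :: "'a::metric_space set"
  assumes s: "1 \<le> s" and fin: "finite J" and cov: "A \<subseteq> (\<Union>j\<in>J. C j)"
    and C: "\<And>j. j \<in> J \<Longrightarrow> bounded (C j) \<and> diameter (C j) \<le> \<epsilon>" and "0 \<le> \<epsilon>"
  shows "hausdorff_content s \<epsilon> A \<le> ennreal (real (card J) * (unit_ball_vol (real s) * (\<epsilon> / 2) ^ s))"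
proof -
  let ?V = "unit_ball_vol (real s)"
  obtain h where h: "bij_betw h {..<card J} J"
    using fin ex_bij_betw_nat_finite atLeast0LessThan by metis
  define D where "D i = (if i < card J then C (h i) else {})" for i
  have hJ: "h i \<in> J" if "i < card J" for i using h that by (auto simp: bij_betw_def)
  have "J = h ` {..<card J}" using h by (auto simp: bij_betw_def)
  then have "(\<Union>j\<in>J. C j) = (\<Union>i<card J. C (h i))" by (metis image_image)
  also have "\<dots> = (\<Union>i. D i)" by (auto simp: D_def split: if_splits)
  finally have "A \<subseteq> (\<Union>i. D i)" using cov by auto
  then have "hausdorff_content s \<epsilon> A \<le> (\<Sum>i. ennreal (?V * (diameter (D i) / 2) ^ s))"
    unfolding hausdorff_content_def using C hJ \<open>0 \<le> \<epsilon>\<close> by (intro INF_lower) (auto simp: D_def)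
  also have "\<dots> = (\<Sum>i<card J. ennreal (?V * (diameter (D i) / 2) ^ s))"
    using s by (intro suminf_finite) (auto simp: D_def power_0_left)
  also have "\<dots> \<le> (\<Sum>i<card J. ennreal (?V * (\<epsilon> / 2) ^ s))"
    using C hJ
    by (intro sum_mono ennreal_leI mult_left_mono power_mono divide_right_mono) (auto simp: D_def diameter_ge_0)
  also have "\<dots> = ennreal (real (card J) * (?V * (\<epsilon> / 2) ^ s))"
    using \<open>0 \<le> \<epsilon>\<close> by (simp add: ennreal_mult ennreal_of_nat_eq_real_of_nat)
  finally show ?thesis .
qed

text \<open>
  For small cubes the sums over coverings by a regular grid do not depend on the mesh width: in a
  hyperplane the number of cubes grows with exactly the power with which their weight decreases.
\<close>

lemma hausdorff_outer_hyperplane_finite: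
  fixes i :: "'d::finite"
  assumes d: "CARD('d) \<ge> 2" and R: "0 < R" and A: "A \<subseteq> {x::real^'d. x $ i = 0 \<and> (\<forall>j. \<bar>x $ j\<bar> \<le> R)}"
  shows "hausdorff_outer (CARD('d) - 1) A < \<infinity>"
proof -
  define s where "s = CARD('d) - 1"
  let ?V = "unit_ball_vol (real s)" and ?d = "real CARD('d)"
  have s: "1 \<le> s" using d by (auto simp: s_def)
  have "hausdorff_outer s A \<le> ennreal (?V * (3 * ?d * R / 2) ^ s)"
    unfolding hausdorff_outer_def
  proof (rule SUP_least)
    fix \<epsilon> :: real assume e: "\<epsilon> \<in> {0<..}"
    obtain m :: nat where m: "?d * R / \<epsilon> < real m" using reals_Archimedean2 by blast
    define n where "n = Suc m"
    have n: "0 < n" and "?d * R / real n \<le> \<epsilon>"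
    proof -
      show "0 < n" by (simp add: n_def)
      have "?d * R < real n * \<epsilon>" using m e by (simp add: n_def pos_divide_less_eq algebra_simps)
      then show "?d * R / real n \<le> \<epsilon>" using \<open>0 < n\<close> by (simp add: field_simps)
    qed
    \<comment> \<open>The grid cells of side \<open>R / n\<close>: there are \<open>(2 n + 1) ^ (d - 1)\<close> of them, of
      diameter at most \<open>d R / n\<close>, so that the sums over these coverings stay bounded as \<open>n\<close> grows.\<close>
    define J where "J = PiE (UNIV - {i}) (\<lambda>_. {- int n..int n})"
    define C where "C g = {x \<in> A. \<forall>j. j \<noteq> i \<longrightarrow> \<lfloor>real n * x $ j / R\<rfloor> = g j}" for g
    have dC: "norm (x - y) \<le> ?d * R / real n" if "x \<in> C g" "y \<in> C g" for x y g
    proof -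
      have "\<bar>(x - y) $ j\<bar> \<le> R / real n" for j
      proof (cases "j = i")
        case True
        have "x $ i = 0" "y $ i = 0" using that A by (auto simp: C_def)
        then show ?thesis using True R by simp
      next
        case False
        then have "\<lfloor>real n * x $ j / R\<rfloor> = \<lfloor>real n * y $ j / R\<rfloor>" using that by (auto simp: C_def)
        then have "\<bar>real n * x $ j / R - real n * y $ j / R\<bar> \<le> 1" by linarith
        then have "real n / R * \<bar>(x - y) $ j\<bar> \<le> 1" using n R
          by (simp add: abs_mult flip: diff_divide_distrib right_diff_distrib)
        then show ?thesis using n R by (simp add: field_simps)
      qed
      then have "(\<Sum>j\<in>UNIV. \<bar>(x - y) $ j\<bar>) \<le> (\<Sum>j\<in>(UNIV::'d set). R / real n)" by (intro sum_mono)
      then show ?thesis using norm_le_l1_cart[of "x - y"] by simp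
    qed
    have "hausdorff_content s \<epsilon> A \<le> hausdorff_content s (?d * R / real n) A"
      unfolding hausdorff_content_def
    proof (rule INF_superset_mono[OF _ order_refl], rule Collect_mono, intro impI)
      fix C :: "nat \<Rightarrow> (real^'d) set"
      assume C: "A \<subseteq> (\<Union>i. C i) \<and> (\<forall>i. bounded (C i) \<and> diameter (C i) \<le> ?d * R / real n)"
      then have "diameter (C i) \<le> \<epsilon>" for i using \<open>?d * R / real n \<le> \<epsilon>\<close> order_trans by blast
      then show "A \<subseteq> (\<Union>i. C i) \<and> (\<forall>i. bounded (C i) \<and> diameter (C i) \<le> \<epsilon>)" using C by blast
    qed
    also have "\<dots> \<le> ennreal (real (card J) * (?V * ((?d * R / real n) / 2) ^ s))"
    proof (rule hausdorff_content_le_finite_cover[OF s, of J A C])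
      show "finite J" by (auto simp: J_def intro: finite_PiE)
      show "0 \<le> ?d * R / real n" using R by auto
      show "A \<subseteq> (\<Union>g\<in>J. C g)"
      proof
        fix x assume x: "x \<in> A"
        define g where "g = restrict (\<lambda>j. \<lfloor>real n * x $ j / R\<rfloor>) (UNIV - {i})"
        have floor_range: "\<lfloor>t\<rfloor> \<in> {- int n..int n}" if "\<bar>t\<bar> \<le> real n" for t :: real
        proof -
          have "real_of_int (- int n) \<le> t" "t < real_of_int (int n) + 1" using that by auto
          then show ?thesis by (simp only: atLeastAtMost_iff le_floor_iff floor_le_iff)
        qed
        have "\<lfloor>real n * x $ j / R\<rfloor> \<in> {- int n..int n}" for j
        proof (rule floor_range)
          have "\<bar>x $ j\<bar> \<le> R" using x A by auto
          then show "\<bar>real n * x $ j / R\<bar> \<le> real n"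
            using R by (simp add: abs_mult divide_le_eq mult_left_mono)
        qed
        then have "g \<in> J" by (auto simp: J_def g_def)
        moreover have "x \<in> C g" using x by (auto simp: C_def g_def)
        ultimately show "x \<in> (\<Union>g\<in>J. C g)" by blast
      qed
      show "bounded (C g) \<and> diameter (C g) \<le> ?d * R / real n" if "g \<in> J" for g
      proof
        show "bounded (C g)" unfolding bounded_two_points dist_norm using dC by blast
        show "diameter (C g) \<le> ?d * R / real n" using dC R by (intro diameter_le) auto
      qed
    qed
    also have "\<dots> \<le> ennreal (?V * (3 * ?d * R / 2) ^ s)"
    proof (rule ennreal_leI)
      have "card {- int n..int n} = 2 * n + 1" by (subst card_atLeastAtMost_int) linarith
      then have "card J = (2 * n + 1) ^ s" by (simp add: J_def card_PiE s_def card_Diff_singleton)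
      also have "\<dots> \<le> (3 * n) ^ s" using n by (intro power_mono) auto
      finally have "real (card J) \<le> (3 * real n) ^ s" by (metis of_nat_le_iff of_nat_mult of_nat_numeral of_nat_power)
      then have "real (card J) * (?V * ((?d * R / real n) / 2) ^ s) \<le> (3 * real n) ^ s * (?V * ((?d * R / real n) / 2) ^ s)"
        using R by (intro mult_right_mono) auto
      also have "\<dots> = ?V * (3 * ?d * R / 2) ^ s"
        using n by (simp add: power_mult_distrib power_divide)
      finally show "real (card J) * (?V * ((?d * R / real n) / 2) ^ s) \<le> ?V * (3 * ?d * R / 2) ^ s" .
    qed
    finally show "hausdorff_content s \<epsilon> A \<le> ennreal (?V * (3 * ?d * R / 2) ^ s)" .
  qed
  also have "\<dots> < \<infinity>" by simp
  finally show ?thesis by (simp add: s_def)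
qed

lemma space_surf [simp]: "space surf = UNIV"
  by (simp add: surf_def hausdorff_def)

lemma sets_surf [measurable_cong, simp]: "sets surf = sets borel"
  using sets.sigma_sets_eq[of "borel :: (real^'d) measure"]
  by (simp add: surf_def hausdorff_def sets_measure_of_conv)

text \<open>
  The command \<open>measure_of\<close> returns the given set function on the Borel sets if that function is
  countably additive there, and the zero measure otherwise. Lipschitz estimates and finiteness
  pass to \<open>surf\<close> in both cases.
\<close>

lemma emeasure_surf:
  "(\<forall>A\<in>sets borel. emeasure surf (A::(real^'d) set) = hausdorff_outer (CARD('d) - 1) A)
   \<or> (\<forall>A. emeasure surf (A::(real^'d) set) = 0)"
  using sets.sigma_sets_eq[of "borel :: (real^'d) measure"]
  by (simp add: surf_def hausdorff_def emeasure_measure_of_conv)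

lemma surf_lipschitz_image:
  fixes f :: "real^'d \<Rightarrow> real^'d"
  assumes d: "CARD('d) \<ge> 2" and L: "0 < L"
    and A: "A \<in> sets borel" and fA: "f ` A \<in> sets borel"
    and lip: "\<And>x y. \<lbrakk>x \<in> A; y \<in> A\<rbrakk> \<Longrightarrow> norm (f x - f y) \<le> L * norm (x - y)"
  shows "emeasure surf (f ` A) \<le> ennreal (L ^ (CARD('d) - 1)) * emeasure surf A"
  using emeasure_surf[where 'd='d]
    hausdorff_outer_lipschitz_image[OF _ L lip[folded dist_norm], of "CARD('d) - 1" A] d A fA
  by auto

section \<open>Surface measure on hyperplanes\<close>

definition perp :: "real^'n \<Rightarrow> (real^'n) set" where
  "perp p = {x. p \<bullet> x = 0}"

lemma closed_perp: "closed (perp p)"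
  by (simp add: perp_def closed_hyperplane)

lemma perp_borel [measurable]: "perp p \<in> sets borel"
  by (simp add: closed_perp borel_closed)

text \<open>
  The half-open cylinder over \<open>B\<close> with generator \<open>v\<close>. Its volume measures \<open>B\<close> inside a hyperplane
  by means of Lebesgue measure on the whole space.
\<close>

definition cyl :: "(real^'n) set \<Rightarrow> real^'n \<Rightarrow> (real^'n) set" where
  "cyl B v = {b + t *\<^sub>R v | b t. b \<in> B \<and> 0 \<le> t \<and> t < 1}"

text \<open>
  The case \<open>p = 0\<close>, where the hyperplane is the whole space and the cylinder over \<open>B\<close> is \<open>B\<close>, is
  included so that the uniqueness argument for invariant measures covers hyperplanes and the whole
  space at once.
\<close>

lemma mem_cyl_iff:
  assumes "B \<subseteq> perp p" "p \<bullet> v \<noteq> 0 \<or> p = 0 \<and> v = 0"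
  shows "x \<in> cyl B v \<longleftrightarrow> 0 \<le> p \<bullet> x / (p \<bullet> v) \<and> p \<bullet> x / (p \<bullet> v) < 1 \<and> x - (p \<bullet> x / (p \<bullet> v)) *\<^sub>R v \<in> B"
proof
  assume "x \<in> cyl B v"
  then obtain b t where bt: "x = b + t *\<^sub>R v" "b \<in> B" "0 \<le> t" "t < 1" by (auto simp: cyl_def)
  then have "p \<bullet> x / (p \<bullet> v) = t" if "p \<noteq> 0"
    using assms that by (auto simp: perp_def inner_add_right)
  then show "0 \<le> p \<bullet> x / (p \<bullet> v) \<and> p \<bullet> x / (p \<bullet> v) < 1 \<and> x - (p \<bullet> x / (p \<bullet> v)) *\<^sub>R v \<in> B"
    using bt assms by (cases "p = 0") auto
next
  assume "0 \<le> p \<bullet> x / (p \<bullet> v) \<and> p \<bullet> x / (p \<bullet> v) < 1 \<and> x - (p \<bullet> x / (p \<bullet> v)) *\<^sub>R v \<in> B"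
  then show "x \<in> cyl B v" unfolding cyl_def by (intro CollectI exI[of _ "x - (p \<bullet> x / (p \<bullet> v)) *\<^sub>R v"] exI[of _ "p \<bullet> x / (p \<bullet> v)"]) auto
qed

lemma cyl_borel:
  assumes "B \<in> sets borel" "B \<subseteq> perp p" "p \<bullet> v \<noteq> 0 \<or> p = 0 \<and> v = 0"
  shows "cyl B v \<in> sets borel"
proof -
  have [measurable]: "B \<in> sets borel" by fact
  have "cyl B v = {x. 0 \<le> p \<bullet> x / (p \<bullet> v) \<and> p \<bullet> x / (p \<bullet> v) < 1 \<and> x - (p \<bullet> x / (p \<bullet> v)) *\<^sub>R v \<in> B}"
    using mem_cyl_iff[OF assms(2,3)] by blast
  also have "\<dots> \<in> sets borel" by measurable
  finally show ?thesis .
qed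

lemma bounded_cyl:
  assumes "bounded B"
  shows "bounded (cyl B v)"
proof -
  obtain R where R: "\<And>x. x \<in> B \<Longrightarrow> norm x \<le> R" using assms by (auto simp: bounded_iff)
  have "norm (b + t *\<^sub>R v) \<le> R + norm v" if "b \<in> B" "0 \<le> t" "t < 1" for b t
  proof -
    have "norm (t *\<^sub>R v) \<le> norm v" using that by (simp add: mult_left_le_one_le)
    then show ?thesis using R[OF that(1)] norm_triangle_le add_mono by blast
  qed
  then show ?thesis unfolding bounded_iff cyl_def by (intro exI[of _ "R + norm v"]) auto
qed

text \<open>
  Uniqueness of invariant measures: integrating \<open>indicator A x * indicator (cyl B p) y\<close> against
  \<open>M\<close> and Lebesgue measure, and using in turn the invariance of either one, exchanges the roles of
  \<open>A\<close> and \<open>B\<close>. Fixing \<open>B\<close> shows that \<open>M A\<close> is proportional to the volume of the cylinder over \<open>A\<close>.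
  It is applied to surface measure on hyperplanes and, with \<open>p = 0\<close>, to linear images of Lebesgue
  measure.
\<close>

lemma invariant_measure_fubini:
  fixes p :: "real^'n" and M :: "(real^'n) measure"
  assumes p: "norm p = 1 \<or> p = 0"
    and sM [measurable_cong, simp]: "sets M = sets borel"
    and finM: "\<And>n::nat. emeasure M (cball 0 n) < \<infinity>"
    and AEM: "AE x in M. x \<in> perp p"
    and inv: "\<And>X y. \<lbrakk>X \<in> sets borel; y \<in> perp p\<rbrakk> \<Longrightarrow> emeasure M ((\<lambda>x. x + y) -` X) = emeasure M X"
    and A: "A \<in> sets borel" "A \<subseteq> perp p" and B: "B \<in> sets borel" "B \<subseteq> perp p"
  shows "emeasure M A * emeasure lborel (cyl B p) = emeasure M (uminus ` B) * emeasure lborel (cyl A p)"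
proof -
  have spM [simp]: "space M = UNIV" using sets_eq_imp_space_eq[OF sM] by simp
  have pp: "p \<bullet> p = 1 \<or> p = 0" using p by (simp add: norm_eq_1)
  have [measurable]: "A \<in> sets borel" "B \<in> sets borel" by fact+
  have [measurable]: "cyl A p \<in> sets borel" "cyl B p \<in> sets borel"
    using A B pp by (auto intro: cyl_borel)
  have "uminus ` B = uminus -` B" by (auto simp: image_iff) (metis minus_minus)
  then have [measurable]: "uminus ` B \<in> sets borel"
    using measurable_sets_borel[of uminus borel B] by simp
  define \<pi> where "\<pi> x = x - (p \<bullet> x) *\<^sub>R p" for x :: "real^'n"
  have [measurable]: "\<pi> \<in> borel_measurable borel" unfolding \<pi>_def by measurable
  have \<pi>: "\<pi> x \<in> perp p" for x using pp by (auto simp: \<pi>_def perp_def inner_diff_right)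
  interpret M: sigma_finite_measure M
  proof (unfold_locales, intro exI conjI)
    show "countable (range (\<lambda>n::nat. cball (0::real^'n) n))" by simp
    show "range (\<lambda>n::nat. cball (0::real^'n) n) \<subseteq> sets M" by auto
    have "x \<in> (\<Union>n::nat. cball 0 (real n))" for x :: "real^'n"
      using real_arch_simple[of "norm x"] by auto
    then show "\<Union> (range (\<lambda>n::nat. cball (0::real^'n) n)) = space M" by auto
    show "\<forall>a\<in>range (\<lambda>n::nat. cball (0::real^'n) n). emeasure M a \<noteq> \<infinity>"
      using finM by (auto simp: less_top[symmetric])
  qed
  interpret P: pair_sigma_finite M "lborel :: (real^'n) measure" ..
  have shiftM: "(\<integral>\<^sup>+x. f (x + y) \<partial>M) = (\<integral>\<^sup>+x. f x \<partial>M)"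
    if [measurable]: "f \<in> borel_measurable borel" and y: "y \<in> perp p" for f :: "_ \<Rightarrow> ennreal" and y
  proof -
    have "distr M borel (\<lambda>x. x + y) = M"
      by (rule measure_eqI) (auto simp: emeasure_distr inv[OF _ y])
    then have "(\<integral>\<^sup>+x. f x \<partial>M) = (\<integral>\<^sup>+x. f x \<partial>distr M borel (\<lambda>x. x + y))" by simp
    also have "\<dots> = (\<integral>\<^sup>+x. f (x + y) \<partial>M)" by (rule nn_integral_distr) auto
    finally show ?thesis by simp
  qed
  have shiftL: "(\<integral>\<^sup>+y. f (x + y) \<partial>lborel) = (\<integral>\<^sup>+y. f y \<partial>lborel)"
    if [measurable]: "f \<in> borel_measurable borel" for f :: "real^'n \<Rightarrow> ennreal" and x
    by (subst (2) lborel_distr_plus[of x, symmetric]) (simp add: nn_integral_distr)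
  \<comment> \<open>With \<open>x\<close> in the hyperplane, \<open>y - \<pi> y\<close> is the part of \<open>y\<close> along \<open>p\<close>; the
    substitution \<open>x \<mapsto> x + \<pi> y\<close> therefore moves the dependence on the hyperplane part of \<open>y\<close> from
    \<open>B\<close> to \<open>A\<close>.\<close>
  have split: "indicator A (x + \<pi> y) * indicator (cyl B p) (y - \<pi> y - x)
      = (indicator (uminus ` B) x * indicator (cyl A p) (x + y) :: ennreal)" if x: "x \<in> perp p" for x y
  proof -
    have px: "p \<bullet> x = 0" using x by (simp add: perp_def)
    have uB: "x \<in> uminus ` B \<longleftrightarrow> - x \<in> B" by (auto simp: image_iff) (metis minus_minus)
    have 1: "y - \<pi> y - x \<in> cyl B p \<longleftrightarrow> 0 \<le> p \<bullet> y \<and> p \<bullet> y < 1 \<and> - x \<in> B"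
      using px pp by (subst mem_cyl_iff[OF B(2)]) (auto simp: \<pi>_def inner_diff_right)
    have 2: "x + y \<in> cyl A p \<longleftrightarrow> 0 \<le> p \<bullet> y \<and> p \<bullet> y < 1 \<and> x + \<pi> y \<in> A"
      using px pp by (subst mem_cyl_iff[OF A(2)]) (auto simp: inner_add_right \<pi>_def add_diff_eq)
    show ?thesis using 1 2 uB by (auto simp: indicator_def)
  qed
  have "emeasure M A * emeasure lborel (cyl B p)
      = (\<integral>\<^sup>+x. indicator A x * (\<integral>\<^sup>+y. indicator (cyl B p) y \<partial>lborel) \<partial>M)"
    by (simp add: nn_integral_multc)
  also have "\<dots> = (\<integral>\<^sup>+x. \<integral>\<^sup>+y. indicator A x * indicator (cyl B p) (y - x) \<partial>lborel \<partial>M)"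
  proof (rule nn_integral_cong)
    fix x
    show "indicator A x * (\<integral>\<^sup>+y. indicator (cyl B p) y \<partial>lborel)
        = (\<integral>\<^sup>+y. indicator A x * indicator (cyl B p) (y - x) \<partial>lborel)"
      using shiftL[of "indicator (cyl B p)" "- x"] by (subst nn_integral_cmult) auto
  qed
  also have "\<dots> = (\<integral>\<^sup>+y. \<integral>\<^sup>+x. indicator A x * indicator (cyl B p) (y - x) \<partial>M \<partial>lborel)"
    by (rule P.Fubini'[symmetric]) measurable
  also have "\<dots> = (\<integral>\<^sup>+y. \<integral>\<^sup>+x. indicator A (x + \<pi> y) * indicator (cyl B p) (y - (x + \<pi> y)) \<partial>M \<partial>lborel)"
    by (intro nn_integral_cong shiftM[symmetric] \<pi>) measurable
  also have "\<dots> = (\<integral>\<^sup>+x. \<integral>\<^sup>+y. indicator A (x + \<pi> y) * indicator (cyl B p) (y - (x + \<pi> y)) \<partial>lborel \<partial>M)"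
    by (rule P.Fubini') measurable
  also have "\<dots> = (\<integral>\<^sup>+x. \<integral>\<^sup>+y. indicator (uminus ` B) x * indicator (cyl A p) (x + y) \<partial>lborel \<partial>M)"
  proof (rule nn_integral_cong_AE, rule AE_mp[OF AEM], rule AE_I2, rule impI)
    fix x assume "x \<in> perp p"
    have e: "y - (x + \<pi> y) = y - \<pi> y - x" for y by simp
    show "(\<integral>\<^sup>+y. indicator A (x + \<pi> y) * indicator (cyl B p) (y - (x + \<pi> y)) \<partial>lborel)
        = (\<integral>\<^sup>+y. indicator (uminus ` B) x * indicator (cyl A p) (x + y) \<partial>lborel)"
      by (simp only: e split[OF \<open>x \<in> perp p\<close>])
  qed
  also have "\<dots> = (\<integral>\<^sup>+x. indicator (uminus ` B) x * (\<integral>\<^sup>+y. indicator (cyl A p) y \<partial>lborel) \<partial>M)"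
    by (intro nn_integral_cong) (subst nn_integral_cmult, auto simp: shiftL)
  also have "\<dots> = emeasure M (uminus ` B) * emeasure lborel (cyl A p)"
    by (simp add: nn_integral_multc)
  finally show ?thesis .
qed

text \<open>
  The measure \<open>A \<mapsto> lborel (f ` A)\<close> is invariant under translations. The unit ball serves as the
  set of comparison, being symmetric and invariant under rotations.
\<close>

lemma lborel_linear_image:
  fixes f g :: "real^'n \<Rightarrow> real^'n"
  assumes f: "linear f" and g: "linear g" and gf: "\<And>x. g (f x) = x" and fg: "\<And>x. f (g x) = x"
    and A: "A \<in> sets borel"
  shows "f ` A \<in> sets borel"
    and "emeasure lborel (f ` A) * emeasure lborel (cball (0::real^'n) 1)
       = emeasure lborel (f ` cball 0 1) * emeasure lborel A"
proof -
  have img: "f ` X = g -` X" for X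
    using gf fg by (auto simp: image_iff) metis
  have [measurable]: "g \<in> borel_measurable borel"
    using g by (intro borel_measurable_continuous_onI linear_continuous_on linear_conv_bounded_linear[THEN iffD1])
  show "f ` A \<in> sets borel" using A measurable_sets_borel[of g borel A] by (simp add: img)
  define M where "M = distr lborel borel g"
  have eM: "emeasure M X = emeasure lborel (f ` X)" if "X \<in> sets borel" for X
    using that by (simp add: M_def emeasure_distr img)
  have "emeasure M A * emeasure lborel (cyl (cball (0::real^'n) 1) 0) = emeasure M (uminus ` cball 0 1) * emeasure lborel (cyl A 0)"
  proof (rule invariant_measure_fubini)
    have "bounded (f ` cball 0 (real n))" for n
      using f by (intro bounded_linear_image bounded_cball) (rule linear_conv_bounded_linear[THEN iffD1])
    then show "emeasure M (cball 0 (real n)) < \<infinity>" for n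
      using emeasure_bounded_finite[of "f ` cball 0 (real n)"] by (simp add: eM)
    show "emeasure M ((\<lambda>x. x + y) -` X) = emeasure M X" if X: "X \<in> sets borel" for X y
    proof -
      have "emeasure M ((\<lambda>x. x + y) -` X) = emeasure lborel (f ` ((\<lambda>x. x + y) -` X))"
        using X measurable_sets_borel[of "\<lambda>x. x + y" borel X] by (intro eM) simp
      also have "f ` ((\<lambda>x. x + y) -` X) = (+) (f y) -` (f ` X) "
        using gf fg by (auto simp: img linear_add[OF g] add.commute)
      also have "emeasure lborel \<dots> = emeasure (distr lborel borel ((+) (f y))) (f ` X)"
        using X measurable_sets_borel[of g borel X] by (simp add: emeasure_distr img)
      finally show ?thesis using X by (simp add: lborel_distr_plus eM)
    qed
  qed (auto simp: M_def perp_def A)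
  moreover have "cyl X 0 = X" for X :: "(real^'n) set" by (auto simp: cyl_def intro: exI[of _ 0])
  moreover have "uminus ` cball 0 1 = cball (0::real^'n) 1"
    by (auto simp: image_iff intro!: bexI[of _ "- _"])
  ultimately show "emeasure lborel (f ` A) * emeasure lborel (cball (0::real^'n) 1)
       = emeasure lborel (f ` cball 0 1) * emeasure lborel A"
    using A by (simp add: eM)
qed

lemma lborel_linear_image_factor:
  fixes f g :: "real^'n \<Rightarrow> real^'n"
  assumes "linear f" "linear g" "\<And>x. g (f x) = x" "\<And>x. f (g x) = x" and A: "A \<in> sets borel"
    and c: "emeasure lborel (f ` cball 0 1) = ennreal c * emeasure lborel (cball (0::real^'n) 1)"
  shows "emeasure lborel (f ` A) = ennreal c * emeasure lborel A"
proof -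
  let ?b = "emeasure lborel (cball (0::real^'n) 1)"
  have b: "?b \<noteq> \<infinity>" using emeasure_bounded_finite[of "cball (0::real^'n) 1"] by auto
  moreover have "0 < ?b"
    using content_cball_pos[of 1 "0::real^'n"] by (simp add: measure_def enn2real_positive_iff)
  moreover have "emeasure lborel (f ` A) * ?b = (ennreal c * emeasure lborel A) * ?b"
    using lborel_linear_image(2)[OF assms(1-5)] by (simp add: c mult_ac)
  ultimately show ?thesis 
    by (metis infinity_ennreal_def mult_divide_eq_ennreal not_gr_zero)
qed

lemma lborel_orthogonal_image:
  fixes T :: "real^'n \<Rightarrow> real^'n"
  assumes T: "orthogonal_transformation T" and A: "A \<in> sets borel"
  shows "emeasure lborel (T ` A) = emeasure lborel A"
proof -
  have inv: "inv T (T x) = x" "T (inv T x) = x" for x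
    using orthogonal_transformation_bij[OF T] by (simp_all add: bij_is_inj bij_is_surj surj_f_inv_f)
  have T': "orthogonal_transformation (inv T)" by (rule orthogonal_transformation_inv[OF T])
  have "x \<in> T ` cball 0 1" if "x \<in> cball 0 1" for x
    using that inv(2)[of x] orthogonal_transformation_norm[OF T', of x] by (intro image_eqI[of _ _ "inv T x"]) auto
  then have "T ` cball 0 1 = cball 0 1" using orthogonal_transformation_norm[OF T] by auto
  then show ?thesis
    using lborel_linear_image_factor[of T "inv T" A 1] T T' inv A by (simp add: orthogonal_transformation_linear)
qed

text \<open>
  Shears preserve volume because a shear and its inverse are conjugate by a reflection.
\<close>

lemma lborel_shear_image:
  fixes l w :: "real^'n"
  assumes lw: "l \<bullet> w = 0" and A: "A \<in> sets borel"
  shows "emeasure lborel ((\<lambda>x. x + (l \<bullet> x) *\<^sub>R w) ` A) = emeasure lborel A"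
proof (cases "l = 0")
  case False
  let ?C = "cball (0::real^'n) 1"
  define f where "f x = x + (l \<bullet> x) *\<^sub>R w" for x
  define g where "g x = x - (l \<bullet> x) *\<^sub>R w" for x
  define R where "R x = x - (2 * (l \<bullet> x) / (l \<bullet> l)) *\<^sub>R l" for x
  have ll: "l \<bullet> l \<noteq> 0" using False by simp
  have lin: "linear f" "linear g" "linear R"
    unfolding f_def[abs_def] g_def[abs_def] R_def[abs_def]
    by (auto intro!: linearI simp: algebra_simps inner_add_right add_divide_distrib)
  have gf: "g (f x) = x" "f (g x) = x" for x using lw by (simp_all add: f_def g_def inner_add_right inner_diff_right)
  have "R x \<bullet> R y = x \<bullet> y" for x y
    using ll by (simp add: R_def inner_diff_left inner_diff_right inner_commute field_simps)
  then have R: "orthogonal_transformation R" by (simp add: orthogonal_transformation_def lin)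
  \<comment> \<open>The reflection in \<open>l\<close> conjugates the shear to its inverse; both therefore
    scale volume by the same factor, which must be \<open>1\<close>.\<close>
  have fR: "R (f (R x)) = g x" for x
    using ll lw by (simp add: R_def f_def g_def inner_diff_right inner_add_right algebra_simps)
  have RC: "R ` ?C = ?C"
  proof -
    have "R (R x) = x" for x using ll by (simp add: R_def inner_diff_right field_simps)
    then have "x \<in> R ` ?C" if "x \<in> ?C" for x
      using that orthogonal_transformation_norm[OF R] by (intro image_eqI[of _ _ "R x"]) auto
    then show ?thesis using orthogonal_transformation_norm[OF R] by auto
  qed
  have fC: "f ` ?C \<in> sets borel" and gC: "g ` ?C \<in> sets borel"
    using lborel_linear_image(1)[of f g ?C] lborel_linear_image(1)[of g f ?C] lin gf by auto
  have "g ` ?C = R ` f ` R ` ?C" by (simp add: image_image fR)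
  also have "emeasure lborel \<dots> = emeasure lborel (f ` ?C)"
    using lborel_orthogonal_image[OF R fC] by (simp add: RC)
  finally have "emeasure lborel (g ` ?C) = emeasure lborel (f ` ?C)" .
  then have sq: "emeasure lborel ?C * emeasure lborel ?C = emeasure lborel (f ` ?C) * emeasure lborel (f ` ?C)"
    using lborel_linear_image(2)[of f g "g ` ?C"] lin gf gC by (simp add: image_image)
  have bf: "bounded (f ` ?C)" using lin by (intro bounded_linear_image linear_conv_bounded_linear[THEN iffD1]) auto
  have "measure lborel ?C * measure lborel ?C = measure lborel (f ` ?C) * measure lborel (f ` ?C)"
    using arg_cong[OF sq, of enn2real] by (simp add: enn2real_mult measure_def)
  then have "measure lborel (f ` ?C) = measure lborel ?C"
    by (metis abs_of_nonneg measure_nonneg power2_eq_square power2_eq_iff_nonneg)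
  then have "emeasure lborel (f ` ?C) = emeasure lborel ?C"
    using emeasure_bounded_finite[OF bf] emeasure_bounded_finite[of ?C] by (simp add: emeasure_eq_ennreal_measure less_top)
  then show ?thesis using lborel_linear_image_factor[of f g A 1] lin gf A by (simp add: f_def[abs_def])
qed simp

lemma lborel_axial_scaling_image:
  fixes p :: "real^'n"
  assumes p: "norm p = 1" and s: "0 < s" and A: "A \<in> sets borel"
  shows "emeasure lborel ((\<lambda>x. x + ((s - 1) * (p \<bullet> x)) *\<^sub>R p) ` A) = ennreal s * emeasure lborel A"
proof -
  let ?C = "cball (0::real^'n) 1"
  have pp: "p \<bullet> p = 1" using p by (simp add: norm_eq_1)
  define F where "F q s x = x + ((s - 1) * (q \<bullet> x)) *\<^sub>R q" for q x :: "real^'n" and s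
  have lin: "linear (F q s)" for q s
    unfolding F_def[abs_def] by (auto intro!: linearI simp: algebra_simps inner_add_right)
  have inv: "F q s (F q (1/s) x) = x" "F q (1/s) (F q s x) = x" if "norm q = 1" for q x
    using that s by (auto simp: F_def norm_eq_1 inner_add_right inner_diff_right field_simps simp flip: scaleR_add_left)
  define i where "i = (SOME i::'n. True)"
  let ?e = "axis i (1::real)"
  have e: "norm ?e = 1" by (simp add: norm_axis_1)
  \<comment> \<open>Along a coordinate axis the scaling is diagonal; a rotation of that axis to
    \<open>p\<close> does the rest.\<close>
  have Feq: "F ?e (1/s) x = 0 + (\<Sum>j\<in>Basis. ((if j = ?e then 1/s else 1) * (x \<bullet> j)) *\<^sub>R j)" for x
  proof (rule euclidean_eqI)
    fix b :: "real^'n" assume b: "b \<in> Basis"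
    have eB: "?e \<in> Basis" by (simp add: axis_in_Basis_iff)
    show "F ?e (1/s) x \<bullet> b = (0 + (\<Sum>j\<in>Basis. ((if j = ?e then 1/s else 1) * (x \<bullet> j)) *\<^sub>R j)) \<bullet> b"
      unfolding add_0 inner_sum_left_Basis[OF b]
      using b eB by (auto simp: F_def inner_add_left inner_Basis inner_commute algebra_simps)
  qed
  have "emeasure lborel (F ?e s ` ?C) = ennreal s * emeasure lborel ?C"
  proof -
    have img: "F ?e s ` ?C = F ?e (1/s) -` ?C"
    proof (intro equalityI subsetI)
      fix x assume "x \<in> F ?e (1/s) -` ?C"
      then show "x \<in> F ?e s ` ?C" using inv(1)[OF e] by (intro image_eqI[of _ _ "F ?e (1/s) x"]) auto
    qed (use inv[OF e] in auto)
    have prod: "(\<Prod>j\<in>(Basis :: (real^'n) set). \<bar>if j = ?e then 1/s else 1\<bar>) = 1 / s"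
      using s by (subst prod.remove[of _ ?e]) (auto simp: axis_in_Basis_iff)
    have "lborel = density (distr lborel borel (F ?e (1/s))) (\<lambda>_. ennreal (1/s))"
      using lborel_affine_euclidean[of "\<lambda>j. if j = ?e then 1/s else 1" 0] s
      unfolding Feq[abs_def, symmetric] prod by auto
    then have "emeasure lborel ?C = emeasure (density (distr lborel borel (F ?e (1/s))) (\<lambda>_. ennreal (1/s))) ?C" by simp
    also have "\<dots> = ennreal (1/s) * emeasure lborel (F ?e s ` ?C)"
    proof -
      have [measurable]: "F ?e (1/s) \<in> borel_measurable borel"
        using lin by (intro borel_measurable_continuous_onI linear_continuous_on linear_conv_bounded_linear[THEN iffD1])
      show ?thesis by (simp add: emeasure_density nn_integral_cmult_indicator emeasure_distr img)
    qed
    finally have "ennreal s * emeasure lborel ?C = ennreal s * ennreal (1/s) * emeasure lborel (F ?e s ` ?C)"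
      by (simp add: mult_ac)
    then show ?thesis using s by (simp flip: ennreal_mult)
  qed
  moreover obtain T where T: "orthogonal_transformation T" and Tp: "T ?e = p"
    using orthogonal_transformation_exists_1[of ?e p] p e by auto
  have linT: "linear T" using T by (rule orthogonal_transformation_linear)
  have "T (F ?e s x) = F p s (T x)" for x
    using T by (simp add: F_def linear_add[OF linT] linear_cmul[OF linT] Tp) (metis Tp orthogonal_transformation_def)
  then have "T ` F ?e s ` ?C = F p s ` T ` ?C" by (simp add: image_image)
  moreover have "T ` ?C = ?C"
  proof -
    have "T (inv T x) = x" for x using orthogonal_transformation_bij[OF T] by (simp add: bij_is_surj surj_f_inv_f)
    then have "x \<in> T ` ?C" if "x \<in> ?C" for x
      using that orthogonal_transformation_norm[OF T, of "inv T x"] by (intro image_eqI[of _ _ "inv T x"]) auto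
    then show ?thesis using orthogonal_transformation_norm[OF T] by auto
  qed
  ultimately have "emeasure lborel (F p s ` ?C) = ennreal s * emeasure lborel ?C"
    using lborel_orthogonal_image[OF T lborel_linear_image(1)[of "F ?e s" "F ?e (1/s)" ?C]] lin inv[OF e] by simp
  then show ?thesis
    using lborel_linear_image_factor[of "F p s" "F p (1/s)" A s] lin inv[OF p] A by (simp add: F_def[abs_def])
qed

context
  assumes d2: "CARD('d::finite) \<ge> 2"
begin

lemma surf_isometry_image:
  fixes f g :: "real^'d \<Rightarrow> real^'d"
  assumes f: "\<And>x y. norm (f x - f y) = norm (x - y)"
    and gf: "\<And>x. g (f x) = x" and fg: "\<And>x. f (g x) = x" and A: "A \<in> sets borel"
  shows "f ` A \<in> sets borel" and "emeasure surf (f ` A) = emeasure surf A"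
proof -
  have g: "norm (g x - g y) = norm (x - y)" for x y using f[of "g x" "g y"] by (simp add: fg)
  have "continuous_on UNIV g"
    by (rule continuous_on_iff[THEN iffD2]) (metis dist_norm g)
  then have "g \<in> borel_measurable borel" by (rule borel_measurable_continuous_onI)
  then have "g -` A \<in> sets borel" using A by (metis measurable_sets_borel)
  moreover have "f ` A = g -` A"
  proof
    show "f ` A \<subseteq> g -` A" using gf by auto
    show "g -` A \<subseteq> f ` A"
    proof
      fix x assume "x \<in> g -` A"
      then show "x \<in> f ` A" using fg[of x] by (intro image_eqI[of _ _ "g x"]) auto
    qed
  qed
  ultimately show fA: "f ` A \<in> sets borel" by simp
  have "g ` f ` A = A" using gf by (simp add: image_image)
  then have "emeasure surf A \<le> emeasure surf (f ` A)"
    using surf_lipschitz_image[OF d2, of 1 "f ` A" g] A fA g by simp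
  moreover have "emeasure surf (f ` A) \<le> emeasure surf A"
    using surf_lipschitz_image[OF d2, of 1 A f] A fA f by simp
  ultimately show "emeasure surf (f ` A) = emeasure surf A" by (rule antisym[rotated])
qed

lemma surf_orthogonal_image:
  fixes T :: "real^'d \<Rightarrow> real^'d"
  assumes T: "orthogonal_transformation T" and A: "A \<in> sets borel"
  shows "T ` A \<in> sets borel" and "emeasure surf (T ` A) = emeasure surf A"
proof -
  have "norm (T x - T y) = norm (x - y)" for x y
    using T by (metis linear_diff orthogonal_transformation_linear orthogonal_transformation_norm)
  moreover have "inv T (T x) = x" "T (inv T x) = x" for x
    using orthogonal_transformation_bij[OF T] by (simp_all add: bij_is_inj bij_is_surj surj_f_inv_f)
  ultimately show "T ` A \<in> sets borel" "emeasure surf (T ` A) = emeasure surf A"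
    using surf_isometry_image[of T "inv T", OF _ _ _ A] by auto
qed

lemma surf_translation:
  fixes a :: "real^'d"
  assumes A: "A \<in> sets borel"
  shows "(+) a ` A \<in> sets borel" and "emeasure surf ((+) a ` A) = emeasure surf A"
  using surf_isometry_image[of "(+) a" "\<lambda>x. x - a", OF _ _ _ A] by auto

lemma surf_uminus_image:
  fixes A :: "(real^'d) set"
  assumes A: "A \<in> sets borel"
  shows "uminus ` A \<in> sets borel" and "emeasure surf (uminus ` A) = emeasure surf A"
  using surf_isometry_image[of uminus uminus, OF _ _ _ A] by (auto simp: norm_minus_commute)

text \<open>
  Rotate the hyperplane to a coordinate hyperplane.
\<close>

lemma surf_bounded_perp_finite:
  fixes p :: "real^'d"
  assumes p: "p \<noteq> 0" and A: "A \<in> sets borel" "bounded A" "A \<subseteq> perp p"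
  shows "emeasure surf A < \<infinity>"
proof -
  define i where "i = (SOME i::'d. True)"
  obtain T :: "real^'d \<Rightarrow> real^'d" where T: "orthogonal_transformation T" and Tp: "T (p /\<^sub>R norm p) = axis i 1"
    using orthogonal_transformation_exists_1[of "p /\<^sub>R norm p" "axis i (1::real)"] p
    by (auto simp: norm_axis_1)
  obtain R where R: "\<And>x. x \<in> A \<Longrightarrow> norm x \<le> R" and "0 < R"
    using A bounded_pos by metis
  have "T ` A \<subseteq> {x. x $ i = 0 \<and> (\<forall>j. \<bar>x $ j\<bar> \<le> R)}"
  proof clarsimp
    fix x assume x: "x \<in> A"
    have "T x $ i = T x \<bullet> axis i 1" by (simp add: inner_axis)
    also have "\<dots> = x \<bullet> (p /\<^sub>R norm p)"
      using T by (metis Tp orthogonal_transformation_def)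
    also have "\<dots> = 0" using x A by (auto simp: perp_def inner_commute)
    finally show "T x $ i = 0 \<and> (\<forall>j. \<bar>T x $ j\<bar> \<le> R)"
      using R[OF x] component_le_norm_cart[of "T x"] orthogonal_transformation_norm[OF T, of x]
      by (metis order_trans)
  qed
  then have "hausdorff_outer (CARD('d) - 1) (T ` A) < \<infinity>"
    by (rule hausdorff_outer_hyperplane_finite[OF d2 \<open>0 < R\<close>])
  then have "emeasure surf (T ` A) < \<infinity>"
    using emeasure_surf[where 'd='d] surf_orthogonal_image(1)[OF T A(1)] by auto
  then show ?thesis by (simp add: surf_orthogonal_image[OF T A(1)])
qed

text \<open>
  Surface measure, restricted to a hyperplane, is invariant under the translations of that
  hyperplane.
\<close>

lemma surf_perp_fubini:
  fixes p :: "real^'d"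
  assumes p: "norm p = 1" and A: "A \<in> sets borel" "A \<subseteq> perp p" and B: "B \<in> sets borel" "B \<subseteq> perp p"
  shows "emeasure surf A * emeasure lborel (cyl B p) = emeasure surf B * emeasure lborel (cyl A p)"
proof -
  define M where "M = density surf (indicator (perp p))"
  have eM: "emeasure M X = emeasure surf (X \<inter> perp p)" if "X \<in> sets borel" for X
  proof -
    have [measurable]: "X \<in> sets borel" by fact
    have "emeasure M X = (\<integral>\<^sup>+x. indicator (perp p) x * indicator X x \<partial>surf)"
      unfolding M_def by (rule emeasure_density) measurable
    also have "\<dots> = (\<integral>\<^sup>+x. indicator (X \<inter> perp p) x \<partial>surf)"
      by (intro nn_integral_cong) (auto simp: indicator_def)
    finally show ?thesis by simp
  qed
  have "emeasure M A * emeasure lborel (cyl B p) = emeasure M (uminus ` B) * emeasure lborel (cyl A p)"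
  proof (rule invariant_measure_fubini[OF _ _ _ _ _ A B])
    show "norm p = 1 \<or> p = 0" using p ..
    show "sets M = sets borel" by (simp add: M_def)
    show "AE x in M. x \<in> perp p" unfolding M_def by (subst AE_density) (auto simp: indicator_def)
    have "emeasure surf (cball 0 (real n) \<inter> perp p) < \<infinity>" for n
      using p by (intro surf_bounded_perp_finite[of p]) (auto intro: bounded_Int)
    then show "emeasure M (cball 0 (real n)) < \<infinity>" for n by (simp add: eM)
    show "emeasure M ((\<lambda>x. x + y) -` X) = emeasure M X" if X: "X \<in> sets borel" and y: "y \<in> perp p" for X y
    proof -
      have [measurable]: "X \<in> sets borel" by fact
      have *: "(+) (- y) ` (X \<inter> perp p) = (\<lambda>x. x + y) -` X \<inter> perp p" (is "?l = ?r")
      proof (intro equalityI subsetI)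
        fix z assume "z \<in> ?r"
        then show "z \<in> ?l" using y by (intro image_eqI[of _ _ "z + y"]) (auto simp: perp_def inner_add_right)
      qed (use y in \<open>auto simp: perp_def inner_diff_right\<close>)
      have "emeasure M ((\<lambda>x. x + y) -` X) = emeasure surf ((\<lambda>x. x + y) -` X \<inter> perp p)"
        by (rule eM) (use measurable_sets_borel[of "\<lambda>x. x + y" borel X] in auto)
      also have "\<dots> = emeasure surf (X \<inter> perp p)"
        by (simp only: *[symmetric]) (rule surf_translation, measurable)
      finally show ?thesis by (simp add: eM)
    qed
  qed
  moreover have "uminus ` B \<subseteq> perp p" using B by (auto simp: perp_def)
  ultimately show ?thesis using A B by (simp add: eM surf_uminus_image Int_absorb2)
qed

end

text \<open>
  The projection onto the hyperplane \<open>perp p\<close> in the direction \<open>v\<close>; \<open>proj_along v v\<close> is the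
  orthogonal one for \<open>v \<noteq> 0\<close>.
\<close>

definition proj_along :: "real^'n \<Rightarrow> real^'n \<Rightarrow> real^'n \<Rightarrow> real^'n" where
  "proj_along p v x = x - (p \<bullet> x / (p \<bullet> v)) *\<^sub>R v"

lemma proj_along_perp: "p \<bullet> v \<noteq> 0 \<Longrightarrow> proj_along p v x \<in> perp p"
  by (simp add: proj_along_def perp_def inner_diff_right)

text \<open>
  Only the component of \<open>v\<close> along \<open>p\<close>, the height of the cylinder, affects its volume; the rest of
  \<open>v\<close> amounts to a shear.
\<close>

lemma measure_cyl_tilt:
  fixes p v :: "real^'n"
  assumes p: "norm p = 1" and pv: "0 < p \<bullet> v" and B: "B \<in> sets borel" "B \<subseteq> perp p"
  shows "emeasure lborel (cyl B v) = ennreal (p \<bullet> v) * emeasure lborel (cyl B p)"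
proof -
  have pp: "p \<bullet> p = 1" using p by (simp add: norm_eq_1)
  define s where "s = p \<bullet> v"
  \<comment> \<open>A scaling of \<open>p\<close> to \<open>(p \<bullet> v) p\<close>, followed by a shear that adds the tangential
    part of \<open>v\<close>.\<close>
  define w where "w = (1/s) *\<^sub>R v - p"
  have pw: "p \<bullet> w = 0" using pv by (simp add: w_def s_def inner_diff_right pp)
  have scale: "(b + t *\<^sub>R p) + ((s - 1) * (p \<bullet> (b + t *\<^sub>R p))) *\<^sub>R p = b + (t * s) *\<^sub>R p" if "b \<in> B" for b t
    using that B by (auto simp: perp_def inner_add_right pp algebra_simps)
  have shear: "(b + (t * s) *\<^sub>R p) + (p \<bullet> (b + (t * s) *\<^sub>R p)) *\<^sub>R w = b + t *\<^sub>R v" if "b \<in> B" for b t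
    using that B pv by (auto simp: perp_def inner_add_right pp w_def s_def algebra_simps)
  have cp: "cyl B p \<in> sets borel" and cs: "cyl B (s *\<^sub>R p) \<in> sets borel"
    using cyl_borel[OF B] pv pp by (auto simp: s_def)
  have "(\<lambda>x. x + ((s - 1) * (p \<bullet> x)) *\<^sub>R p) ` cyl B p = cyl B (s *\<^sub>R p)"
  proof (intro equalityI subsetI)
    fix x assume "x \<in> cyl B (s *\<^sub>R p)"
    then obtain b t where bt: "x = b + t *\<^sub>R s *\<^sub>R p" "b \<in> B" "0 \<le> t" "t < 1" by (auto simp: cyl_def)
    then show "x \<in> (\<lambda>x. x + ((s - 1) * (p \<bullet> x)) *\<^sub>R p) ` cyl B p"
      using scale[of b t] by (intro image_eqI[of _ _ "b + t *\<^sub>R p"]) (auto simp: cyl_def)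
  qed (auto simp: cyl_def scale, blast)
  moreover have "(\<lambda>x. x + (p \<bullet> x) *\<^sub>R w) ` cyl B (s *\<^sub>R p) = cyl B v"
  proof (intro equalityI subsetI)
    fix x assume "x \<in> cyl B v"
    then obtain b t where bt: "x = b + t *\<^sub>R v" "b \<in> B" "0 \<le> t" "t < 1" by (auto simp: cyl_def)
    then show "x \<in> (\<lambda>x. x + (p \<bullet> x) *\<^sub>R w) ` cyl B (s *\<^sub>R p)"
      using shear[of b t] by (intro image_eqI[of _ _ "b + (t * s) *\<^sub>R p"]) (auto simp: cyl_def)
  qed (auto simp: cyl_def shear, blast)
  ultimately show ?thesis
    using lborel_axial_scaling_image[OF p, of s "cyl B p"] lborel_shear_image[OF pw cs] pv cp by (simp add: s_def)
qed

lemma proj_along_image: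
  assumes pv: "p \<bullet> v \<noteq> 0" and v: "norm v = 1" and B: "B \<in> sets borel" "bounded B" "B \<subseteq> perp p"
  shows "proj_along v v ` B \<in> sets borel" "bounded (proj_along v v ` B)" "proj_along v v ` B \<subseteq> perp v"
proof -
  have vv: "v \<bullet> v = 1" using v by (simp add: norm_eq_1)
  have B': "B \<in> sets borel" by fact
  have "proj_along v v ` B = {y \<in> perp v. proj_along p v y \<in> B}"
  proof (intro equalityI subsetI)
    fix y assume "y \<in> proj_along v v ` B"
    then obtain b where b: "b \<in> B" "y = proj_along v v b" by auto
    then have "proj_along p v y = b"
      using B pv vv by (auto simp: proj_along_def perp_def inner_diff_right)
    then show "y \<in> {y \<in> perp v. proj_along p v y \<in> B}" using b vv by (simp add: proj_along_perp)
  next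
    fix y assume y: "y \<in> {y \<in> perp v. proj_along p v y \<in> B}"
    then have "proj_along v v (proj_along p v y) = y"
      using pv vv by (auto simp: proj_along_def perp_def inner_diff_right)
    then show "y \<in> proj_along v v ` B" using y by (metis (mono_tags, lifting) image_eqI mem_Collect_eq)
  qed
  also have "\<dots> \<in> sets borel"
  proof -
    have [measurable]: "B \<in> sets borel" by fact
    have [measurable]: "proj_along p v \<in> borel_measurable borel" unfolding proj_along_def[abs_def] by measurable
    show ?thesis by measurable
  qed
  finally show "proj_along v v ` B \<in> sets borel" .
  have "linear (proj_along v v)"
    unfolding proj_along_def[abs_def] by (intro linearI) (auto simp: algebra_simps inner_add_right add_divide_distrib)
  then show "bounded (proj_along v v ` B)" by (intro bounded_linear_image B linear_conv_bounded_linear[THEN iffD1])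
  show "proj_along v v ` B \<subseteq> perp v" using vv by (auto intro: proj_along_perp)
qed

text \<open>
  Sliding each point of the base along the generator is a shear.
\<close>

lemma measure_cyl_proj_along:
  fixes p v :: "real^'n"
  assumes v: "norm v = 1" and pv: "p \<bullet> v \<noteq> 0" and B: "B \<in> sets borel" "bounded B" "B \<subseteq> perp p"
  shows "emeasure lborel (cyl (proj_along v v ` B) v) = emeasure lborel (cyl B v)"
proof -
  have vv: "v \<bullet> v = 1" using v by (simp add: norm_eq_1)
  \<comment> \<open>The shear that fixes \<open>v\<close> and sends \<open>b\<close> in the hyperplane of \<open>p\<close> to
    \<open>b - (v \<bullet> b) v\<close>.\<close>
  define l where "l = (1 / (p \<bullet> v)) *\<^sub>R p - v"
  have lv: "l \<bullet> v = 0" using pv by (simp add: l_def inner_diff_left vv)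
  have *: "(b + t *\<^sub>R v) + (l \<bullet> (b + t *\<^sub>R v)) *\<^sub>R v = proj_along v v b + t *\<^sub>R v" if "b \<in> B" for b t
  proof -
    have "l \<bullet> (b + t *\<^sub>R v) = - (v \<bullet> b)"
      using that B lv by (auto simp: inner_add_right) (auto simp: l_def inner_diff_left perp_def)
    then show ?thesis by (simp add: proj_along_def vv algebra_simps)
  qed
  have "(\<lambda>x. x + (l \<bullet> x) *\<^sub>R v) ` cyl B v = cyl (proj_along v v ` B) v"
  proof (intro equalityI subsetI)
    fix x assume "x \<in> cyl (proj_along v v ` B) v"
    then obtain b t where bt: "x = proj_along v v b + t *\<^sub>R v" "b \<in> B" "0 \<le> t" "t < 1" by (auto simp: cyl_def)
    then show "x \<in> (\<lambda>x. x + (l \<bullet> x) *\<^sub>R v) ` cyl B v"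
      using *[of b t] by (intro image_eqI[of _ _ "b + t *\<^sub>R v"]) (auto simp: cyl_def)
  qed (auto simp: cyl_def *, blast)
  moreover have "cyl B v \<in> sets borel" using cyl_borel[OF B(1,3)] pv by auto
  ultimately show ?thesis using lborel_shear_image[OF lv, of "cyl B v"] by simp
qed

definition unit_disc :: "real^'n \<Rightarrow> (real^'n) set" where
  "unit_disc p = perp p \<inter> cball 0 1"

lemma unit_disc: "unit_disc p \<in> sets borel" "bounded (unit_disc p)" "unit_disc p \<subseteq> perp p"
  by (auto simp: unit_disc_def bounded_Int)

lemma measure_cyl_unit_disc_pos:
  fixes p :: "real^'n"
  assumes p: "norm p = 1"
  shows "0 < measure lborel (cyl (unit_disc p) p)"
proof -
  have pp: "p \<bullet> p = 1" using p by (simp add: norm_eq_1)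
  have c: "cyl (unit_disc p) p \<in> sets borel" using cyl_borel[OF unit_disc(1,3), of p p] pp by simp
  have "ball ((1/2) *\<^sub>R p) (1/2) \<subseteq> cyl (unit_disc p) p"
  proof
    fix x assume "x \<in> ball ((1/2) *\<^sub>R p) (1/2)"
    then have n: "norm (x - (1/2) *\<^sub>R p) < 1/2" by (simp add: dist_norm norm_minus_commute)
    have "\<bar>p \<bullet> (x - (1/2) *\<^sub>R p)\<bar> < 1/2"
      using Cauchy_Schwarz_ineq2[of p "x - (1/2) *\<^sub>R p"] p n by simp
    then have "\<bar>p \<bullet> x - 1/2\<bar> < 1/2" by (simp add: inner_diff_right pp)
    then have px: "0 < p \<bullet> x" "p \<bullet> x < 1" unfolding abs_less_iff by linarith+
    have eq: "x - (p \<bullet> x) *\<^sub>R p = (x - (1/2) *\<^sub>R p) - (p \<bullet> x - 1/2) *\<^sub>R p" by (simp add: algebra_simps)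
    have "norm (x - (p \<bullet> x) *\<^sub>R p) \<le> norm (x - (1/2) *\<^sub>R p) + \<bar>p \<bullet> x - 1/2\<bar>"
      unfolding eq using norm_triangle_ineq4[of "x - (1/2) *\<^sub>R p" "(p \<bullet> x - 1/2) *\<^sub>R p"] p
      by (simp only: norm_scaleR mult_1_right)
    also have "\<dots> \<le> 1" using n \<open>\<bar>p \<bullet> x - 1/2\<bar> < 1/2\<close> by linarith
    finally show "x \<in> cyl (unit_disc p) p"
      using px by (subst mem_cyl_iff[OF unit_disc(3)]) (auto simp: pp unit_disc_def perp_def inner_diff_right)
  qed
  then have "measure lborel (ball ((1/2) *\<^sub>R p) (1/2)) \<le> measure lborel (cyl (unit_disc p) p)"
    using c emeasure_bounded_finite[OF bounded_cyl[OF unit_disc(2), of p p]]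
    by (intro measure_mono_fmeasurable) (auto simp: fmeasurable_def)
  moreover have "0 < measure lborel (ball ((1/2) *\<^sub>R p) (1/2))" by (intro content_ball_pos) simp
  ultimately show ?thesis by linarith
qed

context
  assumes d2: "CARD('d::finite) \<ge> 2"
begin

lemma measure_surf_perp:
  fixes p :: "real^'d"
  assumes p: "norm p = 1" and B: "B \<in> sets borel" "bounded B" "B \<subseteq> perp p"
  shows "measure surf B * measure lborel (cyl (unit_disc p) p)
       = measure surf (unit_disc p) * measure lborel (cyl B p)"
  using arg_cong[OF surf_perp_fubini[OF d2 p B(1,3) unit_disc(1,3)], of enn2real]
  by (simp add: enn2real_mult measure_def)

text \<open>
  This makes the factor between surface measure and cylinder volume the same for all hyperplanes.
\<close>

lemma unit_disc_rotation_invariant: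
  fixes p v :: "real^'d"
  assumes p: "norm p = 1" and v: "norm v = 1"
  shows "measure surf (unit_disc p) = measure surf (unit_disc v)"
    and "measure lborel (cyl (unit_disc p) p) = measure lborel (cyl (unit_disc v) v)"
proof -
  obtain T where T: "orthogonal_transformation T" and Tp: "T p = v"
    using orthogonal_transformation_exists_1[of p v] p v by auto
  have lin: "linear T" using T by (rule orthogonal_transformation_linear)
  have inv: "T (inv T x) = x" for x
    using orthogonal_transformation_bij[OF T] by (simp add: bij_is_surj surj_f_inv_f)
  have mem: "T x \<in> unit_disc v \<longleftrightarrow> x \<in> unit_disc p" for x
    using T by (simp add: unit_disc_def perp_def orthogonal_transformation_norm flip: Tp) (simp add: orthogonal_transformation_def)
  then have disc: "T ` unit_disc p = unit_disc v"
    by (metis image_subset_iff inv subsetI subset_antisym image_eqI)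
  then show "measure surf (unit_disc p) = measure surf (unit_disc v)"
    using surf_orthogonal_image(2)[OF d2 T unit_disc(1), of p] by (simp add: measure_def)
  have "T ` cyl (unit_disc p) p = cyl (unit_disc v) v"
  proof (intro equalityI subsetI)
    fix x assume "x \<in> cyl (unit_disc v) v"
    then obtain b t where bt: "x = b + t *\<^sub>R v" "b \<in> unit_disc v" "0 \<le> t" "t < 1" by (auto simp: cyl_def)
    moreover obtain a where "a \<in> unit_disc p" "b = T a" using bt(2) disc by auto
    ultimately show "x \<in> T ` cyl (unit_disc p) p"
      by (intro image_eqI[of _ _ "a + t *\<^sub>R p"]) (auto simp: linear_add[OF lin] linear_cmul[OF lin] Tp cyl_def)
  next
    fix x assume "x \<in> T ` cyl (unit_disc p) p"
    then obtain b t where bt: "x = T (b + t *\<^sub>R p)" "b \<in> unit_disc p" "0 \<le> t" "t < 1" by (auto simp: cyl_def)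
    then show "x \<in> cyl (unit_disc v) v"
      using mem[of b] unfolding cyl_def by (auto simp: linear_add[OF lin] linear_cmul[OF lin] Tp)
  qed
  moreover have c: "cyl (unit_disc q) q \<in> sets borel" if "norm q = 1" for q :: "real^'d"
    using cyl_borel[OF unit_disc(1,3), of q q] that by (simp add: norm_eq_1)
  ultimately show "measure lborel (cyl (unit_disc p) p) = measure lborel (cyl (unit_disc v) v)"
    using lborel_orthogonal_image[OF T] p by (metis measure_def)
qed

text \<open>
  The area formula for hyperplanes. The cylinders with generator \<open>v\<close> over the two sets have the
  same volume, and their heights are \<open>p \<bullet> v\<close> and \<open>1\<close>; the factor between area and cylinder volume
  is the same for both hyperplanes.
\<close>

lemma measure_surf_proj_along:
  fixes p v :: "real^'d"
  assumes p: "norm p = 1" and v: "norm v = 1" and pv: "0 < p \<bullet> v"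
    and B: "B \<in> sets borel" "bounded B" "B \<subseteq> perp p"
  shows "measure surf (proj_along v v ` B) = (p \<bullet> v) * measure surf B"
proof -
  let ?m = "measure lborel (cyl (unit_disc v) v)" and ?h = "measure surf (unit_disc v)"
  have pv': "p \<bullet> v \<noteq> 0" using pv by simp
  have "measure surf (proj_along v v ` B) * ?m = ?h * measure lborel (cyl (proj_along v v ` B) v)"
    by (intro measure_surf_perp v proj_along_image[OF pv' v B])
  also have "\<dots> = ?h * ((p \<bullet> v) * measure lborel (cyl B p))"
    using pv by (simp add: measure_def measure_cyl_proj_along[OF v pv' B] measure_cyl_tilt[OF p pv B(1,3)] enn2real_mult)
  also have "\<dots> = (p \<bullet> v) * (measure surf (unit_disc p) * measure lborel (cyl B p))"
    by (simp add: unit_disc_rotation_invariant[OF p v])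
  also have "\<dots> = (p \<bullet> v) * (measure surf B * ?m)"
    using measure_surf_perp[OF p B] by (simp add: unit_disc_rotation_invariant[OF p v])
  finally show ?thesis using measure_cyl_unit_disc_pos[OF v] by simp
qed

lemma measure_surf_perp_null:
  fixes v :: "real^'d"
  assumes v: "norm v = 1" and N: "N \<in> sets borel" "bounded N" "N \<subseteq> perp v" and neg: "negligible (cyl N v)"
  shows "measure surf N = 0"
proof -
  have "measure lborel (cyl N v) = 0"
    using neg cyl_borel[OF N(1,3)] v by (simp add: negligible_iff_measure norm_eq_1)
  then show ?thesis using measure_surf_perp[OF v N] measure_cyl_unit_disc_pos[OF v] by simp
qed

end

section \<open>Surfaces of convex sets\<close>

text \<open>
  The unit vectors of the normal cone of \<open>C\<close> at \<open>x\<close>. \<open>outer_normal\<close> is its element when there is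
  exactly one.
\<close>

definition normals :: "(real^'n) set \<Rightarrow> real^'n \<Rightarrow> (real^'n) set" where
  "normals C x = {n. norm n = 1 \<and> (\<forall>y \<in> C. n \<bullet> (y - x) \<le> 0)}"

text \<open>
  The preimage of \<open>D\<close> under the set-valued Gauss map.
\<close>

definition gauss_preimage :: "(real^'n) set \<Rightarrow> (real^'n) set \<Rightarrow> (real^'n) set" where
  "gauss_preimage C D = {x \<in> frontier C. normals C x \<inter> D \<noteq> {}}"

text \<open>
  As there is a normal at every boundary point, these are the points with several of them, where
  \<open>outer_normal\<close> takes its default value \<open>0\<close>.
\<close>

definition ridge :: "(real^'n) set \<Rightarrow> (real^'n) set" where
  "ridge C = {x \<in> frontier C. \<nexists>n. normals C x = {n}}"

lemma outer_normal_eq: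
  assumes "normals C x = {n}"
  shows "outer_normal C x = n"
proof -
  have "(norm \<nu> = 1 \<and> (\<forall>y \<in> C. \<nu> \<bullet> (y - x) \<le> 0)) \<longleftrightarrow> \<nu> = n" for \<nu>
    using assms unfolding normals_def by blast
  then show ?thesis by (simp add: outer_normal_def)
qed

lemma outer_normal_ridge:
  assumes "x \<in> ridge C"
  shows "outer_normal C x = 0"
proof -
  have "\<not> (\<exists>!\<nu>. norm \<nu> = 1 \<and> (\<forall>y \<in> C. \<nu> \<bullet> (y - x) \<le> 0))"
  proof
    assume "\<exists>!\<nu>. norm \<nu> = 1 \<and> (\<forall>y \<in> C. \<nu> \<bullet> (y - x) \<le> 0)"
    then obtain \<nu> where "normals C x = {\<nu>}" unfolding normals_def by blast
    then show False using assms by (auto simp: ridge_def)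
  qed
  then show ?thesis by (simp add: outer_normal_def)
qed

lemma borel_injective_image:
  fixes f :: "real^'n \<Rightarrow> real^'n"
  assumes K: "compact K" and f: "continuous_on K f" "inj_on f K" and A: "A \<in> sets borel" "A \<subseteq> K"
  shows "f ` A \<in> sets borel"
proof -
  obtain g where g: "homeomorphism K (f ` K) f g" using homeomorphism_compact[OF K f(1) refl f(2)] by blast
  have "continuous_on (f ` K) g" using g by (simp add: homeomorphism_def)
  then have "g \<in> borel_measurable (restrict_space borel (f ` K))" by (rule borel_measurable_continuous_on_restrict)
  then have "g -` A \<inter> f ` K \<in> sets (restrict_space borel (f ` K))"
    using measurable_sets[of g "restrict_space borel (f ` K)" borel A] A by (simp add: space_restrict_space)
  moreover have "f ` K \<in> sets borel" using compact_continuous_image[OF f(1) K] by (simp add: borel_compact)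
  ultimately have "g -` A \<inter> f ` K \<in> sets borel" by (simp add: sets_restrict_space_iff)
  moreover have "f ` A = g -` A \<inter> f ` K"
    using g A(2) by (auto simp: homeomorphism_def image_iff) 
  ultimately show ?thesis by simp
qed

lemma unit_sphere_net:
  assumes "0 < \<epsilon>"
  obtains F where "finite F" "F \<subseteq> sphere (0::real^'n) 1" "sphere 0 1 \<subseteq> (\<Union>p\<in>F. cball p \<epsilon>)"
proof -
  have "sphere (0::real^'n) 1 \<subseteq> (\<Union>p\<in>sphere 0 1. ball p \<epsilon>)" using assms by force
  then obtain F where F: "F \<subseteq> sphere (0::real^'n) 1" "finite F" "sphere 0 1 \<subseteq> (\<Union>p\<in>F. ball p \<epsilon>)"
    using compactE_image[of "sphere (0::real^'n) 1" "sphere 0 1" "\<lambda>p. ball p \<epsilon>"] by auto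
  moreover have "(\<Union>p\<in>F. ball p \<epsilon>) \<subseteq> (\<Union>p\<in>F. cball p \<epsilon>)" using ball_subset_cball by blast
  ultimately show ?thesis using that by (meson subset_trans)
qed

lemma compact_halfspace_sphere: "compact {n \<in> sphere (0::real^'n) 1. \<eta> \<le> n \<bullet> v}"
proof -
  have "closed {n::real^'n. \<eta> \<le> n \<bullet> v}" by (intro closed_Collect_le continuous_intros)
  then have "compact (sphere 0 1 \<inter> {n::real^'n. \<eta> \<le> n \<bullet> v})" by (intro compact_Int_closed) auto
  then show ?thesis by (simp add: Int_def)
qed

context
  fixes C :: "(real^'d::finite) set"
  assumes d2: "CARD('d) \<ge> 2"
    and C: "open C" "convex C" "bounded C" "C \<noteq> {}"
begin

lemma normals_closure:
  assumes "n \<in> normals C x" "y \<in> closure C"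
  shows "n \<bullet> (y - x) \<le> 0"
proof -
  have "closed {y. n \<bullet> (y - x) \<le> 0}" by (intro closed_Collect_le continuous_intros)
  moreover have "C \<subseteq> {y. n \<bullet> (y - x) \<le> 0}" using assms by (auto simp: normals_def)
  ultimately show ?thesis using closure_minimal[of C] assms by auto
qed

lemma normals_strict:
  assumes "n \<in> normals C x" "y \<in> C"
  shows "n \<bullet> (y - x) < 0"
proof -
  have nn: "n \<bullet> n = 1" using assms by (simp add: normals_def norm_eq_1)
  obtain e where e: "0 < e" "cball y e \<subseteq> C" using C assms open_contains_cball by blast
  have "y + e *\<^sub>R n \<in> C" using e assms by (intro subsetD[OF e(2)]) (auto simp: dist_norm normals_def)
  then have "n \<bullet> (y + e *\<^sub>R n - x) \<le> 0" using assms by (auto simp: normals_def)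
  then show ?thesis using e nn by (simp add: inner_diff_right inner_add_right)
qed

lemma normals_nonempty:
  assumes "x \<in> frontier C"
  shows "normals C x \<noteq> {}"
proof -
  have "x \<in> closure C" "x \<notin> rel_interior C"
    using assms C by (auto simp: frontier_def interior_open rel_interior_open)
  then obtain a where a: "a \<noteq> 0" "\<And>y. y \<in> closure C \<Longrightarrow> a \<bullet> x \<le> a \<bullet> y"
    using supporting_hyperplane_relative_frontier[OF C(2)] by metis
  have "a \<bullet> x \<le> a \<bullet> y" if "y \<in> C" for y using a(2) that closure_subset by blast
  then have "- (a /\<^sub>R norm a) \<in> normals C x"
    using a(1) by (auto simp: normals_def inner_diff_right divide_right_mono)
  then show ?thesis by blast
qed

lemma compact_frontier_C: "compact (frontier C)"
  using C by (simp add: compact_frontier_bounded)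

text \<open>
  The relation between boundary points and their normals is closed. This is the source of all
  measurability statements about normals.
\<close>

lemma compact_gauss_preimage:
  assumes D: "compact D"
  shows "compact (gauss_preimage C D)"
proof -
  let ?S = "{z. norm (snd z) = 1 \<and> (\<forall>y\<in>C. snd z \<bullet> (y - fst z) \<le> 0)} :: ((real^'d) \<times> (real^'d)) set"
  have "?S = {z. norm (snd z) = 1} \<inter> (\<Inter>y\<in>C. {z. snd z \<bullet> (y - fst z) \<le> 0})" by auto
  also have "closed \<dots>"
    by (intro closed_Int closed_INT ballI closed_Collect_le closed_Collect_eq continuous_intros)
  finally have "closed ?S" .
  then have "compact ((frontier C \<times> D) \<inter> ?S)"
    using compact_frontier_C D by (intro compact_Int_closed compact_Times)
  then have "compact (fst ` ((frontier C \<times> D) \<inter> ?S))"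
    by (intro compact_continuous_image continuous_intros)
  also have "fst ` ((frontier C \<times> D) \<inter> ?S) = gauss_preimage C D"
  proof (intro equalityI subsetI)
    fix x assume "x \<in> gauss_preimage C D"
    then obtain n where "x \<in> frontier C" "n \<in> normals C x" "n \<in> D" unfolding gauss_preimage_def by blast
    then show "x \<in> fst ` ((frontier C \<times> D) \<inter> ?S)"
      by (intro image_eqI[of _ _ "(x, n)"]) (auto simp: normals_def)
  qed (auto simp: gauss_preimage_def normals_def)
  finally show ?thesis .
qed

lemma gauss_preimage_subset: "gauss_preimage C D \<subseteq> frontier C"
  by (auto simp: gauss_preimage_def)

text \<open>
  Convexity makes the boundary flat where normals are close to each other: by the supporting
  half-spaces at \<open>x\<close> and at \<open>y\<close>, the displacement \<open>x - y\<close> is almost orthogonal to both normals.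
  This takes the place of a local parametrisation of the boundary.
\<close>

lemma gauss_preimage_flat:
  assumes x: "x \<in> gauss_preimage C (cball p \<epsilon>)" and y: "y \<in> gauss_preimage C (cball p \<epsilon>)"
  shows "\<bar>p \<bullet> (x - y)\<bar> \<le> \<epsilon> * norm (x - y)"
proof -
  have *: "p \<bullet> (y - x) \<le> \<epsilon> * norm (y - x)"
    if x: "x \<in> gauss_preimage C (cball p \<epsilon>)" and y: "y \<in> gauss_preimage C (cball p \<epsilon>)" for x y
  proof -
    obtain n where n: "n \<in> normals C x" "norm (p - n) \<le> \<epsilon>"
      using x unfolding gauss_preimage_def mem_Collect_eq ex_in_conv[symmetric] Int_iff mem_cball dist_norm by blast
    have "y \<in> closure C" using y by (auto simp: gauss_preimage_def frontier_def)
    then have "n \<bullet> (y - x) \<le> 0" using normals_closure n by blast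
    moreover have "(p - n) \<bullet> (y - x) \<le> \<epsilon> * norm (y - x)"
      using n by (intro order_trans[OF norm_cauchy_schwarz] mult_right_mono) auto
    ultimately show ?thesis by (simp add: inner_diff_left)
  qed
  show ?thesis using *[OF x y] *[OF y x] by (simp add: abs_le_iff inner_diff_right norm_minus_commute)
qed

lemma proj_along_near_isometry:
  assumes v: "norm v = 1" and pv: "0 < p \<bullet> v"
    and x: "x \<in> gauss_preimage C (cball p \<epsilon>)" and y: "y \<in> gauss_preimage C (cball p \<epsilon>)"
  shows "norm (proj_along p v x - proj_along p v y) \<le> (1 + \<epsilon> / (p \<bullet> v)) * norm (x - y)"
    and "(1 - \<epsilon> / (p \<bullet> v)) * norm (x - y) \<le> norm (proj_along p v x - proj_along p v y)"
proof -
  \<comment> \<open>The projection changes \<open>x - y\<close> by a multiple of \<open>v\<close> that is small because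
    \<open>x - y\<close> is nearly orthogonal to \<open>p\<close>.\<close>
  have eq: "proj_along p v x - proj_along p v y = (x - y) - (p \<bullet> (x - y) / (p \<bullet> v)) *\<^sub>R v"
    by (simp add: proj_along_def inner_diff_right algebra_simps diff_divide_distrib)
  have "norm ((p \<bullet> (x - y) / (p \<bullet> v)) *\<^sub>R v) = \<bar>p \<bullet> (x - y)\<bar> / (p \<bullet> v)" using v pv by simp
  also have "\<dots> \<le> \<epsilon> * norm (x - y) / (p \<bullet> v)"
    using gauss_preimage_flat[OF x y] pv by (intro divide_right_mono) auto
  finally have b: "norm ((p \<bullet> (x - y) / (p \<bullet> v)) *\<^sub>R v) \<le> \<epsilon> / (p \<bullet> v) * norm (x - y)" by simp
  show "norm (proj_along p v x - proj_along p v y) \<le> (1 + \<epsilon> / (p \<bullet> v)) * norm (x - y)"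
    unfolding eq ring_distribs using b norm_triangle_ineq4[of "x - y" "(p \<bullet> (x - y) / (p \<bullet> v)) *\<^sub>R v"] by linarith
  show "(1 - \<epsilon> / (p \<bullet> v)) * norm (x - y) \<le> norm (proj_along p v x - proj_along p v y)"
    unfolding eq ring_distribs using b norm_triangle_ineq2[of "x - y" "(p \<bullet> (x - y) / (p \<bullet> v)) *\<^sub>R v"] by linarith
qed

text \<open>
  On such a flat piece the projection and its inverse are Lipschitz, with constants close to \<open>1\<close>
  for small \<open>\<epsilon>\<close>.
\<close>

lemma proj_along_gauss_preimage:
  assumes v: "norm v = 1" and pv: "0 < p \<bullet> v" and e: "0 \<le> \<epsilon>" "\<epsilon> < p \<bullet> v"
    and A: "A \<in> sets borel" "A \<subseteq> gauss_preimage C (cball p \<epsilon>)"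
  shows "proj_along p v ` A \<in> sets borel" "bounded (proj_along p v ` A)" "proj_along p v ` A \<subseteq> perp p"
    and "emeasure surf (proj_along p v ` A) \<le> ennreal ((1 + \<epsilon> / (p \<bullet> v)) ^ (CARD('d) - 1)) * emeasure surf A"
    and "emeasure surf A \<le> ennreal ((1 / (1 - \<epsilon> / (p \<bullet> v))) ^ (CARD('d) - 1)) * emeasure surf (proj_along p v ` A)"
proof -
  let ?G = "gauss_preimage C (cball p \<epsilon>)" and ?\<delta> = "\<epsilon> / (p \<bullet> v)" and ?f = "proj_along p v"
  have d: "0 \<le> ?\<delta>" "?\<delta> < 1" using e pv by auto
  have K: "compact ?G" by (intro compact_gauss_preimage compact_cball)
  have near: "norm (?f x - ?f y) \<le> (1 + ?\<delta>) * norm (x - y)" "(1 - ?\<delta>) * norm (x - y) \<le> norm (?f x - ?f y)"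
    if "x \<in> ?G" "y \<in> ?G" for x y
    using proj_along_near_isometry[OF v pv that] by auto
  have inj: "inj_on ?f ?G"
  proof (rule inj_onI)
    fix x y assume "x \<in> ?G" "y \<in> ?G" "?f x = ?f y"
    then have "(1 - ?\<delta>) * norm (x - y) \<le> 0" using near(2)[of x y] by simp
    then show "x = y" using d by (simp add: mult_le_0_iff)
  qed
  have cont: "continuous_on S ?f" for S unfolding proj_along_def by (intro continuous_intros) (use pv in auto)
  show fA: "?f ` A \<in> sets borel" by (rule borel_injective_image[OF K cont inj A])
  show "bounded (?f ` A)"
    using compact_imp_bounded[OF compact_continuous_image[OF cont K]] A(2) by (meson bounded_subset image_mono)
  show "?f ` A \<subseteq> perp p" using pv by (auto intro!: proj_along_perp)
  show "emeasure surf (?f ` A) \<le> ennreal ((1 + ?\<delta>) ^ (CARD('d) - 1)) * emeasure surf A"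
  proof (rule surf_lipschitz_image[OF d2 _ A(1) fA])
    show "norm (?f x - ?f y) \<le> (1 + ?\<delta>) * norm (x - y)" if "x \<in> A" "y \<in> A" for x y
      using that A(2) near(1) by blast
  qed (use d in simp)
  define g where "g = the_inv_into A ?f"
  have injA: "inj_on ?f A" using inj A(2) by (rule inj_on_subset)
  then have g: "g (?f x) = x" if "x \<in> A" for x using that by (simp add: g_def the_inv_into_f_f)
  then have gA: "g ` ?f ` A = A" by force
  have "emeasure surf (g ` ?f ` A) \<le> ennreal ((1 / (1 - ?\<delta>)) ^ (CARD('d) - 1)) * emeasure surf (?f ` A)"
  proof (rule surf_lipschitz_image[OF d2])
    fix x' y' assume "x' \<in> ?f ` A" "y' \<in> ?f ` A"
    then obtain x y where xy: "x \<in> A" "y \<in> A" "x' = ?f x" "y' = ?f y" by auto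
    then have "(1 - ?\<delta>) * norm (x - y) \<le> norm (x' - y')" using near(2)[of x y] A(2) by auto
    then show "norm (g x' - g y') \<le> 1 / (1 - ?\<delta>) * norm (x' - y')"
      using xy g d by (simp add: field_simps)
  qed (use d A fA gA in auto)
  then show "emeasure surf A \<le> ennreal ((1 / (1 - ?\<delta>)) ^ (CARD('d) - 1)) * emeasure surf (?f ` A)"
    by (simp only: gA)
qed

lemma surf_frontier_finite: "emeasure surf (frontier C) < \<infinity>"
proof -
  obtain F where F: "finite F" "F \<subseteq> sphere (0::real^'d) 1" "sphere 0 1 \<subseteq> (\<Union>p\<in>F. cball p (1/2))"
    using unit_sphere_net[of "1/2"] by auto
  let ?G = "\<lambda>p. gauss_preimage C (cball p (1/2))"
  have G: "?G p \<in> sets borel" for p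
    using compact_gauss_preimage[of "cball p (1/2)"] by (simp add: borel_compact)
  have fin: "emeasure surf (?G p) < \<infinity>" if "p \<in> F" for p
  proof -
    have p: "norm p = 1" using that F by auto
    then have pp: "p \<bullet> p = 1" by (simp add: norm_eq_1)
    note P = proj_along_gauss_preimage[OF p, of p "1/2" "?G p", unfolded pp, OF _ _ _ G order_refl, simplified]
    have "emeasure surf (proj_along p p ` ?G p) < \<infinity>"
      using p by (intro surf_bounded_perp_finite[OF d2, of p] P) auto
    then show ?thesis using P(5) by (auto intro: le_less_trans simp: ennreal_mult_less_top)
  qed
  have "frontier C \<subseteq> (\<Union>p\<in>F. ?G p)"
  proof
    fix x assume x: "x \<in> frontier C"
    then obtain n where n: "n \<in> normals C x" using normals_nonempty by blast
    then have "n \<in> sphere 0 1" by (simp add: normals_def)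
    then obtain p where "p \<in> F" "n \<in> cball p (1/2)" using F by blast
    moreover have "x \<in> ?G p" using x n \<open>n \<in> cball p (1/2)\<close> unfolding gauss_preimage_def by blast
    ultimately show "x \<in> (\<Union>p\<in>F. ?G p)" by blast
  qed
  then have "emeasure surf (frontier C) \<le> emeasure surf (\<Union>p\<in>F. ?G p)"
    using F G by (intro emeasure_mono) auto
  also have "\<dots> \<le> (\<Sum>p\<in>F. emeasure surf (?G p))"
    using F G by (intro emeasure_subadditive_finite) auto
  also have "\<dots> < \<infinity>" using F fin by (simp add: ennreal_sum_less_top)
  finally show ?thesis .
qed

lemma surf_subset_frontier_finite:
  "A \<in> sets borel \<Longrightarrow> A \<subseteq> frontier C \<Longrightarrow> emeasure surf A < \<infinity>"
  using surf_frontier_finite emeasure_mono[of A "frontier C" surf] by (auto simp: borel_closed intro: le_less_trans)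

text \<open>
  The translates of \<open>B\<close> by different multiples of \<open>w\<close> are disjoint, and infinitely many of them
  fit into a bounded part of the hyperplane, which has finite measure.
\<close>

lemma disjoint_translates_null:
  fixes p w :: "real^'d"
  assumes p: "p \<noteq> 0" and B: "B \<in> sets borel" "bounded B" "B \<subseteq> perp p" and w: "w \<in> perp p"
    and disj: "\<And>x y t. \<lbrakk>x \<in> B; y \<in> B; x - y = t *\<^sub>R w\<rbrakk> \<Longrightarrow> t = 0"
  shows "measure surf B = 0"
proof -
  obtain R where R: "\<And>x. x \<in> B \<Longrightarrow> norm x \<le> R" using B by (auto simp: bounded_iff)
  define D where "D = perp p \<inter> cball 0 (R + norm w)"
  have D: "D \<in> sets borel" "bounded D" "D \<subseteq> perp p" by (auto simp: D_def bounded_Int)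
  have Dfin: "emeasure surf D \<noteq> \<infinity>" using surf_bounded_perp_finite[OF d2 p D] by simp
  define T where "T k = (+) ((1 / real (Suc k)) *\<^sub>R w) ` B" for k
  have T: "T k \<in> sets borel" "measure surf (T k) = measure surf B" for k
    unfolding T_def measure_def by (simp_all add: surf_translation[OF d2 B(1)])
  have TD: "T k \<subseteq> D" for k
  proof
    fix y assume "y \<in> T k"
    then obtain x where x: "x \<in> B" "y = (1 / real (Suc k)) *\<^sub>R w + x" by (auto simp: T_def)
    have "norm ((1 / real (Suc k)) *\<^sub>R w) \<le> norm w" by (simp add: field_simps)
    then have "norm y \<le> norm w + R" using R[OF x(1)] x(2) norm_triangle_le add_mono by blast
    moreover have "y \<in> perp p" using x B(3) w by (auto simp: perp_def inner_add_right)
    ultimately show "y \<in> D" by (auto simp: D_def)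
  qed
  have "disjoint_family T"
    unfolding disjoint_family_on_def
  proof (intro ballI impI)
    fix j k :: nat assume "j \<noteq> k"
    have False if z: "z \<in> T j" "z \<in> T k" for z
    proof -
      obtain x y where xy: "x \<in> B" "y \<in> B" "z = (1 / real (Suc j)) *\<^sub>R w + x" "z = (1 / real (Suc k)) *\<^sub>R w + y"
        using z by (auto simp: T_def)
      then have "x - y = (1 / real (Suc k) - 1 / real (Suc j)) *\<^sub>R w" by (simp add: algebra_simps)
      then have "1 / real (Suc k) - 1 / real (Suc j) = 0" using disj xy by blast
      then show False using \<open>j \<noteq> k\<close> by simp
    qed
    then show "T j \<inter> T k = {}" by blast
  qed
  then have dis: "disjoint_family_on T {..<n}" for n by (auto simp: disjoint_family_on_def)
  have fin: "emeasure surf (T k) \<noteq> \<infinity>" for k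
    using emeasure_mono[OF TD[of k], of surf] D(1) Dfin by (auto simp: top_unique)
  have bound: "real n * measure surf B \<le> measure surf D" for n
  proof -
    have "real n * measure surf B = (\<Sum>k<n. measure surf (T k))" using T by simp
    also have "\<dots> = measure surf (\<Union>k<n. T k)"
      using T fin dis by (intro measure_finite_Union[symmetric]) auto
    also have "\<dots> \<le> measure surf D"
      using TD T D(1) Dfin by (intro measure_mono_fmeasurable) (auto simp: fmeasurable_def less_top)
    finally show ?thesis .
  qed
  show ?thesis
  proof (rule ccontr)
    assume "measure surf B \<noteq> 0"
    then have "0 < measure surf B" by (simp add: zero_less_measure_iff)
    then obtain n :: nat where "measure surf D < real n * measure surf B" using reals_Archimedean3 by blast
    then show False using bound[of n] by simp
  qed
qed

text \<open>
  At the points of this set there are normals near \<open>p\<close> and normals near \<open>q\<close>, so that differences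
  of points are almost orthogonal to two independent directions: the set is essentially of
  dimension \<open>d - 2\<close>.
\<close>

lemma gauss_preimage_two_null:
  assumes p: "norm p = 1" and q: "norm q = 1" and e: "0 \<le> \<epsilon>" "\<epsilon> \<le> 1/2" and pq: "4 * \<epsilon> < norm (proj_along p p q)"
  shows "emeasure surf (gauss_preimage C (cball p \<epsilon>) \<inter> gauss_preimage C (cball q \<epsilon>)) = 0"
proof -
  have pp: "p \<bullet> p = 1" using p by (simp add: norm_eq_1)
  define A where "A = gauss_preimage C (cball p \<epsilon>) \<inter> gauss_preimage C (cball q \<epsilon>)"
  define w where "w = proj_along p p q"
  have A: "A \<in> sets borel" "A \<subseteq> gauss_preimage C (cball p \<epsilon>)"
    unfolding A_def by (auto intro!: sets.Int borel_compact compact_gauss_preimage)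
  have w: "w \<in> perp p" using pp by (simp add: w_def proj_along_perp)
  have "0 < p \<bullet> p" "\<epsilon> < p \<bullet> p" using e pp by auto
  note P = proj_along_gauss_preimage[OF p this(1) e(1) this(2) A]
  have "measure surf (proj_along p p ` A) = 0"
  proof (rule disjoint_translates_null[OF _ P(1-3) w])
    show "p \<noteq> 0" using p by auto
    fix x' y' t assume "x' \<in> proj_along p p ` A" "y' \<in> proj_along p p ` A" and t: "x' - y' = t *\<^sub>R w"
    then obtain x y where xy: "x \<in> A" "y \<in> A" "x' = proj_along p p x" "y' = proj_along p p y" by auto
    have fp: "\<bar>p \<bullet> (x - y)\<bar> \<le> \<epsilon> * norm (x - y)" and fq: "\<bar>q \<bullet> (x - y)\<bar> \<le> \<epsilon> * norm (x - y)"
      using gauss_preimage_flat xy by (auto simp: A_def)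
    have "(1/2) * norm (x - y) \<le> (1 - \<epsilon>) * norm (x - y)" using e by (intro mult_right_mono) auto
    also have "\<dots> \<le> norm (x' - y')"
      using proj_along_near_isometry(2)[OF p, of p x \<epsilon> y] xy pp by (auto simp: A_def)
    finally have n: "norm (x - y) \<le> 2 * norm (x' - y')" by simp
    \<comment> \<open>A displacement along \<open>w\<close> inside the image would be almost orthogonal to \<open>p\<close>
      and \<open>q\<close>, hence to \<open>w\<close>.\<close>
    have "w \<bullet> (x' - y') = q \<bullet> (x - y) - (p \<bullet> q) * (p \<bullet> (x - y))"
      by (simp add: xy w_def proj_along_def pp inner_diff_left inner_diff_right algebra_simps inner_commute)
    then have "\<bar>w \<bullet> (x' - y')\<bar> \<le> \<bar>q \<bullet> (x - y)\<bar> + \<bar>p \<bullet> q\<bar> * \<bar>p \<bullet> (x - y)\<bar>" by (simp add: abs_mult[symmetric])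
    also have "\<bar>p \<bullet> q\<bar> * \<bar>p \<bullet> (x - y)\<bar> \<le> 1 * \<bar>p \<bullet> (x - y)\<bar>"
      using Cauchy_Schwarz_ineq2[of p q] p q by (intro mult_right_mono) auto
    finally have "\<bar>w \<bullet> (x' - y')\<bar> \<le> 2 * \<epsilon> * norm (x - y)" using fp fq by simp
    also have "\<dots> \<le> 2 * \<epsilon> * (2 * norm (x' - y'))" using n e by (intro mult_left_mono) auto
    finally have "\<bar>t\<bar> * (norm w * norm w) \<le> (4 * \<epsilon>) * (\<bar>t\<bar> * norm w)"
      by (simp add: t abs_mult dot_square_norm power2_eq_square)
    then have "(\<bar>t\<bar> * norm w) * (norm w - 4 * \<epsilon>) \<le> 0" by (simp add: algebra_simps)
    moreover have "0 < norm w - 4 * \<epsilon>" "0 < norm w" using pq e by (auto simp: w_def)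
    ultimately show "t = 0" by (simp add: mult_le_0_iff)
  qed
  moreover have "emeasure surf (proj_along p p ` A) < \<infinity>"
  proof (rule surf_bounded_perp_finite[OF d2 _ P(1-3)])
    show "p \<noteq> 0" using p by auto
  qed
  ultimately have "emeasure surf (proj_along p p ` A) = 0" by (simp add: emeasure_eq_ennreal_measure less_top)
  then show ?thesis using P(5) by (simp add: A_def)
qed

lemma normals_not_opposite:
  assumes "n \<in> normals C x" "m \<in> normals C x"
  shows "m \<noteq> - n"
proof
  obtain y where y: "y \<in> C" using C by blast
  assume "m = - n"
  then show False using normals_strict[OF assms(1) y] normals_strict[OF assms(2) y] by simp
qed

text \<open>
  Countably many directions \<open>p\<close>, \<open>q\<close> suffice to detect two different normals. They cannot be
  opposite, since \<open>C\<close> is open and nonempty; this bounds \<open>proj_along p p q\<close> away from \<open>0\<close>.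
\<close>

lemma ridge_eq_Union:
  obtains I :: "((real^'d) \<times> (real^'d) \<times> nat) set" where "countable I"
    "\<And>p q m. (p, q, m) \<in> I \<Longrightarrow> norm p = 1 \<and> norm q = 1 \<and> 4 / real (m + 2) < norm (proj_along p p q)"
    "ridge C = (\<Union>(p, q, m)\<in>I. gauss_preimage C (cball p (1 / real (m + 2))) \<inter> gauss_preimage C (cball q (1 / real (m + 2))))"
proof -
  obtain T where T: "countable T" "T \<subseteq> sphere (0::real^'d) 1" "sphere 0 1 \<subseteq> closure T"
    using separable[of "sphere (0::real^'d) 1"] by blast
  define \<epsilon> where "\<epsilon> m = 1 / real (m + 2)" for m :: nat
  define G where "G = (\<lambda>(p, q, m). gauss_preimage C (cball p (\<epsilon> m)) \<inter> gauss_preimage C (cball q (\<epsilon> m)))"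
  define I where "I = {(p, q, m). p \<in> T \<and> q \<in> T \<and> 4 * \<epsilon> m < norm (proj_along p p q)}"
  have "countable I"
    by (rule countable_subset[of _ "T \<times> T \<times> UNIV"]) (auto simp: I_def T)
  moreover have "norm p = 1 \<and> norm q = 1 \<and> 4 / real (m + 2) < norm (proj_along p p q)" if "(p, q, m) \<in> I" for p q m
    using that T(2) by (auto simp: I_def \<epsilon>_def)
  moreover have "ridge C = (\<Union>(p, q, m)\<in>I. G (p, q, m))"
  proof (intro equalityI subsetI)
    fix x assume x: "x \<in> (\<Union>(p, q, m)\<in>I. G (p, q, m))"
    then obtain p q m where I: "(p, q, m) \<in> I" and xp: "x \<in> gauss_preimage C (cball p (\<epsilon> m))"
      and xq: "x \<in> gauss_preimage C (cball q (\<epsilon> m))"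
      by (auto simp: G_def)
    have p: "p \<bullet> p = 1" "norm p = 1" using I T by (auto simp: I_def norm_eq_1)
    have "normals C x \<noteq> {n}" for n
    proof
      assume "normals C x = {n}"
      then have "dist p n \<le> \<epsilon> m" "dist q n \<le> \<epsilon> m" using xp xq by (auto simp: gauss_preimage_def)
      then have pq: "norm (q - p) \<le> 2 * \<epsilon> m" using dist_triangle2[of q p n] by (simp add: dist_norm)
      have "proj_along p p q = (q - p) - (p \<bullet> (q - p)) *\<^sub>R p" by (simp add: proj_along_def p inner_diff_right algebra_simps)
      then have "norm (proj_along p p q) \<le> norm (q - p) + \<bar>p \<bullet> (q - p)\<bar>"
        using norm_triangle_ineq4[of "q - p" "(p \<bullet> (q - p)) *\<^sub>R p"] p by simp
      also have "\<dots> \<le> 4 * \<epsilon> m" using Cauchy_Schwarz_ineq2[of p "q - p"] p pq by simp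
      finally show False using I by (simp add: I_def)
    qed
    then show "x \<in> ridge C" using xp by (auto simp: ridge_def gauss_preimage_def)
  next
    fix x assume x: "x \<in> ridge C"
    then have fx: "x \<in> frontier C" by (simp add: ridge_def)
    obtain n where n: "n \<in> normals C x" using normals_nonempty[OF fx] by blast
    obtain k where k: "k \<in> normals C x" "k \<noteq> n" using x n by (auto simp: ridge_def)
    have nn: "n \<bullet> n = 1" "norm n = 1" "norm k = 1" using n k by (auto simp: normals_def norm_eq_1)
    define w where "w = proj_along n n k"
    have "w \<noteq> 0"
    proof
      assume "w = 0"
      then have kn: "k = (n \<bullet> k) *\<^sub>R n" by (simp add: w_def proj_along_def nn)
      then have "\<bar>n \<bullet> k\<bar> = 1" using nn by (metis norm_scaleR mult.right_neutral)
      then have "k = n \<or> k = - n" using kn by (auto simp: abs_if split: if_splits)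
      then show False using k normals_not_opposite[OF n k(1)] by blast
    qed
    then obtain m0 :: nat where m0: "8 / norm w < real m0" using reals_Archimedean2 by blast
    define m where "m = m0"
    \<comment> \<open>The factor 8 leaves room for the perturbation of \<open>w\<close>, which costs at most
      \<open>4 * \<epsilon> m\<close>.\<close>
    have em: "8 * \<epsilon> m < norm w" "0 < \<epsilon> m"
    proof -
      have "8 < real m0 * norm w" using m0 \<open>w \<noteq> 0\<close> by (simp add: field_simps)
      then have "8 < real (m0 + 2) * norm w" using \<open>w \<noteq> 0\<close> zero_less_norm_iff[of w] by (simp add: distrib_right del: zero_less_norm_iff)
      then show "8 * \<epsilon> m < norm w" by (simp add: \<epsilon>_def m_def field_simps)
      show "0 < \<epsilon> m" by (simp add: \<epsilon>_def)
    qed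
    have "n \<in> closure T" "k \<in> closure T" using nn T(3) by auto
    then obtain p q where p: "p \<in> T" "dist p n < \<epsilon> m" and q: "q \<in> T" "dist q k < \<epsilon> m"
      using em(2) closure_approachable by metis
    have pn: "norm p = 1" "p \<bullet> p = 1" "norm q = 1" using p q T(2) by (auto simp: norm_eq_1)
    have pk: "\<bar>n \<bullet> k - p \<bullet> q\<bar> \<le> 2 * \<epsilon> m"
    proof -
      have "n \<bullet> k - p \<bullet> q = (n - p) \<bullet> k + p \<bullet> (k - q)" by (simp add: inner_diff_left inner_diff_right)
      then have "\<bar>n \<bullet> k - p \<bullet> q\<bar> \<le> norm (n - p) * norm k + norm p * norm (k - q)"
        using Cauchy_Schwarz_ineq2[of "n - p" k] Cauchy_Schwarz_ineq2[of p "k - q"] by linarith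
      then show ?thesis using p q pn nn by (simp add: dist_norm norm_minus_commute)
    qed
    have "w - proj_along p p q = (k - q) - ((n \<bullet> k) *\<^sub>R (n - p) + (n \<bullet> k - p \<bullet> q) *\<^sub>R p)"
      by (simp add: w_def proj_along_def nn pn algebra_simps)
    then have "norm (w - proj_along p p q) \<le> norm (k - q) + norm ((n \<bullet> k) *\<^sub>R (n - p) + (n \<bullet> k - p \<bullet> q) *\<^sub>R p)"
      by (metis norm_triangle_ineq4)
    also have "\<dots> \<le> norm (k - q) + (norm ((n \<bullet> k) *\<^sub>R (n - p)) + norm ((n \<bullet> k - p \<bullet> q) *\<^sub>R p))"
      by (intro add_left_mono norm_triangle_ineq)
    also have "\<dots> = norm (k - q) + \<bar>n \<bullet> k\<bar> * norm (n - p) + \<bar>n \<bullet> k - p \<bullet> q\<bar>" using pn by simp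
    also have "\<bar>n \<bullet> k\<bar> * norm (n - p) \<le> 1 * norm (n - p)"
      using Cauchy_Schwarz_ineq2[of n k] nn by (intro mult_right_mono) auto
    finally have "norm (w - proj_along p p q) \<le> 4 * \<epsilon> m" using p q pk by (simp add: dist_norm norm_minus_commute)
    then have "4 * \<epsilon> m < norm (proj_along p p q)" using em(1) norm_triangle_ineq2[of w "proj_along p p q"] by linarith
    then have "(p, q, m) \<in> I" using p q by (simp add: I_def)
    moreover have "n \<in> cball p (\<epsilon> m)" "k \<in> cball q (\<epsilon> m)" using p q by auto
    then have "x \<in> G (p, q, m)" using fx n k unfolding G_def gauss_preimage_def by blast
    ultimately show "x \<in> (\<Union>(p, q, m)\<in>I. G (p, q, m))" by blast
  qed
  ultimately show ?thesis by (intro that[of I]) (auto simp: G_def \<epsilon>_def)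
qed

lemma ridge_borel [measurable]: "ridge C \<in> sets borel"
  and surf_ridge_null: "emeasure surf (ridge C) = 0"
proof -
  obtain I :: "((real^'d) \<times> (real^'d) \<times> nat) set" where I: "countable I"
    "\<And>p q m. (p, q, m) \<in> I \<Longrightarrow> norm p = 1 \<and> norm q = 1 \<and> 4 / real (m + 2) < norm (proj_along p p q)"
    "ridge C = (\<Union>(p, q, m)\<in>I. gauss_preimage C (cball p (1 / real (m + 2))) \<inter> gauss_preimage C (cball q (1 / real (m + 2))))"
    using ridge_eq_Union by blast
  let ?G = "\<lambda>(p, q, m). gauss_preimage C (cball p (1 / real (m + 2))) \<inter> gauss_preimage C (cball q (1 / real (m + 2)))"
  have G: "?G i \<in> sets borel" for i
    by (cases i) (auto intro!: sets.Int borel_compact compact_gauss_preimage)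
  show "ridge C \<in> sets borel"
    unfolding I(3) by (rule sets.countable_UN''[OF I(1) G])
  have "emeasure surf (?G i) = 0" if "i \<in> I" for i
  proof (cases i)
    case (fields p q m)
    then show ?thesis using I(2)[of p q m] that gauss_preimage_two_null[of p q "1 / real (m + 2)"] by simp
  qed
  then have "(\<Union>i\<in>I. ?G i) \<in> null_sets surf"
    using G by (intro null_sets_UN'[OF I(1)]) (auto simp: null_sets_def)
  then show "emeasure surf (ridge C) = 0" by (simp add: I(3) null_sets_def)
qed

lemma off_ridge:
  assumes "x \<in> frontier C - ridge C"
  shows "normals C x = {outer_normal C x}"
  using assms outer_normal_eq[of C x] by (auto simp: ridge_def)

lemma norm_outer_normal_le: 
  assumes "x \<in> frontier C"
  shows "norm (outer_normal C x) \<le> 1"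
proof (cases "x \<in> ridge C")
  case False
  then have "outer_normal C x \<in> normals C x" using off_ridge assms by blast
  then show ?thesis by (simp add: normals_def)
qed (simp add: outer_normal_ridge)

lemma outer_normal_measurable:
  "(\<lambda>x. indicator (frontier C) x *\<^sub>R outer_normal C x) \<in> borel_measurable borel"
proof (rule borel_measurable_euclidean_space[THEN iffD2], intro ballI)
  fix w :: "real^'d" assume "w \<in> Basis"
  let ?g = "\<lambda>x. (indicator (frontier C) x *\<^sub>R outer_normal C x) \<bullet> w"
  have "{x \<in> space borel. a \<le> ?g x} \<in> sets borel" for a
  proof -
    let ?P = "gauss_preimage C {n \<in> sphere 0 1. a \<le> n \<bullet> w}"
    have [measurable]: "?P \<in> sets borel" by (intro borel_compact compact_gauss_preimage compact_halfspace_sphere)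
    have [measurable]: "frontier C \<in> sets borel" by (simp add: borel_closed)
    have mem: "x \<in> ?P \<longleftrightarrow> a \<le> outer_normal C x \<bullet> w" if "x \<in> frontier C - ridge C" for x
    proof -
      have "outer_normal C x \<in> normals C x" using off_ridge[OF that] by blast
      then have "norm (outer_normal C x) = 1" by (simp add: normals_def)
      then show ?thesis using that off_ridge[OF that] by (auto simp: gauss_preimage_def)
    qed
    have "{x \<in> space borel. a \<le> ?g x} = (?P - ridge C) \<union> (if a \<le> 0 then (- frontier C) \<union> ridge C else {})"
    proof (intro set_eqI)
      fix x
      consider "x \<notin> frontier C" | "x \<in> ridge C" | "x \<in> frontier C - ridge C" by blast
      then show "x \<in> {x \<in> space borel. a \<le> ?g x} \<longleftrightarrow> x \<in> (?P - ridge C) \<union> (if a \<le> 0 then (- frontier C) \<union> ridge C else {})"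
      proof cases
        case 1
        then show ?thesis using gauss_preimage_subset[of "{n \<in> sphere 0 1. a \<le> n \<bullet> w}"] by (auto simp: ridge_def)
      next
        case 2
        then show ?thesis by (auto simp: outer_normal_ridge)
      next
        case 3
        then show ?thesis using mem[OF 3] by simp
      qed
    qed
    also have "\<dots> \<in> sets borel"
    proof -
      have "- frontier C \<in> sets borel" by (intro borel_open) auto
      then show ?thesis using \<open>?P \<in> sets borel\<close> ridge_borel by auto
    qed
    finally show ?thesis .
  qed
  then show "?g \<in> borel_measurable borel" by (subst borel_measurable_iff_ge) blast
qed

lemma outer_normal_integrable:
  assumes A: "A \<in> sets borel" "A \<subseteq> frontier C"
  shows "set_integrable surf A (\<lambda>x. outer_normal C x \<bullet> v)"
proof -
  have [measurable]: "A \<in> sets borel" by fact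
  note [measurable] = outer_normal_measurable
  have eq: "(\<lambda>x. indicator A x *\<^sub>R (outer_normal C x \<bullet> v))
      = (\<lambda>x. indicator A x *\<^sub>R ((indicator (frontier C) x *\<^sub>R outer_normal C x) \<bullet> v))"
    by (intro ext) (use A(2) in \<open>auto split: split_indicator\<close>)
  have "integrable surf (\<lambda>x. indicator A x *\<^sub>R ((indicator (frontier C) x *\<^sub>R outer_normal C x) \<bullet> v))"
  proof (rule Bochner_Integration.integrable_bound[of _ "\<lambda>x. indicator A x *\<^sub>R norm v"])
    show "integrable surf (\<lambda>x. indicator A x *\<^sub>R norm v)"
      using surf_subset_frontier_finite[OF A] by (intro integrable_scaleR_left integrable_real_indicator) auto
    show "AE x in surf. norm (indicator A x *\<^sub>R ((indicator (frontier C) x *\<^sub>R outer_normal C x) \<bullet> v)) \<le> norm (indicator A x *\<^sub>R norm v)"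
    proof (rule AE_I2)
      fix x
      have "\<bar>outer_normal C x \<bullet> v\<bar> \<le> norm v" if "x \<in> frontier C"
        using Cauchy_Schwarz_ineq2[of "outer_normal C x" v] norm_outer_normal_le[OF that]
        by (meson mult_left_le_one_le norm_ge_zero order_trans)
      then show "norm (indicator A x *\<^sub>R ((indicator (frontier C) x *\<^sub>R outer_normal C x) \<bullet> v)) \<le> norm (indicator A x *\<^sub>R norm v)"
        using A(2) by (auto simp: indicator_def)
    qed
  qed measurable
  then show ?thesis by (simp only: set_integrable_def eq)
qed

text \<open>
  For \<open>\<eta> > 0\<close> each line in the direction \<open>v\<close> meets this set at most once, and the projection along
  \<open>v\<close> is controlled uniformly; the limit \<open>\<eta> \<rightarrow> 0\<close> gives the part of the boundary that faces upward.
\<close>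

definition upward :: "real^'d \<Rightarrow> real \<Rightarrow> (real^'d) set" where
  "upward v \<eta> = gauss_preimage C {n \<in> sphere 0 1. \<eta> \<le> n \<bullet> v}"

lemma compact_upward: "compact (upward v \<eta>)"
  unfolding upward_def by (intro compact_gauss_preimage compact_halfspace_sphere)

lemma inj_on_proj_upward:
  assumes v: "norm v = 1" and \<eta>: "0 < \<eta>"
  shows "inj_on (proj_along v v) (upward v \<eta>)"
proof (rule inj_onI)
  fix x y assume xy: "x \<in> upward v \<eta>" "y \<in> upward v \<eta>" "proj_along v v x = proj_along v v y"
  have vv: "v \<bullet> v = 1" using v by (simp add: norm_eq_1)
  have *: "t \<le> 0" if "x \<in> upward v \<eta>" "y \<in> upward v \<eta>" "y - x = t *\<^sub>R v" for x y t
  proof -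
    obtain n where n: "n \<in> normals C x" "\<eta> \<le> n \<bullet> v"
      using \<open>x \<in> upward v \<eta>\<close> unfolding upward_def gauss_preimage_def by blast
    have "y \<in> closure C" using \<open>y \<in> upward v \<eta>\<close> by (auto simp: upward_def gauss_preimage_def frontier_def)
    then have "t * (n \<bullet> v) \<le> 0" using normals_closure[OF n(1)] that(3) by fastforce
    moreover have "0 < n \<bullet> v" using n \<eta> by simp
    ultimately show "t \<le> 0" by (simp add: mult_le_0_iff)
  qed
  have yx: "y - x = (v \<bullet> (y - x)) *\<^sub>R v" using xy(3) by (simp add: proj_along_def vv inner_diff_right algebra_simps)
  then have "x - y = (- (v \<bullet> (y - x))) *\<^sub>R v" by (metis minus_diff_eq scaleR_minus_left)
  then have "v \<bullet> (y - x) = 0" using *[OF xy(1,2) yx] *[OF xy(2,1)] by fastforce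
  then show "x = y" using yx by simp
qed

lemma continuous_on_proj_along: "continuous_on S (proj_along p v)"
  unfolding proj_along_def by (cases "p \<bullet> v = 0") (auto intro!: continuous_intros)

lemma proj_upward_borel:
  assumes v: "norm v = 1" and \<eta>: "0 < \<eta>" and A: "A \<in> sets borel" "A \<subseteq> upward v \<eta>"
  shows "proj_along v v ` A \<in> sets borel" "emeasure surf (proj_along v v ` A) < \<infinity>"
proof -
  show b: "proj_along v v ` A \<in> sets borel"
    by (rule borel_injective_image[OF compact_upward continuous_on_proj_along inj_on_proj_upward[OF v \<eta>] A])
  have "bounded (proj_along v v ` A)"
    using compact_imp_bounded[OF compact_continuous_image[OF continuous_on_proj_along compact_upward]] A(2)
    by (meson bounded_subset image_mono)
  moreover have "proj_along v v ` A \<subseteq> perp v" using v by (auto intro!: proj_along_perp simp: norm_eq_1)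
  moreover have "v \<noteq> 0" using v by auto
  ultimately show "emeasure surf (proj_along v v ` A) < \<infinity>" using surf_bounded_perp_finite[OF d2 _ b] by blast
qed

text \<open>
  The relative error made by treating a piece of the boundary with normals within \<open>\<epsilon>\<close> of \<open>p\<close> as a
  piece of the hyperplane of \<open>p\<close>. On the pieces in question \<open>p \<bullet> v\<close> is at least \<open>\<eta> / 2\<close>, so that
  \<open>2 * \<epsilon> / \<eta>\<close> bounds the distortion of lengths by the projection.
\<close>

definition proj_error :: "real \<Rightarrow> real \<Rightarrow> real" where
  "proj_error \<eta> \<epsilon> = \<epsilon> + ((1 + 2 * \<epsilon> / \<eta>) ^ (CARD('d) - 1) - inverse ((1 / (1 - 2 * \<epsilon> / \<eta>)) ^ (CARD('d) - 1)))"

text \<open>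
  Compare with the projection of the piece to the hyperplane of \<open>p\<close>: there the area formula is
  exact, and both the surface measure and the normal differ little from those of the hyperplane.
\<close>

lemma proj_upward_piece:
  assumes v: "norm v = 1" and \<eta>: "0 < \<eta>" and e: "0 < \<epsilon>" "4 * \<epsilon> \<le> \<eta>" and p: "norm p = 1"
    and A: "A \<in> sets borel" "A \<subseteq> gauss_preimage C (cball p \<epsilon> \<inter> {n \<in> sphere 0 1. \<eta> \<le> n \<bullet> v})"
  shows "\<bar>measure surf (proj_along v v ` A) - (LINT x:A|surf. outer_normal C x \<bullet> v)\<bar> \<le> proj_error \<eta> \<epsilon> * measure surf A"
proof (cases "A = {}")
  case False
  let ?s = "CARD('d) - 1" and ?\<delta> = "2 * \<epsilon> / \<eta>"
  have vv: "v \<bullet> v = 1" using v by (simp add: norm_eq_1)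
  have A': "A \<subseteq> gauss_preimage C (cball p \<epsilon>)" using A(2) unfolding gauss_preimage_def by blast
  have Af: "A \<subseteq> frontier C" using A' gauss_preimage_subset by blast
  obtain x where "x \<in> gauss_preimage C (cball p \<epsilon> \<inter> {n \<in> sphere 0 1. \<eta> \<le> n \<bullet> v})" using False A(2) by blast
  then obtain n where "n \<in> cball p \<epsilon>" and n2: "\<eta> \<le> n \<bullet> v" unfolding gauss_preimage_def by blast
  then have n: "dist p n \<le> \<epsilon>" "\<eta> \<le> n \<bullet> v" by auto
  have "\<bar>(n - p) \<bullet> v\<bar> \<le> \<epsilon>" using Cauchy_Schwarz_ineq2[of "n - p" v] v n by (simp add: dist_norm norm_minus_commute)
  then have pv: "\<eta> / 2 \<le> p \<bullet> v" using n e \<eta> by (simp add: inner_diff_left abs_le_iff)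
  then have pv0: "0 < p \<bullet> v" "\<epsilon> < p \<bullet> v" using \<eta> e by auto
  have pv1: "p \<bullet> v \<le> 1" using norm_cauchy_schwarz[of p v] p v by simp
  have d: "\<epsilon> / (p \<bullet> v) \<le> ?\<delta>" "?\<delta> \<le> 1/2" "0 \<le> \<epsilon> / (p \<bullet> v)"
    using pv pv0 \<eta> e by (auto simp: field_simps)
  note P = proj_along_gauss_preimage[OF v pv0(1) less_imp_le[OF e(1)] pv0(2) A(1) A']
  let ?m = "measure surf A" and ?m' = "measure surf (proj_along p v ` A)"
  have Afin: "emeasure surf A < \<infinity>" by (rule surf_subset_frontier_finite[OF A(1) Af])
  have Pfin: "emeasure surf (proj_along p v ` A) < \<infinity>"
    using P(4) Afin by (auto intro: le_less_trans simp: ennreal_mult_less_top)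
  have "?m' \<le> (1 + \<epsilon> / (p \<bullet> v)) ^ ?s * ?m"
    using P(4) Afin Pfin d by (simp add: emeasure_eq_ennreal_measure less_top flip: ennreal_mult)
  also have "\<dots> \<le> (1 + ?\<delta>) ^ ?s * ?m" using d by (intro mult_right_mono power_mono) auto
  finally have up: "?m' \<le> (1 + ?\<delta>) ^ ?s * ?m" .
  have "?m \<le> (1 / (1 - \<epsilon> / (p \<bullet> v))) ^ ?s * ?m'"
    using P(5) Afin Pfin d by (simp add: emeasure_eq_ennreal_measure less_top flip: ennreal_mult)
  also have "\<dots> \<le> (1 / (1 - ?\<delta>)) ^ ?s * ?m'" using d by (intro mult_right_mono power_mono divide_left_mono) auto
  finally have "?m \<le> (1 / (1 - ?\<delta>)) ^ ?s * ?m'" .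
  moreover have "0 < (1 / (1 - ?\<delta>)) ^ ?s" using d by (intro zero_less_power) auto
  ultimately have lo: "inverse ((1 / (1 - ?\<delta>)) ^ ?s) * ?m \<le> ?m'" by (simp add: field_simps)
  have one: "inverse ((1 / (1 - ?\<delta>)) ^ ?s) \<le> 1" "1 \<le> (1 + ?\<delta>) ^ ?s"
    using d e \<eta> by (auto intro!: one_le_power simp: inverse_eq_divide power_one_over power_le_one)
  have "\<bar>?m' - ?m\<bar> \<le> ((1 + ?\<delta>) ^ ?s - inverse ((1 / (1 - ?\<delta>)) ^ ?s)) * ?m"
    using up lo mult_right_mono[OF one(1), of ?m] mult_right_mono[OF one(2), of ?m] by (simp add: left_diff_distrib abs_le_iff)
  then have "(p \<bullet> v) * \<bar>?m' - ?m\<bar> \<le> 1 * (((1 + ?\<delta>) ^ ?s - inverse ((1 / (1 - ?\<delta>)) ^ ?s)) * ?m)"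
    using pv1 pv0 by (intro mult_mono) auto
  then have t1: "\<bar>(p \<bullet> v) * ?m' - (p \<bullet> v) * ?m\<bar> \<le> ((1 + ?\<delta>) ^ ?s - inverse ((1 / (1 - ?\<delta>)) ^ ?s)) * ?m"
    using pv0 by (simp add: abs_mult flip: right_diff_distrib)
  \<comment> \<open>Projecting to the hyperplane of \<open>p\<close> first makes no difference, since both
    projections run along \<open>v\<close>.\<close>
  have "proj_along v v ` proj_along p v ` A = proj_along v v ` A"
    by (simp add: image_image proj_along_def vv inner_diff_right algebra_simps)
  then have m: "measure surf (proj_along v v ` A) = (p \<bullet> v) * ?m'"
    using measure_surf_proj_along[OF d2 p v pv0(1) P(1-3)] by simp
  have c: "set_integrable surf A (\<lambda>x. c)" for c :: real
    unfolding set_integrable_def using A Afin by (intro integrable_scaleR_left integrable_real_indicator) auto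
  have int: "set_integrable surf A (\<lambda>x. outer_normal C x \<bullet> v)" by (rule outer_normal_integrable[OF A(1) Af])
  have const: "(LINT x:A|surf. c) = c * ?m" for c :: real using A by (simp add: set_lebesgue_integral_def)
  have "\<bar>(LINT x:A|surf. outer_normal C x \<bullet> v) - (p \<bullet> v) * ?m\<bar> = \<bar>LINT x:A|surf. outer_normal C x \<bullet> v - p \<bullet> v\<bar>"
    using set_integral_diff(2)[OF int c[of "p \<bullet> v"]] by (simp add: const)
  also have "\<dots> \<le> (LINT x:A|surf. \<epsilon>)"
    unfolding set_lebesgue_integral_def real_norm_def[symmetric]
  proof (rule order_trans[OF integral_norm_bound integral_mono_AE])
    show "integrable surf (\<lambda>x. norm (indicator A x *\<^sub>R (outer_normal C x \<bullet> v - p \<bullet> v)))"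
      using integrable_norm[OF set_integral_diff(1)[OF int c[of "p \<bullet> v"], unfolded set_integrable_def]] .
    show "integrable surf (\<lambda>x. indicator A x *\<^sub>R \<epsilon>)" using c by (simp add: set_integrable_def)
    have "AE x in surf. x \<notin> ridge C"
      using surf_ridge_null by (intro AE_not_in) (auto simp: null_sets_def)
    then show "AE x in surf. norm (indicator A x *\<^sub>R (outer_normal C x \<bullet> v - p \<bullet> v)) \<le> indicator A x *\<^sub>R \<epsilon>"
    proof eventually_elim
      fix x assume x: "x \<notin> ridge C"
      have "\<bar>outer_normal C x \<bullet> v - p \<bullet> v\<bar> \<le> \<epsilon>" if "x \<in> A"
      proof -
        have "normals C x = {outer_normal C x}" using off_ridge that Af x by blast
        then have "norm (outer_normal C x - p) \<le> \<epsilon>"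
          using A' that by (auto simp: gauss_preimage_def dist_norm norm_minus_commute)
        then show ?thesis using Cauchy_Schwarz_ineq2[of "outer_normal C x - p" v] v by (simp add: inner_diff_left)
      qed
      then show "norm (indicator A x *\<^sub>R (outer_normal C x \<bullet> v - p \<bullet> v)) \<le> indicator A x *\<^sub>R \<epsilon>"
        by (auto simp: indicator_def)
    qed
  qed
  finally have t2: "\<bar>(LINT x:A|surf. outer_normal C x \<bullet> v) - (p \<bullet> v) * ?m\<bar> \<le> \<epsilon> * ?m" by (simp add: const)
  show ?thesis
    unfolding m proj_error_def distrib_right using t1 t2 by linarith
qed (simp add: set_lebesgue_integral_def)

lemma proj_upward_error:
  assumes v: "norm v = 1" and \<eta>: "0 < \<eta>" and e: "0 < \<epsilon>" "4 * \<epsilon> \<le> \<eta>"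
    and A: "A \<in> sets borel" "A \<subseteq> upward v \<eta>"
  shows "\<bar>measure surf (proj_along v v ` A) - (LINT x:A|surf. outer_normal C x \<bullet> v)\<bar> \<le> proj_error \<eta> \<epsilon> * measure surf A"
proof -
  let ?H = "{n \<in> sphere (0::real^'d) 1. \<eta> \<le> n \<bullet> v}"
  let ?G = "\<lambda>p. gauss_preimage C (cball p \<epsilon> \<inter> ?H)"
  have G: "?G p \<in> sets borel" for p
    by (intro borel_compact compact_gauss_preimage compact_Int compact_cball compact_halfspace_sphere)
  obtain F where F: "finite F" "F \<subseteq> sphere (0::real^'d) 1" "sphere 0 1 \<subseteq> (\<Union>p\<in>F. cball p \<epsilon>)"
    using unit_sphere_net[OF e(1)] by metis
  have *: "\<bar>measure surf (proj_along v v ` A) - (LINT x:A|surf. outer_normal C x \<bullet> v)\<bar> \<le> proj_error \<eta> \<epsilon> * measure surf A"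
    if "finite F" "F \<subseteq> sphere 0 1" "A \<in> sets borel" "A \<subseteq> upward v \<eta>" "A \<subseteq> (\<Union>p\<in>F. ?G p)" for F A
    using that
  proof (induction F arbitrary: A)
    case (insert p F)
    \<comment> \<open>Splitting off the part seen from \<open>p\<close> keeps the pieces disjoint, although the
      sets \<open>?G p\<close> overlap.\<close>
    define A1 where "A1 = A \<inter> ?G p"
    define A2 where "A2 = A - ?G p"
    have sets: "A1 \<in> sets borel" "A2 \<in> sets borel" using insert G by (auto simp: A1_def A2_def)
    have sub: "A1 \<subseteq> upward v \<eta>" "A2 \<subseteq> upward v \<eta>" using insert by (auto simp: A1_def A2_def)
    have Un: "A = A1 \<union> A2" and disj: "A1 \<inter> A2 = {}" by (auto simp: A1_def A2_def)
    have fr: "A1 \<subseteq> frontier C" "A2 \<subseteq> frontier C"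
      using sub gauss_preimage_subset unfolding upward_def by blast+
    have b1: "\<bar>measure surf (proj_along v v ` A1) - (LINT x:A1|surf. outer_normal C x \<bullet> v)\<bar> \<le> proj_error \<eta> \<epsilon> * measure surf A1"
      using insert.prems sets by (intro proj_upward_piece[OF v \<eta> e, of p]) (auto simp: A1_def)
    have b2: "\<bar>measure surf (proj_along v v ` A2) - (LINT x:A2|surf. outer_normal C x \<bullet> v)\<bar> \<le> proj_error \<eta> \<epsilon> * measure surf A2"
      using insert.prems sets sub by (intro insert.IH) (auto simp: A2_def)
    have "measure surf A = measure surf A1 + measure surf A2"
      unfolding Un using sets disj fr surf_subset_frontier_finite by (intro measure_Union) (auto simp: less_top)
    moreover have "measure surf (proj_along v v ` A) = measure surf (proj_along v v ` A1) + measure surf (proj_along v v ` A2)"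
    proof -
      have "proj_along v v ` A1 \<inter> proj_along v v ` A2 = {}"
        using inj_on_image_Int[OF inj_on_proj_upward[OF v \<eta>] sub] disj by simp
      then show ?thesis
        unfolding Un image_Un using proj_upward_borel[OF v \<eta> sets(1) sub(1)] proj_upward_borel[OF v \<eta> sets(2) sub(2)]
        by (intro measure_Union) (auto simp: less_top)
    qed
    moreover have "(LINT x:A|surf. outer_normal C x \<bullet> v)
        = (LINT x:A1|surf. outer_normal C x \<bullet> v) + (LINT x:A2|surf. outer_normal C x \<bullet> v)"
      unfolding Un using outer_normal_integrable sets fr by (intro set_integral_Un disj) auto
    ultimately show ?case using b1 b2 by (simp add: distrib_left)
  qed (simp add: set_lebesgue_integral_def)
  have "A \<subseteq> (\<Union>p\<in>F. ?G p)"
  proof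
    fix x assume "x \<in> A"
    then obtain n where n: "x \<in> frontier C" "n \<in> normals C x" "n \<in> ?H"
      using A(2) unfolding upward_def gauss_preimage_def by blast
    then obtain p where "p \<in> F" "n \<in> cball p \<epsilon>" using F(3) by blast
    then show "x \<in> (\<Union>p\<in>F. ?G p)" using n unfolding gauss_preimage_def by blast
  qed
  then show ?thesis using * F A by blast
qed

text \<open>
  The area formula for the boundary of a convex set, in the limit of ever finer pieces.
\<close>

lemma measure_proj_upward:
  assumes v: "norm v = 1" and \<eta>: "0 < \<eta>"
  shows "measure surf (proj_along v v ` upward v \<eta>) = (LINT x:upward v \<eta>|surf. outer_normal C x \<bullet> v)"
proof -
  let ?X = "\<bar>measure surf (proj_along v v ` upward v \<eta>) - (LINT x:upward v \<eta>|surf. outer_normal C x \<bullet> v)\<bar>"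
  let ?m = "measure surf (upward v \<eta>)"
  have "((\<lambda>\<epsilon>. proj_error \<eta> \<epsilon> * ?m) \<longlongrightarrow> proj_error \<eta> 0 * ?m) (at_right 0)"
    unfolding proj_error_def by (intro tendsto_intros) (use \<eta> in auto)
  then have lim: "((\<lambda>\<epsilon>. proj_error \<eta> \<epsilon> * ?m) \<longlongrightarrow> 0) (at_right 0)" by (simp add: proj_error_def)
  have "\<forall>\<^sub>F \<epsilon> in at_right 0. ?X \<le> proj_error \<eta> \<epsilon> * ?m"
  proof (rule eventually_at_rightI[of 0 "\<eta> / 4"])
    show "?X \<le> proj_error \<eta> \<epsilon> * ?m" if "\<epsilon> \<in> {0<..<\<eta> / 4}" for \<epsilon>
      using that by (intro proj_upward_error[OF v \<eta>] borel_compact compact_upward) auto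
  qed (use \<eta> in simp)
  then have "?X \<le> 0" by (intro tendsto_lowerbound[OF lim]) simp_all
  then show ?thesis by simp
qed

definition upper :: "real^'d \<Rightarrow> (real^'d) set" where
  "upper v = {x \<in> frontier C. \<exists>n\<in>normals C x. 0 < n \<bullet> v}"

lemma upper_eq: "upper v = (\<Union>i. upward v (inverse (real (Suc i))))"
proof (intro equalityI subsetI)
  fix x assume "x \<in> upper v"
  then obtain n where n: "x \<in> frontier C" "n \<in> normals C x" "0 < n \<bullet> v" by (auto simp: upper_def)
  then obtain i where "inverse (real (Suc i)) < n \<bullet> v" using reals_Archimedean by blast
  then have "n \<in> {n \<in> sphere 0 1. inverse (real (Suc i)) \<le> n \<bullet> v}" using n by (auto simp: normals_def)
  then have "x \<in> upward v (inverse (real (Suc i)))" using n unfolding upward_def gauss_preimage_def by blast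
  then show "x \<in> (\<Union>i. upward v (inverse (real (Suc i))))" by blast
next
  fix x assume "x \<in> (\<Union>i. upward v (inverse (real (Suc i))))"
  then obtain i n where "x \<in> frontier C" "n \<in> normals C x" "inverse (real (Suc i)) \<le> n \<bullet> v"
    unfolding upward_def gauss_preimage_def by blast
  moreover have "0 < inverse (real (Suc i))" by simp
  ultimately show "x \<in> upper v" unfolding upper_def using less_le_trans by blast
qed

lemma upper_borel [measurable]: "upper v \<in> sets borel"
  unfolding upper_eq by (intro sets.countable_UN image_subsetI borel_compact compact_upward)

lemma measure_proj_upper:
  assumes v: "norm v = 1"
  shows "proj_along v v ` upper v \<in> sets borel"
    and "measure surf (proj_along v v ` upper v) = (LINT x:upper v|surf. outer_normal C x \<bullet> v)"
proof -
  let ?U = "\<lambda>i. upward v (inverse (real (Suc i)))" and ?f = "proj_along v v"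
  have U: "?U i \<in> sets borel" for i by (intro borel_compact compact_upward)
  have fU: "?f ` ?U i \<in> sets borel" for i using proj_upward_borel(1)[OF v _ U order_refl] by simp
  have img: "?f ` upper v = (\<Union>i. ?f ` ?U i)" by (simp add: upper_eq image_UN)
  show "?f ` upper v \<in> sets borel" unfolding img using fU by blast
  have inc: "incseq ?U"
  proof (rule incseq_SucI, rule subsetI)
    fix i x assume "x \<in> ?U i"
    then obtain n where n: "x \<in> frontier C" "n \<in> normals C x" "n \<in> sphere 0 1" "inverse (real (Suc i)) \<le> n \<bullet> v"
      unfolding upward_def gauss_preimage_def by blast
    have "inverse (real (Suc (Suc i))) \<le> inverse (real (Suc i))" by (intro le_imp_inverse_le) auto
    then have "inverse (real (Suc (Suc i))) \<le> n \<bullet> v" using n(4) by (rule order_trans)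
    then have "n \<in> {n \<in> sphere 0 1. inverse (real (Suc (Suc i))) \<le> n \<bullet> v}" using n(3) by blast
    then show "x \<in> ?U (Suc i)" using n unfolding upward_def gauss_preimage_def by blast
  qed
  have "upper v \<subseteq> frontier C" by (auto simp: upper_def)
  then have int: "set_integrable surf (\<Union>i. ?U i) (\<lambda>x. outer_normal C x \<bullet> v)"
    unfolding upper_eq[symmetric] by (intro outer_normal_integrable upper_borel)
  have "(\<lambda>i. LINT x:?U i|surf. outer_normal C x \<bullet> v) \<longlonglongrightarrow> (LINT x:upper v|surf. outer_normal C x \<bullet> v)"
    unfolding upper_eq by (rule set_integral_cont_up[OF _ inc int]) (simp only: U sets_surf)
  moreover have "(\<lambda>i. measure surf (?f ` ?U i)) \<longlonglongrightarrow> measure surf (?f ` upper v)"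
    unfolding img
  proof (rule Lim_measure_incseq)
    show "incseq (\<lambda>i. ?f ` ?U i)" using inc by (auto simp: incseq_def)
    show "range (\<lambda>i. ?f ` ?U i) \<subseteq> sets surf" using fU by auto
    have "(\<Union>i. ?f ` ?U i) \<subseteq> perp v" using v by (auto intro!: proj_along_perp simp: norm_eq_1)
    moreover have "bounded (\<Union>i. ?f ` ?U i)"
    proof -
      have "(\<Union>i. ?f ` ?U i) \<subseteq> ?f ` frontier C" unfolding img[symmetric] by (auto simp: upper_def)
      then show ?thesis
        using bounded_subset[OF compact_imp_bounded[OF compact_continuous_image[OF continuous_on_proj_along compact_frontier_C]]]
        by blast
    qed
    moreover have "(\<Union>i. ?f ` ?U i) \<in> sets borel" using fU by blast
    moreover have "v \<noteq> 0" using v by auto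
    ultimately show "emeasure surf (\<Union>i. ?f ` ?U i) \<noteq> \<infinity>"
      using surf_bounded_perp_finite[OF d2, of v] by (auto simp: less_top)
  qed
  moreover have "measure surf (?f ` ?U i) = (LINT x:?U i|surf. outer_normal C x \<bullet> v)" for i
    by (intro measure_proj_upward v) simp
  ultimately show "measure surf (?f ` upper v) = (LINT x:upper v|surf. outer_normal C x \<bullet> v)"
    using LIMSEQ_unique by auto
qed

definition tube :: "real^'d \<Rightarrow> (real^'d) set" where
  "tube v = {x. \<exists>t. x + t *\<^sub>R v \<in> C}"

lemma tube_shift: "x + t *\<^sub>R v \<in> tube v \<longleftrightarrow> x \<in> tube v"
proof
  assume "x + t *\<^sub>R v \<in> tube v"
  then obtain s where "x + t *\<^sub>R v + s *\<^sub>R v \<in> C" by (auto simp: tube_def)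
  then have "x + (t + s) *\<^sub>R v \<in> C" by (simp add: algebra_simps)
  then show "x \<in> tube v" by (auto simp: tube_def)
next
  assume "x \<in> tube v"
  then obtain s where "x + s *\<^sub>R v \<in> C" by (auto simp: tube_def)
  then have "x + t *\<^sub>R v + (s - t) *\<^sub>R v \<in> C" by (simp add: algebra_simps)
  then show "x + t *\<^sub>R v \<in> tube v" unfolding tube_def by blast
qed

lemma open_tube: "open (tube v)"
proof -
  have "tube v = (\<Union>t. (\<lambda>x. x + t *\<^sub>R v) -` C)" by (auto simp: tube_def)
  moreover have "open ((\<lambda>x. x + t *\<^sub>R v) -` C)" for t by (intro open_vimage C continuous_intros)
  ultimately show ?thesis by auto
qed

lemma convex_tube: "convex (tube v)"
proof (rule convexI)
  fix x y and a b :: real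
  assume "x \<in> tube v" "y \<in> tube v" and ab: "0 \<le> a" "0 \<le> b" "a + b = 1"
  then obtain s t where "x + s *\<^sub>R v \<in> C" "y + t *\<^sub>R v \<in> C" by (auto simp: tube_def)
  then have "a *\<^sub>R (x + s *\<^sub>R v) + b *\<^sub>R (y + t *\<^sub>R v) \<in> C" using C(2) ab by (auto simp: convex_def)
  then have "(a *\<^sub>R x + b *\<^sub>R y) + (a * s + b * t) *\<^sub>R v \<in> C" by (simp add: algebra_simps)
  then show "a *\<^sub>R x + b *\<^sub>R y \<in> tube v" unfolding tube_def by blast
qed

lemma closure_tube_shift: "x \<in> closure (tube v) \<Longrightarrow> x + t *\<^sub>R v \<in> closure (tube v)"
proof -
  assume x: "x \<in> closure (tube v)"
  have "(+) (t *\<^sub>R v) ` tube v \<subseteq> tube v" using tube_shift by (auto simp: add.commute)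
  then have "closure ((+) (t *\<^sub>R v) ` tube v) \<subseteq> closure (tube v)" by (rule closure_mono)
  then have "(+) (t *\<^sub>R v) ` closure (tube v) \<subseteq> closure (tube v)" by (simp only: closure_translation)
  then show "x + t *\<^sub>R v \<in> closure (tube v)" using x by (auto simp: add.commute)
qed

text \<open>
  The upward part of the boundary projects onto the shadow of \<open>C\<close>, up to the boundary of the
  shadow: the lines that meet \<open>C\<close> leave it exactly once, and the boundary of the convex set
  \<open>tube v\<close> is negligible.
\<close>

lemma outer_normal_upper_integral:
  assumes v: "norm v = 1"
  shows "(LINT x:upper v|surf. outer_normal C x \<bullet> v) = measure surf (perp v \<inter> tube v)"
proof -
  let ?f = "proj_along v v"
  have vv: "v \<bullet> v = 1" "v \<noteq> 0" using v by (auto simp: norm_eq_1)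
  have f_shift: "?f (y + t *\<^sub>R v) = y" if "y \<in> perp v" for y t
    using that by (simp add: proj_along_def perp_def inner_add_right vv)
  have f_inv: "\<exists>t. x = ?f x + t *\<^sub>R v" for x
    by (intro exI[of _ "v \<bullet> x / (v \<bullet> v)"]) (simp add: proj_along_def)
  note U = measure_proj_upper[OF v]
  have sh: "perp v \<inter> tube v \<in> sets borel" using open_tube by (auto intro: borel_open)
  have sub: "perp v \<inter> tube v \<subseteq> ?f ` upper v"
  proof
    fix y assume y: "y \<in> perp v \<inter> tube v"
    then obtain t where t: "y + t *\<^sub>R v \<in> C" by (auto simp: tube_def)
    then have "y + t *\<^sub>R v \<in> interior C" using C by (simp add: interior_open)
    then obtain d where d: "0 < d" "y + t *\<^sub>R v + d *\<^sub>R v \<in> frontier C"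
      using ray_to_frontier[OF C(3) _ vv(2)] by blast
    \<comment> \<open>The point where the line leaves \<open>C\<close>: an interior point lies before it, so
      every normal there points forward.\<close>
    define q where "q = y + (t + d) *\<^sub>R v"
    have q: "q \<in> frontier C" "y + t *\<^sub>R v = q - d *\<^sub>R v" using d by (auto simp: q_def algebra_simps)
    obtain n where n: "n \<in> normals C q" using normals_nonempty[OF q(1)] by blast
    have "n \<bullet> (y + t *\<^sub>R v - q) < 0" by (rule normals_strict[OF n t])
    then have "0 < n \<bullet> v" using d(1) by (simp add: q(2) zero_less_mult_iff)
    then have "q \<in> upper v" using q n by (auto simp: upper_def)
    moreover have "?f q = y" using f_shift y by (simp add: q_def)
    ultimately show "y \<in> ?f ` upper v" by force
  qed
  define N where "N = ?f ` upper v - perp v \<inter> tube v"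
  have Nperp: "N \<subseteq> perp v" using vv by (auto simp: N_def intro: proj_along_perp)
  have N: "N \<in> sets borel" using U sh by (auto simp: N_def)
  have "N \<subseteq> ?f ` frontier C" by (auto simp: N_def upper_def)
  then have Nb: "bounded N"
    using bounded_subset[OF compact_imp_bounded[OF compact_continuous_image[OF continuous_on_proj_along compact_frontier_C]]]
    by blast
  \<comment> \<open>The remaining points of the projection lie on lines that touch the closure of
    \<open>C\<close> but miss \<open>C\<close>.\<close>
  have "cyl N v \<subseteq> frontier (tube v)"
  proof
    fix z assume "z \<in> cyl N v"
    then obtain y t where y: "y \<in> N" "z = y + t *\<^sub>R v" by (auto simp: cyl_def)
    then obtain q where q: "q \<in> frontier C" "y = ?f q" by (auto simp: N_def upper_def)
    obtain s where s: "q = y + s *\<^sub>R v" using f_inv[of q] q by auto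
    have "C \<subseteq> tube v"
    proof
      fix x assume "x \<in> C"
      then have "x + 0 *\<^sub>R v \<in> C" by simp
      then show "x \<in> tube v" unfolding tube_def by blast
    qed
    then have "q \<in> closure (tube v)" using q closure_mono by (auto simp: frontier_def)
    then have "q + (t - s) *\<^sub>R v \<in> closure (tube v)" by (rule closure_tube_shift)
    moreover have "q + (t - s) *\<^sub>R v = z" using s y by (simp add: algebra_simps)
    moreover have "z \<notin> tube v" using y Nperp tube_shift[of y t v] by (auto simp: N_def)
    ultimately show "z \<in> frontier (tube v)" by (simp add: frontier_def interior_open open_tube)
  qed
  then have "negligible (cyl N v)" using negligible_convex_frontier[OF convex_tube] negligible_subset by blast
  then have "measure surf N = 0" using measure_surf_perp_null[OF d2 v N Nb Nperp] by blast
  moreover have "emeasure surf N < \<infinity>" using surf_bounded_perp_finite[OF d2 vv(2) N Nb Nperp] .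
  ultimately have "emeasure surf N = 0" by (simp add: emeasure_eq_ennreal_measure less_top)
  then have "N \<in> null_sets surf" using N by (simp add: null_sets_def)
  moreover have "?f ` upper v = (perp v \<inter> tube v) \<union> N" using sub by (auto simp: N_def)
  ultimately have "measure surf (?f ` upper v) = measure surf (perp v \<inter> tube v)"
    using sh by (simp add: measure_Un_null_set)
  then show ?thesis using U by simp
qed

text \<open>
  The upward and the downward part of the boundary have the same shadow.
\<close>

theorem closed_surface_integral:
  assumes v: "norm v = 1"
  shows "(LINT x:frontier C|surf. outer_normal C x \<bullet> v) = 0"
proof -
  have [measurable]: "frontier C \<in> sets borel" by (simp add: borel_closed)
  have sub: "upper w \<subseteq> frontier C" for w by (auto simp: upper_def)
  have int: "set_integrable surf (upper w) (\<lambda>x. outer_normal C x \<bullet> v)" for w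
    by (rule outer_normal_integrable[OF upper_borel sub])
  have "AE x in surf. x \<notin> ridge C"
    using surf_ridge_null by (intro AE_not_in) (auto simp: null_sets_def)
  then have AE: "AE x in surf. indicator (frontier C) x *\<^sub>R (outer_normal C x \<bullet> v)
      = indicator (upper v) x *\<^sub>R (outer_normal C x \<bullet> v) + indicator (upper (- v)) x *\<^sub>R (outer_normal C x \<bullet> v)"
  proof eventually_elim
    fix x assume x: "x \<notin> ridge C"
    show "indicator (frontier C) x *\<^sub>R (outer_normal C x \<bullet> v)
      = indicator (upper v) x *\<^sub>R (outer_normal C x \<bullet> v) + indicator (upper (- v)) x *\<^sub>R (outer_normal C x \<bullet> v)"
    proof (cases "x \<in> frontier C")
      case True
      then have "normals C x = {outer_normal C x}" using off_ridge x by blast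
      then have mem: "x \<in> upper w \<longleftrightarrow> 0 < outer_normal C x \<bullet> w" for w
        using True by (simp add: upper_def)
      show ?thesis using True mem[of v] mem[of "- v"]
        by (cases "0 < outer_normal C x \<bullet> v"; cases "outer_normal C x \<bullet> v < 0") auto
    qed (use sub in \<open>auto simp: indicator_def\<close>)
  qed
  have "(LINT x:frontier C|surf. outer_normal C x \<bullet> v)
      = (LINT x|surf. indicator (upper v) x *\<^sub>R (outer_normal C x \<bullet> v) + indicator (upper (- v)) x *\<^sub>R (outer_normal C x \<bullet> v))"
    unfolding set_lebesgue_integral_def
  proof (rule integral_cong_AE[OF _ _ AE])
    show "(\<lambda>x. indicator (frontier C) x *\<^sub>R (outer_normal C x \<bullet> v)) \<in> borel_measurable surf"
      using outer_normal_integrable[of "frontier C" v] by (auto simp: set_integrable_def)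
    show "(\<lambda>x. indicator (upper v) x *\<^sub>R (outer_normal C x \<bullet> v) + indicator (upper (- v)) x *\<^sub>R (outer_normal C x \<bullet> v))
        \<in> borel_measurable surf"
      using int[of v] int[of "- v"] unfolding set_integrable_def by (intro borel_measurable_add borel_measurable_integrable)
  qed
  also have "\<dots> = (LINT x:upper v|surf. outer_normal C x \<bullet> v) + (LINT x:upper (- v)|surf. outer_normal C x \<bullet> v)"
    using int[of v] int[of "- v"] unfolding set_integrable_def set_lebesgue_integral_def by (rule Bochner_Integration.integral_add)
  also have "(LINT x:upper (- v)|surf. outer_normal C x \<bullet> v) = - (LINT x:upper (- v)|surf. outer_normal C x \<bullet> (- v))"
    by (simp add: set_lebesgue_integral_def)
  also have "perp (- v) \<inter> tube (- v) = perp v \<inter> tube v"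
  proof -
    have "tube (- v) = tube v"
    proof (intro set_eqI iffI)
      fix x assume "x \<in> tube (- v)"
      then obtain t where "x + (- t) *\<^sub>R v \<in> C" by (auto simp: tube_def)
      then show "x \<in> tube v" unfolding tube_def by blast
    next
      fix x assume "x \<in> tube v"
      then obtain t where "x + (- t) *\<^sub>R (- v) \<in> C" by (auto simp: tube_def)
      then show "x \<in> tube (- v)" unfolding tube_def by blast
    qed
    then show ?thesis by (auto simp: perp_def)
  qed
  then have "(LINT x:upper (- v)|surf. outer_normal C x \<bullet> (- v)) = measure surf (perp v \<inter> tube v)"
    using outer_normal_upper_integral[of "- v"] v by simp
  finally show ?thesis using outer_normal_upper_integral[OF v] by simp
qed

end

section \<open>A convex domain inside a box\<close>

context
  fixes \<Omega> :: "(real^'d::finite) set" and a b :: "real^'d"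
  assumes d2: "CARD('d) \<ge> 2"
    and \<Omega>: "open \<Omega>" "convex \<Omega>" "bounded \<Omega>"
    and ab: "\<And>i. a $ i < b $ i" and meets: "cbox a b \<inter> \<Omega> \<noteq> {}"
begin

lemma box_Int_domain: "open (box a b \<inter> \<Omega>)" "convex (box a b \<inter> \<Omega>)" "bounded (box a b \<inter> \<Omega>)" "box a b \<inter> \<Omega> \<noteq> {}"
proof -
  have "box a b \<noteq> {}" using ab by (auto simp: interval_ne_empty_cart)
  then have "closure (box a b) = cbox a b" by simp
  then have "\<Omega> \<inter> closure (box a b) \<noteq> {}" using meets by auto
  then show "box a b \<inter> \<Omega> \<noteq> {}" using open_Int_closure_eq_empty[OF \<Omega>(1), of "box a b"] by auto
qed (auto intro: \<Omega> convex_Int bounded_Int convex_box)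

text \<open>
  For overlapping open convex sets, the closure of the intersection is the intersection of the
  closures.
\<close>

lemma frontier_box_Int:
  "frontier (box a b \<inter> \<Omega>) = (cbox a b \<inter> frontier \<Omega>) \<union> ((cbox a b - box a b) \<inter> \<Omega>)"
proof -
  have "box a b \<noteq> {}" using ab by (auto simp: interval_ne_empty_cart)
  then have cb: "closure (box a b) = cbox a b" by simp
  have "closure (box a b \<inter> \<Omega>) = closure (box a b) \<inter> closure \<Omega>"
    using box_Int_domain(4) \<Omega> by (intro closure_Int_convex) (auto simp: rel_interior_open open_box)
  then have "frontier (box a b \<inter> \<Omega>) = cbox a b \<inter> closure \<Omega> - box a b \<inter> \<Omega>"
    using box_Int_domain(1) by (simp add: frontier_def interior_open cb del: interior_Int)
  moreover have "frontier \<Omega> = closure \<Omega> - \<Omega>" using \<Omega> by (simp add: frontier_def interior_open)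
  ultimately show ?thesis using box_subset_cbox[of a b] closure_subset[of \<Omega>] by blast
qed

lemma face_not_in_box: "x $ i = a $ i \<or> x $ i = b $ i \<Longrightarrow> x \<notin> box a b"
  unfolding mem_box_cart by (metis less_irrefl)

text \<open>
  A normal of \<open>\<Omega>\<close> is a normal of every subset with the same boundary point, so where the normal of
  the cut cell is unique it agrees with that of \<open>\<Omega>\<close>. Degenerate positions of the box need no
  separate treatment: they only produce points with several normals, which form a null set.
\<close>

lemma outer_normal_Int_frontier:
  assumes x: "x \<in> cbox a b \<inter> frontier \<Omega>" and r: "x \<notin> ridge (box a b \<inter> \<Omega>)"
  shows "outer_normal (box a b \<inter> \<Omega>) x = outer_normal \<Omega> x"
proof -
  have "x \<in> frontier (box a b \<inter> \<Omega>) - ridge (box a b \<inter> \<Omega>)" using x r by (simp add: frontier_box_Int)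
  then have "normals (box a b \<inter> \<Omega>) x = {outer_normal (box a b \<inter> \<Omega>) x}"
    by (rule off_ridge[OF d2 box_Int_domain])
  moreover have "normals \<Omega> x \<subseteq> normals (box a b \<inter> \<Omega>) x" by (auto simp: normals_def)
  moreover have "\<Omega> \<noteq> {}" using meets by auto
  then have "normals \<Omega> x \<noteq> {}" using normals_nonempty[OF d2 \<Omega>, of x] x by auto
  ultimately have "normals \<Omega> x = {outer_normal (box a b \<inter> \<Omega>) x}" by (metis subset_singletonD)
  then show ?thesis using outer_normal_eq by metis
qed

text \<open>
  The same argument for the faces of the box. Edges of the box have several normals.
\<close>

lemma outer_normal_Int_face:
  assumes x: "x \<in> cbox a b \<inter> \<Omega>" and r: "x \<notin> ridge (box a b \<inter> \<Omega>)"
  shows "x $ i = b $ i \<Longrightarrow> outer_normal (box a b \<inter> \<Omega>) x = axis i 1"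
    and "x $ i = a $ i \<Longrightarrow> outer_normal (box a b \<inter> \<Omega>) x = - axis i 1"
proof -
  assume xi: "x $ i = b $ i"
  then have "x \<in> frontier (box a b \<inter> \<Omega>) - ridge (box a b \<inter> \<Omega>)"
    using x r face_not_in_box[of x i] by (auto simp: frontier_box_Int)
  then have "normals (box a b \<inter> \<Omega>) x = {outer_normal (box a b \<inter> \<Omega>) x}" by (rule off_ridge[OF d2 box_Int_domain])
  moreover have "axis i 1 \<in> normals (box a b \<inter> \<Omega>) x"
    using xi by (auto simp: normals_def norm_axis_1 inner_axis' mem_box_cart less_imp_le)
  ultimately show "outer_normal (box a b \<inter> \<Omega>) x = axis i 1" by auto
next
  assume xi: "x $ i = a $ i"
  then have "x \<in> frontier (box a b \<inter> \<Omega>) - ridge (box a b \<inter> \<Omega>)"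
    using x r face_not_in_box[of x i] by (auto simp: frontier_box_Int)
  then have "normals (box a b \<inter> \<Omega>) x = {outer_normal (box a b \<inter> \<Omega>) x}" by (rule off_ridge[OF d2 box_Int_domain])
  moreover have "- axis i 1 \<in> normals (box a b \<inter> \<Omega>) x"
    using xi by (auto simp: normals_def norm_axis_1 inner_axis' mem_box_cart less_imp_le)
  ultimately show "outer_normal (box a b \<inter> \<Omega>) x = - axis i 1" by auto
qed

lemma box_face_finite:
  assumes "c = a $ i \<or> c = b $ i"
  shows "cbox a b \<inter> {x. x $ i = c} \<inter> \<Omega> \<in> sets borel"
    and "emeasure surf (cbox a b \<inter> {x. x $ i = c} \<inter> \<Omega>) < \<infinity>"
proof -
  have "{x::real^'d. x $ i = c} \<in> sets borel" by (intro borel_closed closed_Collect_eq continuous_intros)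
  then show *: "cbox a b \<inter> {x. x $ i = c} \<inter> \<Omega> \<in> sets borel" using \<Omega>(1) by auto
  have "cbox a b \<inter> {x. x $ i = c} \<inter> \<Omega> \<subseteq> frontier (box a b \<inter> \<Omega>)"
    using assms face_not_in_box[of _ i] by (auto simp: frontier_box_Int)
  then show "emeasure surf (cbox a b \<inter> {x. x $ i = c} \<inter> \<Omega>) < \<infinity>"
    using surf_subset_frontier_finite[OF d2 box_Int_domain *] by blast
qed

text \<open>
  Component \<open>i\<close> of the integral of the normal over the closed surface of \<open>box a b \<inter> \<Omega>\<close>; besides
  the curved part, the two faces orthogonal to the axis \<open>i\<close> contribute.
\<close>

lemma cut_box_surface_integral:
  "measure surf (cbox a b \<inter> {x. x $ i = b $ i} \<inter> \<Omega>) - measure surf (cbox a b \<inter> {x. x $ i = a $ i} \<inter> \<Omega>)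
   + (LINT x:cbox a b \<inter> frontier \<Omega>|surf. outer_normal \<Omega> x \<bullet> axis i 1) = 0"
proof -
  let ?C = "box a b \<inter> \<Omega>" and ?e = "axis i 1 :: real^'d" and ?G = "cbox a b \<inter> frontier \<Omega>"
  let ?P = "cbox a b \<inter> {x. x $ i = b $ i} \<inter> \<Omega>" and ?Q = "cbox a b \<inter> {x. x $ i = a $ i} \<inter> \<Omega>"
  have \<Omega>ne: "\<Omega> \<noteq> {}" using meets by auto
  have G: "?G \<in> sets borel" by (intro sets.Int borel_closed) auto
  have intC: "integrable surf (\<lambda>x. indicator (frontier ?C) x *\<^sub>R (outer_normal ?C x \<bullet> ?e))"
    using outer_normal_integrable[OF d2 box_Int_domain, of "frontier ?C" ?e]
    by (simp add: set_integrable_def borel_closed)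
  have intG: "integrable surf (\<lambda>x. indicator ?G x *\<^sub>R (outer_normal \<Omega> x \<bullet> ?e))"
    using outer_normal_integrable[OF d2 \<Omega> \<Omega>ne G, of ?e] by (simp add: set_integrable_def)
  have intP: "integrable surf (indicator ?P :: _ \<Rightarrow> real)" and intQ: "integrable surf (indicator ?Q :: _ \<Rightarrow> real)"
    using box_face_finite[of "b $ i" i] box_face_finite[of "a $ i" i] by (auto intro!: integrable_real_indicator)
  have "AE x in surf. x \<notin> ridge ?C"
    using surf_ridge_null[OF d2 box_Int_domain] ridge_borel[OF d2 box_Int_domain]
    by (intro AE_not_in) (auto simp: null_sets_def)
  then have AE: "AE x in surf. indicator (frontier ?C) x *\<^sub>R (outer_normal ?C x \<bullet> ?e)
      = indicator ?P x - indicator ?Q x + indicator ?G x *\<^sub>R (outer_normal \<Omega> x \<bullet> ?e)"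
  proof eventually_elim
    fix x assume r: "x \<notin> ridge ?C"
    have disj: "\<Omega> \<inter> frontier \<Omega> = {}" using \<Omega>(1) by (simp add: frontier_def interior_open)
    consider "x \<notin> frontier ?C" | "x \<in> ?G" | "x \<in> (cbox a b - box a b) \<inter> \<Omega>"
      using frontier_box_Int by blast
    then show "indicator (frontier ?C) x *\<^sub>R (outer_normal ?C x \<bullet> ?e)
      = indicator ?P x - indicator ?Q x + indicator ?G x *\<^sub>R (outer_normal \<Omega> x \<bullet> ?e)"
    proof cases
      case 1
      then have "x \<notin> ?P" "x \<notin> ?Q" "x \<notin> ?G" using face_not_in_box[of x i] by (auto simp: frontier_box_Int)
      then show ?thesis using 1 by simp
    next
      case 2
      then have "x \<notin> ?P" "x \<notin> ?Q" "x \<in> frontier ?C" using disj by (auto simp: frontier_box_Int)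
      then show ?thesis using 2 outer_normal_Int_frontier[OF 2 r] by simp
    next
      case 3
      then have x: "x \<in> cbox a b \<inter> \<Omega>" "x \<notin> ?G" "x \<in> frontier ?C" using disj by (auto simp: frontier_box_Int)
      have "\<And>j. a $ j \<le> x $ j \<and> x $ j \<le> b $ j" "\<not> (\<forall>j. a $ j < x $ j \<and> x $ j < b $ j)"
        using 3 unfolding Int_iff Diff_iff mem_box_cart by blast+
      then obtain j where j: "x $ j = a $ j \<or> x $ j = b $ j" by (metis order_le_less)
      show ?thesis
      proof (cases "x \<in> ?P \<or> x \<in> ?Q")
        case True
        then show ?thesis
          using x ab[of i] outer_normal_Int_face[OF x(1) r, of i] by (auto simp: inner_axis_axis)
      next
        case False
        then have "j \<noteq> i" using x j by auto
        then have "outer_normal ?C x \<bullet> ?e = 0"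
          using j outer_normal_Int_face[OF x(1) r, of j] by (auto simp: inner_axis_axis)
        then show ?thesis using False x by simp
      qed
    qed
  qed
  have "0 = (LINT x:frontier ?C|surf. outer_normal ?C x \<bullet> ?e)"
    using closed_surface_integral[OF d2 box_Int_domain, of ?e] by (simp add: norm_axis_1)
  also have "\<dots> = (LINT x|surf. indicator ?P x - indicator ?Q x + indicator ?G x *\<^sub>R (outer_normal \<Omega> x \<bullet> ?e))"
    unfolding set_lebesgue_integral_def
    by (rule integral_cong_AE[OF _ _ AE]) (use intC intP intQ intG in \<open>auto intro!: borel_measurable_add borel_measurable_diff\<close>)
  also have "\<dots> = measure surf ?P - measure surf ?Q + (LINT x:?G|surf. outer_normal \<Omega> x \<bullet> ?e)"
    using intP intQ intG by (simp add: set_lebesgue_integral_def)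
  finally show ?thesis by simp
qed

end

section \<open>Macro-elements as closed surfaces\<close>

lemma convex_domainD:
  assumes "convex_domain \<Omega>"
  shows "open \<Omega>" "convex \<Omega>" "bounded \<Omega>" "\<Omega> \<noteq> {}"
  using assms by (auto simp: convex_domain_def)

definition neighbours :: "'d idx \<Rightarrow> 'd idx set" where
  "neighbours k = {k'. adjacent k k'}"

lemma neighbours_eq: "neighbours k = (\<Union>i. {k(i := k i + 1), k(i := k i - 1)})"
proof -
  have "next_cell k' k \<longleftrightarrow> (\<exists>i. k' = k(i := k i - 1))" for k' :: "'a idx"
    by (auto simp: next_cell_def fun_eq_iff) (metis add_diff_cancel diff_add_cancel)+
  then show ?thesis by (auto simp: neighbours_def adjacent_def next_cell_def)
qed

lemma finite_neighbours: "finite (neighbours (k :: 'd::finite idx))"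
  by (simp add: neighbours_eq)

lemma adjacent_commute: "adjacent k k' \<longleftrightarrow> adjacent k' k"
  by (auto simp: adjacent_def)

text \<open>
  The flux of the constant vector field \<open>v\<close> through a facet.
\<close>

definition facet_flow :: "('d::finite) cut_dg \<Rightarrow> real^'d \<Rightarrow> 'd facet \<Rightarrow> real" where
  "facet_flow S v e = (LINT x:facet_set S e|surf. normal S e x \<bullet> v)"

context
  fixes S :: "('d::finite) cut_dg"
  assumes d2: "CARD('d) \<ge> 2"
    and dom: "convex_domain (Omega S)" and mesh: "background_mesh S"
begin

lemma grid_step: "grid S i j < grid S i (j + 1)"
proof -
  obtain c where "c > 0" "c * msize S \<le> grid S i (j + 1) - grid S i j" "0 < msize S"
    using mesh by (auto simp: background_mesh_def)
  then have "0 < c * msize S" by simp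
  then show ?thesis using \<open>c * msize S \<le> _\<close> by linarith
qed

lemma grid_growth: "\<exists>\<kappa>>0. \<forall>i j (n::nat). grid S i j + real n * \<kappa> \<le> grid S i (j + int n)"
proof -
  obtain c where c: "c > 0" "\<And>i j. c * msize S \<le> grid S i (j + 1) - grid S i j" "0 < msize S"
    using mesh by (auto simp: background_mesh_def)
  have "grid S i j + real n * (c * msize S) \<le> grid S i (j + int n)" for i j and n :: nat
  proof (induction n)
    case (Suc n)
    then show ?case using c(2)[of i "j + int n"] by (simp add: algebra_simps)
  qed simp
  then show ?thesis using c by (intro exI[of _ "c * msize S"]) auto
qed

lemma grid_strict_mono: "j < j' \<Longrightarrow> grid S i j < grid S i j'"
proof -
  assume "j < j'"
  obtain \<kappa> where "0 < \<kappa>" "\<And>i j (n::nat). grid S i j + real n * \<kappa> \<le> grid S i (j + int n)" using grid_growth by blast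
  from this(2)[of i j "nat (j' - j)"] \<open>j < j'\<close> \<open>0 < \<kappa>\<close> show ?thesis
    by (simp add: algebra_simps) (smt (verit) mult_strict_left_mono of_int_less_iff)
qed

lemma mem_cell: "x \<in> cell S k \<longleftrightarrow> (\<forall>i. grid S i (k i) \<le> x $ i \<and> x $ i \<le> grid S i (k i + 1))"
  by (simp add: cell_def mem_box_cart)

lemma cells_cover: "\<exists>k. x \<in> cell S k"
proof -
  obtain \<kappa> where k: "0 < \<kappa>" "\<And>i j (n::nat). grid S i j + real n * \<kappa> \<le> grid S i (j + int n)" using grid_growth by blast
  have "\<exists>j. grid S i j \<le> y \<and> y \<le> grid S i (j + 1)" for i y
  proof -
    obtain m :: nat where m: "grid S i 0 - y < real m * \<kappa>" using reals_Archimedean3[OF k(1)] by blast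
    obtain n :: nat where n: "y - grid S i (- int m) < real n * \<kappa>" using reals_Archimedean3[OF k(1)] by blast
    \<comment> \<open>The first grid line, counted from one below \<open>y\<close>, that is not below \<open>y\<close>.\<close>
    define P where "P l \<longleftrightarrow> y \<le> grid S i (- int m + int l)" for l :: nat
    have "P n" using n k(2)[of i "- int m" n] by (simp add: P_def)
    then obtain l where l: "P l" "\<And>l'. l' < l \<Longrightarrow> \<not> P l'" by (metis exists_least_iff)
    have low: "grid S i (- int m) < y" using m k(2)[of i "- int m" m] by simp
    have "l \<noteq> 0"
    proof
      assume "l = 0"
      then show False using l(1) low by (simp add: P_def)
    qed
    then obtain l' where l': "l = Suc l'" using not0_implies_Suc by blast
    then have "\<not> P l'" using l(2) by simp
    then show ?thesis using l(1) by (intro exI[of _ "- int m + int l'"]) (auto simp: P_def l' algebra_simps)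
  qed
  then have "\<forall>i. \<exists>j. grid S i j \<le> x $ i \<and> x $ i \<le> grid S i (j + 1)" by blast
  then obtain k where "\<forall>i. grid S i (k i) \<le> x $ i \<and> x $ i \<le> grid S i (k i + 1)" by metis
  then show ?thesis by (auto simp: mem_cell)
qed

lemma finite_active: "finite (active S)"
proof -
  obtain R where R: "\<And>x. x \<in> Omega S \<Longrightarrow> norm x \<le> R"
    using convex_domainD(3)[OF dom] by (auto simp: bounded_iff)
  obtain \<kappa> where k: "0 < \<kappa>" "\<And>i j (n::nat). grid S i j + real n * \<kappa> \<le> grid S i (j + int n)" using grid_growth by blast
  have fin: "finite {j. grid S i j \<le> R \<and> - R \<le> grid S i (j + 1)}" for i
  proof -
    obtain m :: nat where m: "R - grid S i 0 < real m * \<kappa>" using reals_Archimedean3[OF k(1)] by blast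
    obtain n :: nat where n: "R + grid S i 0 < real n * \<kappa>" using reals_Archimedean3[OF k(1)] by blast
    have "j \<le> int m" if "grid S i j \<le> R" for j
    proof (rule ccontr)
      assume "\<not> j \<le> int m"
      then have "grid S i (int m) < grid S i j" by (intro grid_strict_mono) simp
      then show False using k(2)[of i 0 m] m that by simp
    qed
    moreover have "- int n \<le> j + 1" if "- R \<le> grid S i (j + 1)" for j
    proof (rule ccontr)
      assume "\<not> - int n \<le> j + 1"
      then have "grid S i (j + 1) < grid S i (- int n)" by (intro grid_strict_mono) simp
      then show False using k(2)[of i "- int n" n] n that by simp
    qed
    ultimately have "{j. grid S i j \<le> R \<and> - R \<le> grid S i (j + 1)} \<subseteq> {- int n - 1..int m}" by force
    then show ?thesis by (rule finite_subset) simp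
  qed
  have "active S \<subseteq> PiE UNIV (\<lambda>i. {j. grid S i j \<le> R \<and> - R \<le> grid S i (j + 1)})"
  proof
    fix k assume "k \<in> active S"
    then obtain x where x: "x \<in> cell S k" "x \<in> Omega S" by (auto simp: active_def)
    have "\<bar>x $ i\<bar> \<le> R" for i using component_le_norm_cart[of x i] R[OF x(2)] by linarith
    then show "k \<in> PiE UNIV (\<lambda>i. {j. grid S i j \<le> R \<and> - R \<le> grid S i (j + 1)})"
      using x(1) by (auto simp: mem_cell abs_le_iff) (meson order_trans minus_le_iff)+
  qed
  then show ?thesis by (rule finite_subset) (intro finite_PiE fin, simp)
qed

lemma closure_Omega_covered:
  assumes "x \<in> closure (Omega S)"
  shows "\<exists>k\<in>active S. x \<in> cell S k"
proof -
  have "closed (\<Union>k\<in>active S. cell S k)"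
    by (intro closed_UN finite_active ballI) (simp add: cell_def closed_cbox)
  moreover have "Omega S \<subseteq> (\<Union>k\<in>active S. cell S k)"
  proof
    fix x assume "x \<in> Omega S"
    moreover obtain k where "x \<in> cell S k" using cells_cover by blast
    ultimately show "x \<in> (\<Union>k\<in>active S. cell S k)" by (auto simp: active_def)
  qed
  ultimately show ?thesis using closure_minimal assms by blast
qed

lemma cell_Int_upper: "cell S k \<inter> cell S (k(i := k i + 1)) = cell S k \<inter> {x. x $ i = grid S i (k i + 1)}"
proof (intro equalityI subsetI)
  fix x assume "x \<in> cell S k \<inter> {x. x $ i = grid S i (k i + 1)}"
  then show "x \<in> cell S k \<inter> cell S (k(i := k i + 1))"
    using grid_step[of i "k i + 1"] by (auto simp: mem_cell)
next
  fix x assume x: "x \<in> cell S k \<inter> cell S (k(i := k i + 1))"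
  then have "x $ i \<le> grid S i (k i + 1)" by (simp add: mem_cell)
  moreover have "grid S i (k i + 1) \<le> x $ i" using x by (auto simp: mem_cell dest: spec[of _ i])
  ultimately show "x \<in> cell S k \<inter> {x. x $ i = grid S i (k i + 1)}" using x by auto
qed

lemma cell_Int_lower: "cell S k \<inter> cell S (k(i := k i - 1)) = cell S k \<inter> {x. x $ i = grid S i (k i)}"
proof (intro equalityI subsetI)
  fix x assume "x \<in> cell S k \<inter> {x. x $ i = grid S i (k i)}"
  then show "x \<in> cell S k \<inter> cell S (k(i := k i - 1))"
    using grid_step[of i "k i - 1"] by (auto simp: mem_cell)
next
  fix x assume x: "x \<in> cell S k \<inter> cell S (k(i := k i - 1))"
  then have "grid S i (k i) \<le> x $ i" by (simp add: mem_cell)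
  moreover have "x $ i \<le> grid S i (k i)" using x by (auto simp: mem_cell dest: spec[of _ i])
  ultimately show "x \<in> cell S k \<inter> {x. x $ i = grid S i (k i)}" using x by auto
qed

text \<open>
  Each facet is part of the boundary of one cut cell.
\<close>

lemma facet_borel_finite:
  assumes k: "k \<in> active S" and e: "e = Inner k k' \<and> adjacent k k' \<or> e = Outer k"
  shows "facet_set S e \<in> sets borel" "emeasure surf (facet_set S e) < \<infinity>" "facet_set S e \<subseteq> closure (Omega S)"
proof -
  note O = convex_domainD[OF dom]
  let ?a = "(\<chi> i. grid S i (k i))" and ?b = "(\<chi> i. grid S i (k i + 1))"
  have ab: "?a $ i < ?b $ i" for i using grid_step by simp
  have meets: "cbox ?a ?b \<inter> Omega S \<noteq> {}" using k by (simp add: active_def cell_def)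
  note F = box_face_finite[OF d2 O(1-3) ab meets]
  show "facet_set S e \<in> sets borel" "emeasure surf (facet_set S e) < \<infinity>"
  proof -
    have "facet_set S e \<in> sets borel \<and> emeasure surf (facet_set S e) < \<infinity>"
    proof (cases "e = Outer k")
      case True
      have "cell S k \<inter> bdry S \<in> sets borel" by (intro sets.Int borel_closed) (auto simp: cell_def)
      then show ?thesis using True surf_subset_frontier_finite[OF d2 O, of "cell S k \<inter> bdry S"] by auto
    next
      case False
      then have e: "e = Inner k k'" "k' \<in> neighbours k" using e by (auto simp: neighbours_def)
      then obtain i where "k' = k(i := k i + 1) \<or> k' = k(i := k i - 1)" by (auto simp: neighbours_eq)
      then show ?thesis
      proof
        assume "k' = k(i := k i + 1)"
        then show ?thesis using F[of "?b $ i" i] by (simp add: e cell_Int_upper) (simp add: cell_def)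
      next
        assume "k' = k(i := k i - 1)"
        then show ?thesis using F[of "?a $ i" i] by (simp add: e cell_Int_lower) (simp add: cell_def)
      qed
    qed
    then show "facet_set S e \<in> sets borel" "emeasure surf (facet_set S e) < \<infinity>" by auto
  qed
  show "facet_set S e \<subseteq> closure (Omega S)"
    using e closure_subset[of "Omega S"] by (auto simp: frontier_def)
qed

lemma facet_flow_Inner:
  assumes "k \<in> active S" "adjacent k k'"
  shows "facet_flow S (axis i 1) (Inner k k') = of_int (k' i - k i) * measure surf (facet_set S (Inner k k'))"
  using facet_borel_finite(1)[of k "Inner k k'" k'] assms
  by (simp add: facet_flow_def set_lebesgue_integral_def inner_axis)

text \<open>
  The facets towards inactive neighbours are empty, so the sum may run over all neighbours.
\<close>

lemma cell_balance:
  assumes k: "k \<in> active S"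
  shows "(\<Sum>k'\<in>neighbours k. facet_flow S (axis i 1) (Inner k k')) + facet_flow S (axis i 1) (Outer k) = 0"
proof -
  note O = convex_domainD[OF dom]
  let ?a = "(\<chi> i. grid S i (k i))" and ?b = "(\<chi> i. grid S i (k i + 1))"
  have ab: "?a $ i < ?b $ i" for i using grid_step by simp
  have meets: "cbox ?a ?b \<inter> Omega S \<noteq> {}" using k by (simp add: active_def cell_def)
  let ?u = "k(i := k i + 1)" and ?l = "k(i := k i - 1)"
  have nb: "{?u, ?l} \<subseteq> neighbours k" by (auto simp: neighbours_eq)
  then have adj: "adjacent k ?u" "adjacent k ?l" by (auto simp: neighbours_def)
  have "facet_flow S (axis i 1) (Inner k k') = 0" if k': "k' \<in> neighbours k - {?u, ?l}" for k'
  proof -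
    obtain j where "k' = k(j := k j + 1) \<or> k' = k(j := k j - 1)" using k' by (auto simp: neighbours_eq)
    then have "k' i = k i" using k' by (cases "j = i") auto
    then show ?thesis using facet_flow_Inner[OF k] k' by (simp add: neighbours_def)
  qed
  then have "(\<Sum>k'\<in>neighbours k. facet_flow S (axis i 1) (Inner k k')) = (\<Sum>k'\<in>{?u, ?l}. facet_flow S (axis i 1) (Inner k k'))"
    using nb by (intro sum.mono_neutral_right finite_neighbours) auto
  also have "\<dots> = facet_flow S (axis i 1) (Inner k ?u) + facet_flow S (axis i 1) (Inner k ?l)"
    by (subst sum.insert) (auto simp: fun_eq_iff dest: spec[of _ i])
  also have "facet_flow S (axis i 1) (Inner k ?u) = measure surf (cbox ?a ?b \<inter> {x. x $ i = ?b $ i} \<inter> Omega S)"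
    by (simp add: facet_flow_Inner[OF k adj(1)] cell_Int_upper) (simp add: cell_def)
  also have "facet_flow S (axis i 1) (Inner k ?l) = - measure surf (cbox ?a ?b \<inter> {x. x $ i = ?a $ i} \<inter> Omega S)"
    by (simp add: facet_flow_Inner[OF k adj(2)] cell_Int_lower) (simp add: cell_def)
  finally show ?thesis
    using cut_box_surface_integral[OF d2 O(1-3) ab meets, of i] by (simp add: facet_flow_def cell_def)
qed

lemma facet_flow_antisym:
  assumes "k \<in> active S" "k' \<in> active S" "adjacent k k'"
  shows "facet_flow S (axis i 1) (Inner k' k) = - facet_flow S (axis i 1) (Inner k k')"
  using assms facet_flow_Inner[of k k' i] facet_flow_Inner[of k' k i]
  by (simp add: adjacent_commute Int_commute left_diff_distrib)

lemma facet_flow_linear: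
  assumes k: "k \<in> active S" and e: "e = Inner k k' \<and> adjacent k k' \<or> e = Outer k"
  shows "set_integrable surf (facet_set S e) (\<lambda>x. normal S e x \<bullet> v)"
    and "facet_flow S v e = (\<Sum>i\<in>UNIV. v $ i * facet_flow S (axis i 1) e)"
proof -
  note O = convex_domainD[OF dom]
  note F = facet_borel_finite[OF k e]
  have int: "set_integrable surf (facet_set S e) (\<lambda>x. normal S e x \<bullet> w)" for w
  proof (cases "e = Outer k")
    case True
    then show ?thesis using outer_normal_integrable[OF d2 O, of "facet_set S e" w] F(1) by simp
  next
    case False
    then show ?thesis using e F
      by (auto simp: set_integrable_def less_top intro!: integrable_scaleR_left integrable_real_indicator)
  qed
  show "set_integrable surf (facet_set S e) (\<lambda>x. normal S e x \<bullet> v)" by (rule int)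
  have "normal S e x \<bullet> v = (\<Sum>i\<in>UNIV. v $ i * (normal S e x \<bullet> axis i 1))" for x
  proof -
    have "normal S e x \<bullet> axis i 1 = normal S e x $ i" for i by (simp add: inner_axis)
    then show ?thesis by (simp add: inner_vec_def mult.commute)
  qed
  then have "facet_flow S v e = (LINT x:facet_set S e|surf. (\<Sum>i\<in>UNIV. v $ i * (normal S e x \<bullet> axis i 1)))"
    by (simp add: facet_flow_def)
  also have "\<dots> = (\<Sum>i\<in>UNIV. LINT x:facet_set S e|surf. v $ i * (normal S e x \<bullet> axis i 1))"
  proof -
    have "integrable surf (\<lambda>x. indicator (facet_set S e) x *\<^sub>R (v $ i * (normal S e x \<bullet> axis i 1)))" for i
      using set_integrable_mult_right[of "v $ i", OF int[of "axis i 1"]] by (simp add: set_integrable_def)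
    then show ?thesis unfolding set_lebesgue_integral_def scaleR_sum_right by (intro Bochner_Integration.integral_sum)
  qed
  also have "\<dots> = (\<Sum>i\<in>UNIV. v $ i * facet_flow S (axis i 1) e)" by (simp add: facet_flow_def)
  finally show "facet_flow S v e = (\<Sum>i\<in>UNIV. v $ i * facet_flow S (axis i 1) e)" .
qed

end

text \<open>
  All facets of the interfaces of a macro-element. Sums over interfaces and their facets become
  single sums over this set.
\<close>

definition macro_facets :: "('d::finite) cut_dg \<Rightarrow> 'd idx set \<Rightarrow> 'd facet set" where
  "macro_facets S M = {Inner k k' | k k'. k \<in> M \<and> k' \<in> active S - M \<and> adjacent k k'} \<union> Outer ` (M \<inter> cut_cells S)"

context
  fixes S :: "('d::finite) cut_dg"
  assumes d2: "CARD('d) \<ge> 2"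
    and dom: "convex_domain (Omega S)" and mesh: "background_mesh S" and mac: "macro_elements S"
begin

lemma macros_partition: "partition_on (active S) (macros S)"
  using mac by (simp add: macro_elements_def)

lemma macro_subset_active: "M \<in> macros S \<Longrightarrow> M \<subseteq> active S"
  using macros_partition by (auto simp: partition_on_def)

lemma finite_macro: "M \<in> macros S \<Longrightarrow> finite M"
  using macro_subset_active finite_active[OF d2 dom mesh] finite_subset by blast

lemma finite_macros: "finite (macros S)"
  using macros_partition finite_active[OF d2 dom mesh] finite_elements by blast

lemma macros_disjoint: "\<lbrakk>M \<in> macros S; N \<in> macros S; k \<in> M; k \<in> N\<rbrakk> \<Longrightarrow> M = N"
  using macros_partition by (auto simp: partition_on_def disjoint_def)

lemma macro_of_eq:
  assumes "M \<in> macros S" "k \<in> M"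
  shows "macro_of S k = M"
  unfolding macro_of_def using assms macros_disjoint by (intro the_equality) auto

lemma macro_of_active:
  assumes "k \<in> active S"
  shows "macro_of S k \<in> macros S" "k \<in> macro_of S k"
proof -
  obtain M where "M \<in> macros S" "k \<in> M" using assms macros_partition by (auto simp: partition_on_def)
  then show "macro_of S k \<in> macros S" "k \<in> macro_of S k" by (simp_all add: macro_of_eq)
qed

lemma finite_faces: "finite (faces S M)" if "M \<in> macros S"
proof -
  have "faces S M \<subseteq> Shared M ` macros S \<union> OnBdry ` M" by (auto simp: faces_def)
  then show ?thesis by (rule finite_subset) (use finite_macros finite_macro[OF that] in auto)
qed

lemma finite_facets_of: "finite (facets_of \<xi>)" if "M \<in> macros S" "\<xi> \<in> faces S M"
proof (cases \<xi>)
  case (Shared A N)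
  then have "A = M" "N \<in> macros S" using that by (auto simp: faces_def)
  then have "facets_of \<xi> \<subseteq> (\<lambda>(k, k'). Inner k k') ` (M \<times> N)" using Shared by auto
  then show ?thesis by (rule finite_subset) (use finite_macro that \<open>N \<in> _\<close> in auto)
qed simp

lemma facets_of_faces: "(\<Union>\<xi>\<in>faces S M. facets_of \<xi>) = macro_facets S M" if M: "M \<in> macros S"
proof (intro equalityI subsetI)
  fix e assume "e \<in> (\<Union>\<xi>\<in>faces S M. facets_of \<xi>)"
  then obtain \<xi> where xi: "\<xi> \<in> faces S M" "e \<in> facets_of \<xi>" by blast
  show "e \<in> macro_facets S M"
  proof (cases \<xi>)
    case (Shared A N)
    then have A: "A = M" "N \<in> macros S" "N \<noteq> M" using xi by (auto simp: faces_def)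
    then obtain k k' where e: "e = Inner k k'" "k \<in> M" "k' \<in> N" "adjacent k k'" using xi Shared by auto
    then have "k' \<in> active S - M" using A macro_subset_active macros_disjoint[OF M] by blast
    then show ?thesis using e by (auto simp: macro_facets_def)
  next
    case (OnBdry k)
    then show ?thesis using xi by (auto simp: faces_def macro_facets_def)
  qed
next
  fix e assume "e \<in> macro_facets S M"
  then consider k k' where "e = Inner k k'" "k \<in> M" "k' \<in> active S - M" "adjacent k k'"
    | k where "e = Outer k" "k \<in> M \<inter> cut_cells S"
    by (auto simp: macro_facets_def)
  then show "e \<in> (\<Union>\<xi>\<in>faces S M. facets_of \<xi>)"
  proof cases
    case 1
    let ?N = "macro_of S k'"
    have N: "?N \<in> macros S" "k' \<in> ?N" using macro_of_active 1 by auto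
    then have "?N \<noteq> M" using 1 by auto
    moreover have "e \<in> facets_of (Shared M ?N)" using 1 N by auto
    ultimately have "Shared M ?N \<in> faces S M" using N by (auto simp: faces_def)
    then show ?thesis using \<open>e \<in> facets_of (Shared M ?N)\<close> by blast
  next
    case 2
    then have "OnBdry k \<in> faces S M" "e \<in> facets_of (OnBdry k)" by (auto simp: faces_def)
    then show ?thesis by blast
  qed
qed

lemma sum_faces: "(\<Sum>\<xi>\<in>faces S M. \<Sum>e\<in>facets_of \<xi>. g e) = (\<Sum>e\<in>macro_facets S M. g e)" if M: "M \<in> macros S"
proof -
  have "facets_of \<xi> \<inter> facets_of \<zeta> = {}" if "\<xi> \<in> faces S M" "\<zeta> \<in> faces S M" "\<xi> \<noteq> \<zeta>" for \<xi> \<zeta>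
    using that macros_disjoint by (cases \<xi>; cases \<zeta>) (auto simp: faces_def)
  then have "(\<Sum>e\<in>(\<Union>\<xi>\<in>faces S M. facets_of \<xi>). g e) = (\<Sum>\<xi>\<in>faces S M. \<Sum>e\<in>facets_of \<xi>. g e)"
    using finite_faces[OF M] finite_facets_of[OF M] by (intro sum.UNION_disjoint) auto
  then show ?thesis by (simp add: facets_of_faces[OF M])
qed

lemma macro_facetE:
  assumes M: "M \<in> macros S" and e: "e \<in> macro_facets S M"
  obtains k k' where "k \<in> active S" "k \<in> M" "e = Inner k k' \<and> adjacent k k' \<and> k' \<in> active S \<or> e = Outer k"
  using e macro_subset_active[OF M] unfolding macro_facets_def cut_cells_def by blast

text \<open>
  For a quantity that vanishes on empty facets, the restrictions to active neighbours and to cut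
  cells may be dropped.
\<close>

lemma sum_macro_facets:
  assumes M: "M \<in> macros S"
    and inactive: "\<And>k k'. k' \<notin> active S \<Longrightarrow> g (Inner k k') = 0"
    and uncut: "\<And>k. k \<in> active S - cut_cells S \<Longrightarrow> g (Outer k) = 0"
  shows "(\<Sum>e\<in>macro_facets S M. g e) = (\<Sum>k\<in>M. (\<Sum>k'\<in>neighbours k - M. g (Inner k k')) + g (Outer k) :: real)"
proof -
  let ?I = "SIGMA k:M. neighbours k \<inter> (active S - M)"
  have I: "{Inner k k' | k k'. k \<in> M \<and> k' \<in> active S - M \<and> adjacent k k'} = (\<lambda>(k, k'). Inner k k') ` ?I"
    by (auto simp: neighbours_def image_iff)
  have finI: "finite ?I" using finite_macro[OF M] finite_neighbours by (intro finite_SigmaI) auto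
  have "(\<Sum>e\<in>macro_facets S M. g e)
      = (\<Sum>e\<in>(\<lambda>(k, k'). Inner k k') ` ?I. g e) + (\<Sum>e\<in>Outer ` (M \<inter> cut_cells S). g e)"
    unfolding macro_facets_def I using finI finite_macro[OF M] by (intro sum.union_disjoint) auto
  also have "(\<Sum>e\<in>(\<lambda>(k, k'). Inner k k') ` ?I. g e) = (\<Sum>(k, k')\<in>?I. g (Inner k k'))"
    by (subst sum.reindex) (auto simp: inj_on_def intro!: sum.cong)
  also have "\<dots> = (\<Sum>k\<in>M. \<Sum>k'\<in>neighbours k \<inter> (active S - M). g (Inner k k'))"
    using finite_macro[OF M] finite_neighbours by (intro sum.Sigma[symmetric]) auto
  also have "\<dots> = (\<Sum>k\<in>M. \<Sum>k'\<in>neighbours k - M. g (Inner k k'))"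
    using inactive finite_neighbours by (intro sum.cong refl sum.mono_neutral_left) auto
  also have "(\<Sum>e\<in>Outer ` (M \<inter> cut_cells S). g e) = (\<Sum>k\<in>M \<inter> cut_cells S. g (Outer k))"
    by (subst sum.reindex) (auto simp: inj_on_def)
  also have "\<dots> = (\<Sum>k\<in>M. g (Outer k))"
    using uncut macro_subset_active[OF M] finite_macro[OF M] by (intro sum.mono_neutral_left) auto
  finally show ?thesis by (simp add: sum.distrib)
qed

lemma macro_balance_axis:
  assumes M: "M \<in> macros S"
  shows "(\<Sum>e\<in>macro_facets S M. facet_flow S (axis i 1) e) = 0"
proof -
  let ?g = "facet_flow S (axis i 1)"
  have "(\<Sum>e\<in>macro_facets S M. ?g e) = (\<Sum>k\<in>M. (\<Sum>k'\<in>neighbours k - M. ?g (Inner k k')) + ?g (Outer k))"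
  proof (rule sum_macro_facets[OF M])
    show "?g (Inner k k') = 0" if "k' \<notin> active S" for k k'
    proof -
      have "facet_set S (Inner k k') = {}" using that by (auto simp: active_def)
      then show ?thesis unfolding facet_flow_def by (simp add: set_lebesgue_integral_def del: facet_set.simps)
    qed
    show "?g (Outer k) = 0" if "k \<in> active S - cut_cells S" for k
    proof -
      have "facet_set S (Outer k) = {}" using that by (auto simp: cut_cells_def)
      then show ?thesis unfolding facet_flow_def by (simp add: set_lebesgue_integral_def del: facet_set.simps)
    qed
  qed
  also have "\<dots> = (\<Sum>k\<in>M. - (\<Sum>k'\<in>neighbours k \<inter> M. ?g (Inner k k')))"
  proof (rule sum.cong[OF refl])
    fix k assume "k \<in> M"
    then have "k \<in> active S" using macro_subset_active[OF M] by auto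
    moreover have "(\<Sum>k'\<in>neighbours k. ?g (Inner k k'))
        = (\<Sum>k'\<in>neighbours k - M. ?g (Inner k k')) + (\<Sum>k'\<in>neighbours k \<inter> M. ?g (Inner k k'))"
      using sum.Int_Diff[OF finite_neighbours[of k], of "\<lambda>k'. ?g (Inner k k')" M] by simp
    ultimately show "(\<Sum>k'\<in>neighbours k - M. ?g (Inner k k')) + ?g (Outer k) = - (\<Sum>k'\<in>neighbours k \<inter> M. ?g (Inner k k'))"
      using cell_balance[OF d2 dom mesh, of k i] by linarith
  qed
  also have "\<dots> = 0"
  proof -
    \<comment> \<open>Each facet inside \<open>M\<close> is counted once from either side, with opposite
      normals.\<close>
    let ?h = "\<lambda>k k'. if adjacent k k' then ?g (Inner k k') else 0"
    have "(\<Sum>k'\<in>neighbours k \<inter> M. ?g (Inner k k')) = (\<Sum>k'\<in>M. ?h k k')" for k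
    proof -
      have "(\<Sum>k'\<in>M. ?h k k') = (\<Sum>k'\<in>M \<inter> {k'. adjacent k k'}. ?g (Inner k k'))"
        using finite_macro[OF M] by (simp add: sum.inter_restrict)
      also have "M \<inter> {k'. adjacent k k'} = neighbours k \<inter> M" by (auto simp: neighbours_def)
      finally show ?thesis by simp
    qed
    then have 1: "(\<Sum>k\<in>M. \<Sum>k'\<in>neighbours k \<inter> M. ?g (Inner k k')) = (\<Sum>k\<in>M. \<Sum>k'\<in>M. ?h k k')" by simp
    have "(\<Sum>k\<in>M. \<Sum>k'\<in>M. ?h k k') = (\<Sum>k'\<in>M. \<Sum>k\<in>M. ?h k k')" by (rule sum.swap)
    also have "\<dots> = (\<Sum>k'\<in>M. \<Sum>k\<in>M. - ?h k' k)"
    proof (intro sum.cong refl)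
      fix k k' assume "k \<in> M" "k' \<in> M"
      then have "k \<in> active S" "k' \<in> active S" using macro_subset_active[OF M] by auto
      then show "?h k k' = - ?h k' k"
        using facet_flow_antisym[OF d2 dom mesh, of k' k i] by (auto simp: adjacent_commute)
    qed
    also have "\<dots> = - (\<Sum>k\<in>M. \<Sum>k'\<in>M. ?h k k')" by (simp add: sum_negf)
    finally have "(\<Sum>k\<in>M. \<Sum>k'\<in>M. ?h k k') = 0" by simp
    then show ?thesis using 1 by (simp add: sum_negf)
  qed
  finally show ?thesis .
qed

text \<open>
  Add up the balances of the cells: the facets inside the macro-element cancel.
\<close>

theorem macro_balance:
  assumes M: "M \<in> macros S"
  shows "(\<Sum>e\<in>macro_facets S M. LINT x:facet_set S e|surf. normal S e x \<bullet> v) = 0"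
proof -
  have "(\<Sum>e\<in>macro_facets S M. facet_flow S v e) = (\<Sum>e\<in>macro_facets S M. \<Sum>i\<in>UNIV. v $ i * facet_flow S (axis i 1) e)"
  proof (rule sum.cong[OF refl])
    fix e assume "e \<in> macro_facets S M"
    then obtain k k' where k: "k \<in> active S" "e = Inner k k' \<and> adjacent k k' \<or> e = Outer k"
      using macro_facetE[OF M] by metis
    show "facet_flow S v e = (\<Sum>i\<in>UNIV. v $ i * facet_flow S (axis i 1) e)"
      by (rule facet_flow_linear(2)[OF d2 dom mesh k])
  qed
  also have "\<dots> = (\<Sum>i\<in>UNIV. v $ i * (\<Sum>e\<in>macro_facets S M. facet_flow S (axis i 1) e))"
    by (subst sum.swap) (simp add: sum_distrib_left)
  also have "\<dots> = 0" by (simp add: macro_balance_axis[OF M])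
  finally show ?thesis by (simp add: facet_flow_def)
qed

end

section \<open>Integrability of the numerical fluxes\<close>

text \<open>
  Turns the maximal wave speed into a countable supremum, which is what measurability needs.
\<close>

lemma cSUP_dense_rationals:
  fixes g :: "real \<Rightarrow> real"
  assumes g: "continuous_on UNIV g"
  shows "(SUP t\<in>{0..1}. g t) = (SUP t\<in>{0<..<1} \<inter> \<rat>. g t)"
proof -
  let ?I = "{0<..<1} \<inter> \<rat> :: real set"
  have cl: "closure ?I = {0..1}"
    using closure_open_Int_superset[of "{0<..<1::real}" "\<rat>"] by (simp add: Rats_closure_real)
  have ne: "?I \<noteq> {}" using cl by auto
  have "compact (g ` {0..1})" using g by (intro compact_continuous_image) (auto intro: continuous_on_subset)
  then have bdd: "bdd_above (g ` {0..1})" by (intro bounded_imp_bdd_above compact_imp_bounded)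
  have sub: "?I \<subseteq> {0..1}" by auto
  then have bddI: "bdd_above (g ` ?I)" using bdd by (meson bdd_above_mono image_mono)
  show ?thesis
  proof (rule antisym)
    show "(SUP t\<in>?I. g t) \<le> (SUP t\<in>{0..1}. g t)" using sub ne bdd by (intro cSUP_subset_mono) auto
    have "closed {t. g t \<le> (SUP t\<in>?I. g t)}" using g by (intro closed_Collect_le) auto
    moreover have "?I \<subseteq> {t. g t \<le> (SUP t\<in>?I. g t)}" using bddI by (auto intro: cSUP_upper)
    ultimately have "{0..1} \<subseteq> {t. g t \<le> (SUP t\<in>?I. g t)}" using closure_minimal cl by metis
    then show "(SUP t\<in>{0..1}. g t) \<le> (SUP t\<in>?I. g t)" by (intro cSUP_least) auto
  qed
qed

text \<open>
  The only property of discrete functions that matters for the integrability of fluxes. It is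
  shared by the polynomials, the Runge--Kutta stages and the piecewise constant means.
\<close>

definition cellwise_continuous :: "('d::finite) cut_dg \<Rightarrow> 'd pw \<Rightarrow> bool" where
  "cellwise_continuous S u \<longleftrightarrow> (\<forall>k\<in>active S. continuous_on UNIV (u k))"

context
  fixes S :: "('d::finite) cut_dg"
  assumes d2: "CARD('d) \<ge> 2"
    and dom: "convex_domain (Omega S)" and mesh: "background_mesh S"
    and C1: "flux S C1_differentiable_on UNIV"
begin

lemma continuous_flux: "continuous_on UNIV (flux S)"
  using C1 by (rule C1_differentiable_imp_continuous_on)

lemma continuous_flux_deriv: "continuous_on UNIV (\<lambda>v. vector_derivative (flux S) (at v))"
  using C1 by (simp add: C1_differentiable_on_eq)

lemma flux_has_vector_derivative: "(flux S has_vector_derivative vector_derivative (flux S) (at v)) (at v)"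
  using C1 by (simp add: C1_differentiable_on_eq vector_derivative_works)

lemma bounded_on_interval:
  fixes f :: "real \<Rightarrow> real^'d"
  assumes "continuous_on UNIV f"
  shows "\<exists>B\<ge>0. \<forall>v. \<bar>v\<bar> \<le> r \<longrightarrow> norm (f v) \<le> B"
proof -
  have "compact (f ` cball 0 r)" using assms by (intro compact_continuous_image) (auto intro: continuous_on_subset)
  then obtain B where "\<And>y. y \<in> f ` cball 0 r \<Longrightarrow> norm y \<le> B" "B > 0" using compact_imp_bounded bounded_pos by metis
  then show ?thesis by (intro exI[of _ B]) auto
qed

lemma max_speed_eq_SUP:
  "max_speed S n a b = (SUP t\<in>{0<..<1} \<inter> \<rat>. speed S n (a + t * (b - a)))"
proof -
  have "continuous_on UNIV (\<lambda>t. speed S n (a + t * (b - a)))"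
    unfolding speed_def
    by (intro continuous_intros continuous_on_compose2[OF continuous_flux_deriv]) auto
  moreover have "closed_segment a b = (\<lambda>t. a + t * (b - a)) ` {0..1}"
  proof -
    have "(1 - t) *\<^sub>R a + t *\<^sub>R b = a + t * (b - a)" for t by (simp add: algebra_simps)
    then show ?thesis unfolding closed_segment_def by auto
  qed
  ultimately show ?thesis
    unfolding max_speed_def using cSUP_dense_rationals by (simp add: image_image)
qed

lemma max_speed_bounds:
  assumes "\<bar>a\<bar> \<le> r" "\<bar>b\<bar> \<le> r" "norm n \<le> N" and B: "\<And>v. \<bar>v\<bar> \<le> r \<Longrightarrow> norm (vector_derivative (flux S) (at v)) \<le> B"
  shows "\<bar>max_speed S n a b\<bar> \<le> B * N"
proof -
  have v: "\<bar>v\<bar> \<le> r" if "v \<in> closed_segment a b" for v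
    using that assms(1,2) by (auto simp: closed_segment_eq_real_ivl split: if_splits)
  have sp: "0 \<le> speed S n v" "speed S n v \<le> B * N" if "v \<in> closed_segment a b" for v
  proof -
    have "speed S n v \<le> norm (vector_derivative (flux S) (at v)) * norm n"
      unfolding speed_def by (rule Cauchy_Schwarz_ineq2)
    also have "\<dots> \<le> B * N" using B[OF v[OF that]] assms(3) by (intro mult_mono) (auto intro: order_trans[OF norm_ge_zero])
    finally show "speed S n v \<le> B * N" .
  qed (simp add: speed_def)
  have "max_speed S n a b \<le> B * N" unfolding max_speed_def using sp by (intro cSUP_least) auto
  moreover have "0 \<le> speed S n a" "speed S n a \<le> max_speed S n a b"
    unfolding max_speed_def using sp by (auto intro!: cSUP_upper bdd_aboveI2[of _ _ "B * N"])
  ultimately show ?thesis by simp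
qed

lemma max_speed_measurable:
  assumes [measurable]: "n \<in> borel_measurable M" "a \<in> borel_measurable M" "b \<in> borel_measurable M"
    and bnd: "\<And>x. x \<in> space M \<Longrightarrow> \<bar>a x\<bar> \<le> r \<and> \<bar>b x\<bar> \<le> r"
  shows "(\<lambda>x. max_speed S (n x) (a x) (b x)) \<in> borel_measurable M"
  unfolding max_speed_eq_SUP
proof (rule borel_measurable_cSUP)
  show "countable ({0<..<1} \<inter> \<rat> :: real set)" by (intro countable_Int2 countable_rat)
  have [measurable]: "(\<lambda>v. vector_derivative (flux S) (at v)) \<in> borel_measurable borel"
    by (rule borel_measurable_continuous_onI[OF continuous_flux_deriv])
  show "(\<lambda>x. speed S (n x) (a x + t * (b x - a x))) \<in> borel_measurable M" for t
    unfolding speed_def by measurable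
  show "bdd_above ((\<lambda>t. speed S (n x) (a x + t * (b x - a x))) ` ({0<..<1} \<inter> \<rat>))" if "x \<in> space M" for x
  proof -
    have "continuous_on UNIV (\<lambda>t. speed S (n x) (a x + t * (b x - a x)))"
      unfolding speed_def by (intro continuous_intros continuous_on_compose2[OF continuous_flux_deriv]) auto
    then have "compact ((\<lambda>t. speed S (n x) (a x + t * (b x - a x))) ` {0..1})"
      by (intro compact_continuous_image) (auto intro: continuous_on_subset)
    then have "bdd_above ((\<lambda>t. speed S (n x) (a x + t * (b x - a x))) ` {0..1})"
      by (intro bounded_imp_bdd_above compact_imp_bounded)
    then show ?thesis by (rule bdd_above_mono) auto
  qed
qed

lemma lax_friedrichs_integrable:
  assumes A: "A \<in> sets borel" "emeasure surf A < \<infinity>"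
    and m: "n \<in> borel_measurable (restrict_space borel A)" "a \<in> borel_measurable (restrict_space borel A)"
      "b \<in> borel_measurable (restrict_space borel A)" "l \<in> borel_measurable (restrict_space borel A)"
    and bnd: "\<And>x. x \<in> A \<Longrightarrow> norm (n x) \<le> N" "\<And>x. x \<in> A \<Longrightarrow> \<bar>a x\<bar> \<le> r"
      "\<And>x. x \<in> A \<Longrightarrow> \<bar>b x\<bar> \<le> r" "\<And>x. x \<in> A \<Longrightarrow> \<bar>l x\<bar> \<le> L"
  shows "set_integrable surf A (\<lambda>x. lax_friedrichs S (l x) (n x) (a x) (b x))"
proof -
  let ?M = "restrict_space surf A"
  have sM: "sets ?M = sets (restrict_space borel A)" by (simp add: sets_restrict_space)
  have [measurable]: "n \<in> borel_measurable ?M" "a \<in> borel_measurable ?M" "b \<in> borel_measurable ?M" "l \<in> borel_measurable ?M"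
    using m by (simp_all add: measurable_cong_sets[OF sM refl])
  have [measurable]: "flux S \<in> borel_measurable borel" by (rule borel_measurable_continuous_onI[OF continuous_flux])
  interpret finite_measure ?M
    using A by (intro finite_measureI) (simp add: emeasure_restrict_space space_restrict_space less_top)
  obtain B where B: "0 \<le> B" "\<And>v. \<bar>v\<bar> \<le> r \<Longrightarrow> norm (flux S v) \<le> B" using bounded_on_interval[OF continuous_flux] by blast
  have "integrable ?M (\<lambda>x. lax_friedrichs S (l x) (n x) (a x) (b x))"
  proof (rule integrable_const_bound[of _ "B * N + L * r"])
    show "AE x in ?M. norm (lax_friedrichs S (l x) (n x) (a x) (b x)) \<le> B * N + L * r"
    proof (rule AE_I2)
      fix x assume "x \<in> space ?M"
      then have x: "x \<in> A" by (simp add: space_restrict_space)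
      have r: "0 \<le> r" "0 \<le> L" "0 \<le> N" using bnd[OF x] by (auto intro: order_trans[OF norm_ge_zero])
      have "\<bar>(flux S (a x) + flux S (b x)) \<bullet> n x\<bar> \<le> norm (flux S (a x) + flux S (b x)) * norm (n x)"
        by (rule Cauchy_Schwarz_ineq2)
      also have "\<dots> \<le> (2 * B) * N"
      proof (intro mult_mono)
        show "norm (flux S (a x) + flux S (b x)) \<le> 2 * B"
          using B(2)[of "a x"] B(2)[of "b x"] bnd[OF x] norm_triangle_ineq[of "flux S (a x)" "flux S (b x)"] by linarith
      qed (use B(1) bnd[OF x] in auto)
      finally have 1: "\<bar>(flux S (a x) + flux S (b x)) \<bullet> n x\<bar> \<le> 2 * B * N" .
      have "\<bar>l x * (b x - a x)\<bar> \<le> L * (2 * r)"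
        unfolding abs_mult using bnd[OF x] r by (intro mult_mono) auto
      then show "norm (lax_friedrichs S (l x) (n x) (a x) (b x)) \<le> B * N + L * r"
        using 1 unfolding lax_friedrichs_def real_norm_def by (simp add: abs_le_iff)
    qed
  qed (unfold lax_friedrichs_def, measurable)
  then show ?thesis using A by (simp add: integrable_restrict_space set_integrable_def)
qed

lemma normal_measurable_bounded:
  assumes k: "k \<in> active S" and e: "e = Inner k k' \<and> adjacent k k' \<or> e = Outer k"
  shows "normal S e \<in> borel_measurable (restrict_space borel (facet_set S e))"
    and "\<exists>N. \<forall>x\<in>facet_set S e. norm (normal S e x) \<le> N"
proof -
  note O = convex_domainD[OF dom]
  show "normal S e \<in> borel_measurable (restrict_space borel (facet_set S e))"
  proof (cases "e = Outer k")
    case True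
    have "outer_normal (Omega S) \<in> borel_measurable (restrict_space borel (bdry S))"
      using outer_normal_measurable[OF d2 O] by (subst borel_measurable_restrict_space_iff) (auto simp: borel_closed)
    then have "outer_normal (Omega S) \<in> borel_measurable (restrict_space borel (facet_set S e))"
      by (rule measurable_restrict_mono) (simp add: True)
    moreover have "normal S e = outer_normal (Omega S)" using True by (auto simp: fun_eq_iff)
    ultimately show ?thesis by simp
  next
    case False
    then have "normal S e = (\<lambda>_. \<chi> i. of_int (k' i - k i))" using e by (auto simp: fun_eq_iff)
    then show ?thesis by simp
  qed
  show "\<exists>N. \<forall>x\<in>facet_set S e. norm (normal S e x) \<le> N"
  proof (cases "e = Outer k")
    case True
    then show ?thesis using norm_outer_normal_le[OF d2 O] by (intro exI[of _ 1]) auto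
  qed (use e in auto)
qed

lemma cellwise_bounded:
  assumes u: "cellwise_continuous S u"
  obtains r where "\<And>k x. \<lbrakk>k \<in> active S; x \<in> closure (Omega S)\<rbrakk> \<Longrightarrow> \<bar>u k x\<bar> \<le> r"
proof -
  have K: "compact (closure (Omega S))" using convex_domainD[OF dom] by (simp add: compact_closure)
  have "\<exists>r. \<forall>x\<in>closure (Omega S). \<bar>u k x\<bar> \<le> r" if "k \<in> active S" for k
  proof -
    have "compact (u k ` closure (Omega S))"
      using u that K unfolding cellwise_continuous_def by (intro compact_continuous_image) (auto intro: continuous_on_subset)
    then show ?thesis using compact_imp_bounded by (fastforce simp: bounded_iff)
  qed
  then obtain R where R: "\<And>k x. \<lbrakk>k \<in> active S; x \<in> closure (Omega S)\<rbrakk> \<Longrightarrow> \<bar>u k x\<bar> \<le> R k" by metis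
  have "\<bar>u k x\<bar> \<le> (\<Sum>k\<in>active S. \<bar>R k\<bar>)" if "k \<in> active S" "x \<in> closure (Omega S)" for k x
  proof -
    have "\<bar>R k\<bar> \<le> (\<Sum>k\<in>active S. \<bar>R k\<bar>)" using that finite_active[OF d2 dom mesh] by (intro member_le_sum) auto
    then show ?thesis using R[OF that] by linarith
  qed
  then show ?thesis using that by blast
qed

lemma cell_at_active:
  assumes "x \<in> closure (Omega S)"
  shows "cell_at S x \<in> active S"
  unfolding cell_at_def using closure_Omega_covered[OF d2 dom mesh assms] someI_ex[of "\<lambda>k. k \<in> active S \<and> x \<in> cell S k"] by blast

text \<open>
  The traces on the periodic part of the boundary evaluate the polynomial of a cell that is chosen
  pointwise; the choice has to be measurable.
\<close>

lemma cell_at_measurable: "cell_at S \<in> measurable (restrict_space borel (bdry S)) (count_space (active S))"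
proof -
  \<comment> \<open>The chosen cell depends on \<open>x\<close> only through the finite set of active cells
    that contain \<open>x\<close>.\<close>
  define T where "T x = {k \<in> active S. x \<in> cell S k}" for x
  have fin: "finite (active S)" by (rule finite_active[OF d2 dom mesh])
  have T: "T \<in> measurable borel (count_space (Pow (active S)))"
  proof (subst measurable_count_space_eq2)
    show "finite (Pow (active S))" using fin by simp
    have "T -` {X} \<inter> space borel \<in> sets borel" if "X \<subseteq> active S" for X
    proof -
      have "T -` {X} \<inter> space borel = (\<Inter>k\<in>X. cell S k) \<inter> - (\<Union>k\<in>active S - X. cell S k)"
        using that by (auto simp: T_def)
      also have "\<dots> \<in> sets borel"
      proof -
        have "closed (\<Inter>k\<in>X. cell S k)" "closed (\<Union>k\<in>active S - X. cell S k)"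
          using fin by (auto simp: cell_def closed_cbox intro!: closed_INT closed_UN)
        then show ?thesis by (intro sets.Int borel_closed borel_open open_Compl)
      qed
      finally show ?thesis .
    qed
    then show "T \<in> space borel \<rightarrow> Pow (active S) \<and> (\<forall>a\<in>Pow (active S). T -` {a} \<inter> space borel \<in> sets borel)"
      by (auto simp: T_def)
  qed
  have "(\<lambda>X. SOME k. k \<in> X) \<in> measurable (count_space (Pow (active S))) (count_space UNIV)" by simp
  from measurable_compose[OF T this]
  have "(\<lambda>x. SOME k. k \<in> T x) \<in> measurable borel (count_space UNIV)" .
  moreover have "(\<lambda>x. SOME k. k \<in> T x) = cell_at S" by (auto simp: T_def cell_at_def fun_eq_iff)
  ultimately have "cell_at S \<in> measurable borel (count_space UNIV)" by simp
  then have m: "cell_at S \<in> measurable (restrict_space borel (bdry S)) (count_space UNIV)" by (rule measurable_restrict_space1)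
  have "cell_at S \<in> space (restrict_space borel (bdry S)) \<rightarrow> active S"
    by (auto simp: space_restrict_space frontier_def intro!: cell_at_active)
  then show ?thesis
    using m by (auto simp: measurable_def)
qed

lemma trace_measurable:
  assumes bc: "boundary_conditions S"
    and k: "k \<in> active S" and e: "e = Inner k k' \<and> adjacent k k' \<and> k' \<in> active S \<or> e = Outer k"
    and u: "cellwise_continuous S u"
  shows "trace_in u e \<in> borel_measurable (restrict_space borel (facet_set S e))"
    and "trace_out S u e \<in> borel_measurable (restrict_space borel (facet_set S e))"
proof -
  have uk: "u k \<in> borel_measurable borel" if "k \<in> active S" for k
    using u that by (intro borel_measurable_continuous_onI) (simp add: cellwise_continuous_def)
  have "trace_in u e = u k" using e by (auto simp: fun_eq_iff)
  then show "trace_in u e \<in> borel_measurable (restrict_space borel (facet_set S e))"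
    using uk[OF k] by (simp add: measurable_restrict_space1)
  show "trace_out S u e \<in> borel_measurable (restrict_space borel (facet_set S e))"
  proof (cases "e = Outer k")
    case False
    then have "trace_out S u e = u k'" "k' \<in> active S" using e by (auto simp: fun_eq_iff)
    then show ?thesis using uk by (simp add: measurable_restrict_space1)
  next
    case True
    define A where "A = facet_set S e"
    have Ab: "A \<subseteq> bdry S" using True by (auto simp: A_def)
    have sets: "inflow S \<in> sets borel" "period S \<in> sets borel"
      and g: "datum S \<in> borel_measurable (restrict_space borel (inflow S))"
      and p: "partner S \<in> borel_measurable (restrict_space borel (period S))"
      and pp: "\<And>x. x \<in> period S \<Longrightarrow> partner S x \<in> period S" and per: "period S \<subseteq> bdry S"
      using bc unfolding boundary_conditions_def by blast+
    have G: "(\<lambda>y. u (cell_at S y) y) \<in> borel_measurable (restrict_space borel (bdry S))"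
    proof (rule measurable_compose_countable'[OF _ cell_at_measurable])
      show "u i \<in> borel_measurable (restrict_space borel (bdry S))" if "i \<in> active S" for i
        using uk[OF that] by (rule measurable_restrict_space1)
      show "countable (active S)" using finite_active[OF d2 dom mesh] by (rule countable_finite)
    qed
    have "partner S \<in> measurable (restrict_space borel (period S)) (restrict_space borel (bdry S))"
      using p pp per by (intro measurable_restrict_space2) (auto simp: space_restrict_space)
    from measurable_compose[OF this G]
    have P: "(\<lambda>x. u (cell_at S (partner S x)) (partner S x)) \<in> borel_measurable (restrict_space borel (period S))" .
    let ?R = "restrict_space borel A"
    have Rsp: "space ?R = A" by (simp add: space_restrict_space)
    have rr: "restrict_space ?R X = restrict_space borel (A \<inter> X)" if "X \<in> sets borel" for X
      using that borel_closed[of "bdry S"] facet_borel_finite(1)[OF d2 dom mesh k, of e] True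
      by (intro restrict_restrict_space) (auto simp: A_def)
    have inR: "{x \<in> space ?R. x \<in> X} \<in> sets ?R" if "X \<in> sets borel" for X
      using that by (auto simp: sets_restrict_space Rsp Int_def)
    have "(\<lambda>x. if x \<in> period S then u (cell_at S (partner S x)) (partner S x) else u k x) \<in> borel_measurable ?R"
    proof (subst measurable_If_restrict_space_iff[OF inR[OF sets(2)]], intro conjI)
      have "(\<lambda>x. u (cell_at S (partner S x)) (partner S x)) \<in> borel_measurable (restrict_space borel (A \<inter> period S))"
        using P by (rule measurable_restrict_mono) auto
      then show "(\<lambda>x. u (cell_at S (partner S x)) (partner S x)) \<in> borel_measurable (restrict_space ?R {x. x \<in> period S})"
        using rr[OF sets(2)] by simp
      show "u k \<in> borel_measurable (restrict_space ?R {x. x \<notin> period S})"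
        using uk[OF k] by (intro measurable_restrict_space1)
    qed
    then have "(\<lambda>x. if x \<in> inflow S then datum S x else
        if x \<in> period S then u (cell_at S (partner S x)) (partner S x) else u k x) \<in> borel_measurable ?R"
    proof (subst measurable_If_restrict_space_iff[OF inR[OF sets(1)]], intro conjI)
      have "datum S \<in> borel_measurable (restrict_space borel (A \<inter> inflow S))"
        using g by (rule measurable_restrict_mono) auto
      then show "datum S \<in> borel_measurable (restrict_space ?R {x. x \<in> inflow S})"
        using rr[OF sets(1)] by simp
    qed (rule measurable_restrict_space1)
    moreover have "trace_out S u e = (\<lambda>x. if x \<in> inflow S then datum S x else
        if x \<in> period S then u (cell_at S (partner S x)) (partner S x) else u k x)"
      using True by (auto simp: fun_eq_iff)
    ultimately show ?thesis by (simp add: A_def)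
  qed
qed

lemma trace_bounded:
  assumes bc: "boundary_conditions S" and D: "\<And>x. x \<in> inflow S \<Longrightarrow> \<bar>datum S x\<bar> \<le> D"
    and k: "k \<in> active S" and e: "e = Inner k k' \<and> adjacent k k' \<and> k' \<in> active S \<or> e = Outer k"
    and u: "cellwise_continuous S u"
  obtains r where "\<And>x. x \<in> facet_set S e \<Longrightarrow> \<bar>trace_in u e x\<bar> \<le> r \<and> \<bar>trace_out S u e x\<bar> \<le> r"
proof -
  obtain r where r: "\<And>k x. \<lbrakk>k \<in> active S; x \<in> closure (Omega S)\<rbrakk> \<Longrightarrow> \<bar>u k x\<bar> \<le> r"
    using cellwise_bounded[OF u] by blast
  have pp: "partner S x \<in> closure (Omega S)" if "x \<in> period S" for x
    using bc that unfolding boundary_conditions_def frontier_def by blast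
  have "\<bar>trace_in u e x\<bar> \<le> max r D \<and> \<bar>trace_out S u e x\<bar> \<le> max r D" if x: "x \<in> facet_set S e" for x
  proof -
    have e': "e = Inner k k' \<and> adjacent k k' \<or> e = Outer k" using e by blast
    have cx: "x \<in> closure (Omega S)" using facet_borel_finite(3)[OF d2 dom mesh k e'] x by blast
    show ?thesis
    proof (cases "e = Outer k")
      case True
      then show ?thesis using r[OF k cx] D[of x] r[OF cell_at_active[OF pp] pp, of x x] by (auto simp: le_max_iff_disj)
    next
      case False
      then show ?thesis using e r[OF k cx] r[OF _ cx, of k'] by (auto simp: le_max_iff_disj)
    qed
  qed
  then show ?thesis using that by blast
qed

text \<open>
  On a facet of finite measure it suffices that traces, normals and speeds are measurable and
  bounded.
\<close>

lemma fluxes_integrable: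
  assumes bc: "boundary_conditions S" and D: "\<And>x. x \<in> inflow S \<Longrightarrow> \<bar>datum S x\<bar> \<le> D"
    and k: "k \<in> active S" and e: "e = Inner k k' \<and> adjacent k k' \<and> k' \<in> active S \<or> e = Outer k"
    and u: "cellwise_continuous S u"
  shows "set_integrable surf (facet_set S e) (\<lambda>x. lax_friedrichs S l (normal S e x) (trace_in u e x) (trace_out S u e x))"
    and "set_integrable surf (facet_set S e) (num_flux S u e)"
proof -
  have e': "e = Inner k k' \<and> adjacent k k' \<or> e = Outer k" using e by blast
  note F = facet_borel_finite[OF d2 dom mesh k e']
  note T = trace_measurable[OF bc k e u] and N = normal_measurable_bounded[OF k e']
  obtain r where r: "\<And>x. x \<in> facet_set S e \<Longrightarrow> \<bar>trace_in u e x\<bar> \<le> r \<and> \<bar>trace_out S u e x\<bar> \<le> r"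
    using trace_bounded[OF bc D k e u] by blast
  obtain N' where N': "\<And>x. x \<in> facet_set S e \<Longrightarrow> norm (normal S e x) \<le> N'" using N(2) by blast
  show "set_integrable surf (facet_set S e) (\<lambda>x. lax_friedrichs S l (normal S e x) (trace_in u e x) (trace_out S u e x))"
    by (rule lax_friedrichs_integrable[OF F(1,2) N(1) T, of "\<lambda>_. l" N' r "\<bar>l\<bar>"]) (use r N' in auto)
  obtain B where B: "0 \<le> B" "\<And>v. \<bar>v\<bar> \<le> r \<Longrightarrow> norm (vector_derivative (flux S) (at v)) \<le> B"
    using bounded_on_interval[OF continuous_flux_deriv] by blast
  let ?l = "\<lambda>x. C_facet S e x * max_speed S (normal S e x) (trace_in u e x) (trace_out S u e x)"
  let ?R = "restrict_space borel (facet_set S e)"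
  have Cm: "C_facet S e \<in> borel_measurable ?R"
  proof (cases "e = Outer k")
    case True
    have [measurable]: "inflow S \<in> sets borel" using bc by (simp add: boundary_conditions_def)
    have "(\<lambda>x. if x \<in> inflow S then Cin S k else 1) \<in> borel_measurable ?R"
      by (rule measurable_restrict_space1) measurable
    moreover have "C_facet S e = (\<lambda>x. if x \<in> inflow S then Cin S k else 1)" using True by (auto simp: fun_eq_iff)
    ultimately show ?thesis by simp
  next
    case False
    then have "C_facet S e = (\<lambda>_. 1)" using e by (auto simp: fun_eq_iff)
    then show ?thesis by simp
  qed
  have Cb: "\<bar>C_facet S e x\<bar> \<le> \<bar>Cin S k\<bar> + 1" for x using e by auto
  have lm: "?l \<in> borel_measurable ?R"
    using r by (intro borel_measurable_times Cm max_speed_measurable[OF N(1) T, of r]) (auto simp: space_restrict_space)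
  have lb: "\<bar>?l x\<bar> \<le> (\<bar>Cin S k\<bar> + 1) * (B * N')" if "x \<in> facet_set S e" for x
    unfolding abs_mult using Cb max_speed_bounds[OF _ _ N'[OF that] B(2)] r[OF that]
    by (intro mult_mono) auto
  have "set_integrable surf (facet_set S e) (\<lambda>x. lax_friedrichs S (?l x) (normal S e x) (trace_in u e x) (trace_out S u e x))"
    by (rule lax_friedrichs_integrable[OF F(1,2) N(1) T lm, of N' r "(\<bar>Cin S k\<bar> + 1) * (B * N')"])
      (use r N' lb in auto)
  moreover have "num_flux S u e = (\<lambda>x. lax_friedrichs S (?l x) (normal S e x) (trace_in u e x) (trace_out S u e x))"
    by (auto simp: num_flux_def Let_def fun_eq_iff)
  ultimately show "set_integrable surf (facet_set S e) (num_flux S u e)" by simp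
qed

lemma Vh_cellwise_continuous:
  assumes "u \<in> Vh S"
  shows "cellwise_continuous S u"
  unfolding cellwise_continuous_def
proof
  fix k assume "k \<in> active S"
  then obtain c where c: "\<And>x. u k x = (\<Sum>\<alpha> \<in> {\<alpha> :: 'd \<Rightarrow> nat. (\<Sum>i \<in> UNIV. \<alpha> i) \<le> deg S}. c \<alpha> * (\<Prod>i \<in> UNIV. x $ i ^ \<alpha> i))"
    using assms unfolding Vh_def polys_def by blast
  show "continuous_on UNIV (u k)" unfolding c[abs_def] by (intro continuous_intros)
qed

lemma high_flux_integrable:
  assumes bc: "boundary_conditions S" and D: "\<And>x. x \<in> inflow S \<Longrightarrow> \<bar>datum S x\<bar> \<le> D"
    and k: "k \<in> active S" and e: "e = Inner k k' \<and> adjacent k k' \<and> k' \<in> active S \<or> e = Outer k"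
    and u: "u \<in> Vh S" and FH: "high_flux S u FH"
  shows "set_integrable surf (facet_set S e) (FH e)"
proof -
  note I = fluxes_integrable(2)[OF bc D k e]
  note cu = Vh_cellwise_continuous[OF u]
  consider "FH = num_flux S u" | w w1 u1 u2 where "is_L S u w" "u1 = (\<lambda>k x. u k x + dt S * w k x)"
     "is_L S u1 w1" "u2 = (\<lambda>k x. u k x + 1/4 * dt S * (w k x + w1 k x))"
     "FH = (\<lambda>e x. 1/6 * num_flux S u e x + 1/6 * num_flux S u1 e x + 4/6 * num_flux S u2 e x)"
    using FH unfolding high_flux_def by blast
  then show ?thesis
  proof cases
    case 1
    then show ?thesis using I[OF _ cu] by auto
  next
    case 2
    have cw: "cellwise_continuous S w" "cellwise_continuous S w1"
      using 2 Vh_cellwise_continuous by (auto simp: is_L_def)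
    have c1: "cellwise_continuous S u1" "cellwise_continuous S u2"
      using cu cw unfolding 2(2,4) cellwise_continuous_def by (auto intro!: continuous_intros)
    show ?thesis unfolding 2(5)
      by (intro set_integral_add(1) set_integrable_mult_right I cu c1 D)
  qed
qed

end

section \<open>Maximum principle and limiter\<close>

text \<open>
  The heart of the limiter: negative corrections only help, and the positive ones are scaled so
  that together they use at most the fraction \<open>C / (C + \<epsilon>)\<close> of the available room \<open>B\<close>. The
  positive \<open>\<epsilon>\<close> keeps the quotient defined when all corrections vanish.
\<close>

lemma limited_sum_le:
  fixes \<theta> \<beta> :: "'i \<Rightarrow> real"
  assumes c: "0 \<le> c" and B: "0 \<le> B" and eps: "0 < \<epsilon>"
    and C: "C = c * (\<Sum>i\<in>I. max (\<beta> i) 0)"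
    and \<theta>: "\<And>i. i \<in> I \<Longrightarrow> 0 \<le> \<theta> i" "\<And>i. \<lbrakk>i \<in> I; 0 \<le> \<beta> i\<rbrakk> \<Longrightarrow> \<theta> i \<le> B / (C + \<epsilon>)"
  shows "c * (\<Sum>i\<in>I. \<theta> i * \<beta> i) \<le> B"
proof -
  have C0: "0 \<le> C" unfolding C using c by (intro mult_nonneg_nonneg sum_nonneg) auto
  have "\<theta> i * \<beta> i \<le> B / (C + \<epsilon>) * max (\<beta> i) 0" if "i \<in> I" for i
  proof (cases "0 \<le> \<beta> i")
    case True
    then show ?thesis using mult_right_mono[OF \<theta>(2)[OF that True] True] by (simp add: max_absorb1)
  next
    case False
    then show ?thesis using \<theta>(1)[OF that] by (simp add: mult_nonneg_nonpos)
  qed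
  then have "(\<Sum>i\<in>I. \<theta> i * \<beta> i) \<le> B / (C + \<epsilon>) * (\<Sum>i\<in>I. max (\<beta> i) 0)"
    by (simp add: sum_distrib_left sum_mono)
  then have "c * (\<Sum>i\<in>I. \<theta> i * \<beta> i) \<le> c * (B / (C + \<epsilon>) * (\<Sum>i\<in>I. max (\<beta> i) 0))"
    using c by (rule mult_left_mono)
  also have "\<dots> = B * (C / (C + \<epsilon>))" by (simp add: C)
  also have "\<dots> \<le> B * 1" using B C0 eps by (intro mult_left_mono) auto
  finally show ?thesis by simp
qed

lemma flux_difference_bound:
  fixes F :: "real \<Rightarrow> real^'d"
  assumes F: "\<And>v. (F has_vector_derivative F' v) (at v)"
    and bnd: "\<And>v. v \<in> {lo..hi} \<Longrightarrow> \<bar>F' v \<bullet> n\<bar> \<le> l" and ab: "a \<in> {lo..hi}" "b \<in> {lo..hi}"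
  shows "\<bar>(F b - F a) \<bullet> n\<bar> \<le> l * \<bar>b - a\<bar>"
proof -
  have "((\<lambda>v. F v \<bullet> n) has_field_derivative F' v \<bullet> n) (at v within {lo..hi})" for v
    using bounded_linear.has_vector_derivative[OF bounded_linear_inner_left F, of n v]
    by (simp add: has_real_derivative_iff_has_vector_derivative has_vector_derivative_at_within)
  then have "norm (F b \<bullet> n - F a \<bullet> n) \<le> l * norm (b - a)"
    using bnd ab by (intro field_differentiable_bound[of "{lo..hi}" "\<lambda>v. F v \<bullet> n" "\<lambda>v. F' v \<bullet> n"]) auto
  then show ?thesis by (simp add: inner_diff_left)
qed

text \<open>
  The Lax--Friedrichs flux minus the flux of the inner state is half the flux difference minus the
  dissipation. As \<open>l\<close> bounds the wave speed, the dissipation dominates: the excess has the sign of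
  \<open>a - b\<close> and size at most \<open>l * \<bar>b - a\<bar>\<close>.
\<close>

lemma low_order_flux_excess:
  assumes F: "\<And>v. (flux S has_vector_derivative F' v) (at v)"
    and bnd: "\<And>v. v \<in> {lo..hi} \<Longrightarrow> \<bar>F' v \<bullet> n\<bar> \<le> l" and ab: "a \<in> {lo..hi}" "b \<in> {lo..hi}"
  shows "lax_friedrichs S l n a b - n \<bullet> flux S a \<in> {- l * (hi - a)..l * (a - lo)}"
proof -
  define D where "D = (flux S b - flux S a) \<bullet> n"
  have D: "\<bar>D\<bar> \<le> l * \<bar>b - a\<bar>" unfolding D_def by (rule flux_difference_bound[OF F bnd ab])
  have l: "0 \<le> l" using bnd[OF ab(1)] by (meson abs_ge_zero order_trans)
  have eq: "lax_friedrichs S l n a b - n \<bullet> flux S a = D / 2 - l * (b - a) / 2"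
    unfolding lax_friedrichs_def D_def inner_add_left inner_diff_left inner_commute[of n] by (simp add: field_simps)
  have up: "l * (b - a) \<le> l * (hi - a)" and lo: "l * (a - b) \<le> l * (a - lo)"
    using ab l by (auto intro!: mult_left_mono)
  have nn: "0 \<le> l * (hi - a)" "0 \<le> l * (a - lo)" using ab l by (auto intro!: mult_nonneg_nonneg)
  show ?thesis
  proof (cases "a \<le> b")
    case True
    then have "\<bar>D\<bar> \<le> l * (b - a)" using D by simp
    then show ?thesis using up nn by (simp add: eq abs_le_iff)
  next
    case False
    then have "\<bar>D\<bar> \<le> l * (a - b)" using D by simp
    moreover have "l * (b - a) = - (l * (a - b))" by (simp add: algebra_simps)
    ultimately show ?thesis using lo nn by (simp add: eq abs_le_iff)
  qed
qed

context
  fixes S :: "('d::finite) cut_dg"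
    and u :: "'d pw"
    and FH :: "'d facet \<Rightarrow> real ^ 'd \<Rightarrow> real"
  assumes d2: "CARD('d) \<ge> 2"
    and dom: "convex_domain (Omega S)"
    and C1: "flux S C1_differentiable_on UNIV"
    and mesh: "background_mesh S"
    and mac: "macro_elements S"
    and bc: "boundary_conditions S"
    and u: "u \<in> Vh S"
    and FH: "high_flux S u FH"
    and lam: "\<And>M \<xi> e x v. \<lbrakk>M \<in> macros S; \<xi> \<in> faces S M; e \<in> facets_of \<xi>; x \<in> facet_set S e;
                  v \<in> {u_min S..u_max S}\<rbrakk> \<Longrightarrow>
                \<bar>vector_derivative (flux S) (at v) \<bullet> normal S e x\<bar> \<le> lam S"
    and means: "\<And>M. M \<in> macros S \<Longrightarrow> mean S u M \<in> {u_min S..u_max S}"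
    and inflow: "\<And>x. x \<in> inflow S \<Longrightarrow> datum S x \<in> {u_min S..u_max S}"
    and dt: "dt S > 0"
    and CFL: "(MAX M \<in> macros S. perimeter S M / macro_vol S M) * lam S * dt S \<le> 1"
begin

lemma datum_bounded: "x \<in> inflow S \<Longrightarrow> \<bar>datum S x\<bar> \<le> \<bar>u_min S\<bar> + \<bar>u_max S\<bar>"
  using inflow[of x] by auto

lemma low_flux_integrable:
  assumes M: "M \<in> macros S" and e: "e \<in> macro_facets S M"
  shows "set_integrable surf (facet_set S e) (low_flux S u e)"
proof -
  obtain k k' where k: "k \<in> active S" "e = Inner k k' \<and> adjacent k k' \<and> k' \<in> active S \<or> e = Outer k"
    using macro_facetE[OF d2 dom mesh mac M e] by metis
  have "cellwise_continuous S (mean_fun S u)"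
    unfolding cellwise_continuous_def by (simp add: mean_fun_def)
  from fluxes_integrable(1)[OF d2 dom mesh C1 bc datum_bounded k this]
  show ?thesis by (simp add: low_flux_def[abs_def] Let_def)
qed

lemma high_flux_integrable_facet:
  assumes M: "M \<in> macros S" and e: "e \<in> macro_facets S M"
  shows "set_integrable surf (facet_set S e) (FH e)"
proof -
  obtain k k' where k: "k \<in> active S" "e = Inner k k' \<and> adjacent k k' \<and> k' \<in> active S \<or> e = Outer k"
    using macro_facetE[OF d2 dom mesh mac M e] by metis
  show ?thesis by (rule high_flux_integrable[OF d2 dom mesh C1 bc datum_bounded k u FH])
qed

lemma mean_traces:
  assumes M: "M \<in> macros S" and e: "e \<in> macro_facets S M" and x: "x \<in> facet_set S e"
  shows "trace_in (mean_fun S u) e x = mean S u M"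
    and "trace_out S (mean_fun S u) e x \<in> {u_min S..u_max S}"
proof -
  have mm: "mean S u (macro_of S j) \<in> {u_min S..u_max S}" if "j \<in> active S" for j
    using means macro_of_active(1)[OF d2 dom mesh mac that] by blast
  obtain k k' where k: "k \<in> active S" "k \<in> M" "e = Inner k k' \<and> adjacent k k' \<and> k' \<in> active S \<or> e = Outer k"
    using macro_facetE[OF d2 dom mesh mac M e] by metis
  show "trace_in (mean_fun S u) e x = mean S u M"
    using k macro_of_eq[OF d2 dom mesh mac M k(2)] by (auto simp: mean_fun_def)
  show "trace_out S (mean_fun S u) e x \<in> {u_min S..u_max S}"
  proof (cases "e = Outer k")
    case False
    then show ?thesis using k(3) mm by (auto simp: mean_fun_def)
  next
    case True
    have "cell_at S (partner S x) \<in> active S" if "x \<in> period S"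
    proof (rule cell_at_active[OF d2 dom mesh C1])
      show "partner S x \<in> closure (Omega S)"
        using bc that unfolding boundary_conditions_def frontier_def by blast
    qed
    then show ?thesis using True mm k(1) inflow[of x] by (simp add: mean_fun_def)
  qed
qed

lemma low_flux_excess:
  assumes M: "M \<in> macros S" and e: "e \<in> macro_facets S M" and x: "x \<in> facet_set S e"
  shows "low_flux S u e x - normal S e x \<bullet> flux S (mean S u M)
    \<in> {- lam S * (u_max S - mean S u M)..lam S * (mean S u M - u_min S)}"
proof -
  obtain \<xi> where "\<xi> \<in> faces S M" "e \<in> facets_of \<xi>"
    using e facets_of_faces[OF d2 dom mesh mac M] by blast
  note lam' = lam[OF M this x]
  show ?thesis
    unfolding low_flux_def Let_def mean_traces(1)[OF M e x]
    by (rule low_order_flux_excess[OF flux_has_vector_derivative[OF d2 dom mesh C1] lam' means[OF M] mean_traces(2)[OF M e x]])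
qed

lemma perimeter_eq: "M \<in> macros S \<Longrightarrow> perimeter S M = (\<Sum>e\<in>macro_facets S M. measure surf (facet_set S e))"
proof -
  assume M: "M \<in> macros S"
  have "facet_set S e \<in> sets borel" if e: "e \<in> macro_facets S M" for e
  proof -
    obtain k k' where k: "k \<in> active S" "e = Inner k k' \<and> adjacent k k' \<or> e = Outer k"
      using macro_facetE[OF d2 dom mesh mac M e] by metis
    show ?thesis by (rule facet_borel_finite(1)[OF d2 dom mesh k])
  qed
  then show ?thesis
    unfolding perimeter_def face_area_def face_integral_def sum_faces[OF d2 dom mesh mac M]
    by (intro sum.cong) (simp_all add: set_lebesgue_integral_def)
qed

text \<open>
  By the balance of the closed surface, the flux of the constant vector \<open>flux S (mean S u M)\<close> may
  be subtracted from the low-order flux, and only the excess remains.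
\<close>

lemma low_total_bounds:
  assumes M: "M \<in> macros S"
  shows "low_total S u M \<in> {- lam S * (u_max S - mean S u M) * perimeter S M..lam S * (mean S u M - u_min S) * perimeter S M}"
proof -
  let ?w = "flux S (mean S u M)"
  let ?lo = "- lam S * (u_max S - mean S u M)" and ?hi = "lam S * (mean S u M - u_min S)"
  have each: "(LINT x:facet_set S e|surf. low_flux S u e x) - (LINT x:facet_set S e|surf. normal S e x \<bullet> ?w)
      \<in> {?lo * measure surf (facet_set S e)..?hi * measure surf (facet_set S e)}"
    if e: "e \<in> macro_facets S M" for e
  proof -
    obtain k k' where k: "k \<in> active S" "e = Inner k k' \<and> adjacent k k' \<or> e = Outer k"
      using macro_facetE[OF d2 dom mesh mac M e] by metis
    note F = facet_borel_finite[OF d2 dom mesh k]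
    note il = low_flux_integrable[OF M e] and ifl = facet_flow_linear(1)[OF d2 dom mesh k, of ?w]
    have c: "set_integrable surf (facet_set S e) (\<lambda>x. c)" for c :: real
      unfolding set_integrable_def using F by (intro integrable_scaleR_left integrable_real_indicator) auto
    have const: "(LINT x:facet_set S e|surf. c) = c * measure surf (facet_set S e)" for c :: real
      using F by (simp add: set_lebesgue_integral_def)
    have d: "set_integrable surf (facet_set S e) (\<lambda>x. low_flux S u e x - normal S e x \<bullet> ?w)"
      by (rule set_integral_diff(1)[OF il ifl])
    have eq: "(LINT x:facet_set S e|surf. low_flux S u e x) - (LINT x:facet_set S e|surf. normal S e x \<bullet> ?w)
        = (LINT x:facet_set S e|surf. low_flux S u e x - normal S e x \<bullet> ?w)"
      using set_integral_diff(2)[OF il ifl] by simp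
    have "?lo * measure surf (facet_set S e) \<le> (LINT x:facet_set S e|surf. low_flux S u e x - normal S e x \<bullet> ?w)"
      unfolding const[symmetric] using low_flux_excess[OF M e] by (intro set_integral_mono c d) auto
    moreover have "(LINT x:facet_set S e|surf. low_flux S u e x - normal S e x \<bullet> ?w) \<le> ?hi * measure surf (facet_set S e)"
      unfolding const[symmetric] using low_flux_excess[OF M e] by (intro set_integral_mono c d) auto
    ultimately show ?thesis by (simp add: eq)
  qed
  have "low_total S u M = (\<Sum>e\<in>macro_facets S M. LINT x:facet_set S e|surf. low_flux S u e x)"
    unfolding low_total_def face_integral_def by (rule sum_faces[OF d2 dom mesh mac M])
  also have "\<dots> = (\<Sum>e\<in>macro_facets S M. (LINT x:facet_set S e|surf. low_flux S u e x) - (LINT x:facet_set S e|surf. normal S e x \<bullet> ?w))"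
    using macro_balance[OF d2 dom mesh mac M, of ?w] by (simp add: sum_subtractf)
  finally have eq: "low_total S u M = \<dots>" .
  show ?thesis
    unfolding eq perimeter_eq[OF M] sum_distrib_left using each by (auto intro!: sum_mono)
qed

text \<open>
  A negative \<open>lam S\<close> makes the left-hand side nonpositive, so that the maximum over macro-elements
  is used for nonnegative \<open>lam S\<close> only.
\<close>

lemma CFL_macro:
  assumes M: "M \<in> macros S"
  shows "dt S / macro_vol S M * (lam S * perimeter S M) \<le> 1"
proof (cases "0 \<le> lam S")
  case True
  have "perimeter S M / macro_vol S M \<le> (MAX M \<in> macros S. perimeter S M / macro_vol S M)"
    using M finite_macros[OF d2 dom mesh mac] by (intro Max_ge) auto
  then have "perimeter S M / macro_vol S M * lam S * dt S \<le> (MAX M \<in> macros S. perimeter S M / macro_vol S M) * lam S * dt S"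
    using True dt by (intro mult_right_mono) auto
  then show ?thesis using CFL by (simp add: mult_ac)
next
  case False
  have "0 \<le> perimeter S M" unfolding perimeter_eq[OF M] by (intro sum_nonneg) simp
  then have "lam S * perimeter S M \<le> 0" using False by (intro mult_nonpos_nonneg) auto
  moreover have "0 \<le> dt S / macro_vol S M" using dt by (simp add: macro_vol_def)
  ultimately have "dt S / macro_vol S M * (lam S * perimeter S M) \<le> 0" by (rule mult_nonneg_nonpos[rotated])
  then show ?thesis by simp
qed

text \<open>
  The maximum principle of the low-order scheme: under the time step restriction, \<open>B_min\<close> and
  \<open>B_max\<close> are the nonnegative distances of its update from the two bounds.
\<close>

lemma low_order_bounds:
  assumes M: "M \<in> macros S"
  shows "0 \<le> B_min S u M" "0 \<le> B_max S u M"
proof -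
  let ?c = "dt S / macro_vol S M" and ?m = "mean S u M"
  have c: "0 \<le> ?c" using dt by (simp add: macro_vol_def)
  have m: "u_min S \<le> ?m" "?m \<le> u_max S" using means[OF M] by auto
  note L = low_total_bounds[OF M]
  have "?c * low_total S u M \<le> ?c * (lam S * (?m - u_min S) * perimeter S M)"
    using L c by (intro mult_left_mono) auto
  also have "\<dots> = (?c * (lam S * perimeter S M)) * (?m - u_min S)" by (simp add: mult_ac)
  also have "\<dots> \<le> 1 * (?m - u_min S)" using CFL_macro[OF M] m by (intro mult_right_mono) auto
  finally show "0 \<le> B_min S u M" by (simp add: B_min_def)
  have "?c * - low_total S u M \<le> ?c * (lam S * (u_max S - ?m) * perimeter S M)"
    using L c by (intro mult_left_mono) auto
  also have "\<dots> = (?c * (lam S * perimeter S M)) * (u_max S - ?m)" by (simp add: mult_ac)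
  also have "\<dots> \<le> 1 * (u_max S - ?m)" using CFL_macro[OF M] m by (intro mult_right_mono) auto
  finally show "0 \<le> B_max S u M" by (simp add: B_max_def)
qed

lemma C_nonneg: "0 \<le> C_min S u FH M" "0 \<le> C_max S u FH M"
proof -
  have "0 \<le> dt S / macro_vol S M" using dt by (simp add: macro_vol_def)
  then show "0 \<le> C_min S u FH M" "0 \<le> C_max S u FH M"
    unfolding C_min_def C_max_def by (intro mult_nonneg_nonneg sum_nonneg; simp)+
qed

lemma theta_macro_nonneg:
  assumes M: "M \<in> macros S"
  shows "0 \<le> theta_macro S u FH M \<xi>"
  using low_order_bounds[OF M] C_nonneg[of M]
  by (simp add: theta_macro_def Lambda_min_def Lambda_max_def add_nonneg_nonneg)

text \<open>
  The limiter of a shared interface respects the demands of both macro-elements. It is nonnegative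
  because the low-order update obeys the bounds on both sides.
\<close>

lemma theta_bounds:
  assumes M: "M \<in> macros S" and \<xi>: "\<xi> \<in> faces S M"
  shows "0 \<le> theta S u FH \<xi>" "theta S u FH \<xi> \<le> theta_macro S u FH M \<xi>"
proof -
  have "0 \<le> theta S u FH \<xi> \<and> theta S u FH \<xi> \<le> theta_macro S u FH M \<xi>"
  proof (cases \<xi>)
    case (Shared A N)
    then have "A = M" "N \<in> macros S" using \<xi> by (auto simp: faces_def)
    then show ?thesis using Shared theta_macro_nonneg M by simp
  next
    case (OnBdry k)
    then have "macro_of S k = M" using \<xi> macro_of_eq[OF d2 dom mesh mac M] by (auto simp: faces_def)
    then show ?thesis using OnBdry theta_macro_nonneg M by simp
  qed
  then show "0 \<le> theta S u FH \<xi>" "theta S u FH \<xi> \<le> theta_macro S u FH M \<xi>" by auto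
qed

text \<open>
  Splitting the integral of the limited flux requires that the low-order and the high-order flux
  are integrable separately.
\<close>

lemma mpp_face_integral:
  assumes M: "M \<in> macros S" and \<xi>: "\<xi> \<in> faces S M"
  shows "face_integral S \<xi> (mpp_flux S u FH \<xi>) = face_integral S \<xi> (low_flux S u) + theta S u FH \<xi> * beta S u FH \<xi>"
proof -
  let ?\<theta> = "theta S u FH \<xi>"
  have "(LINT x:facet_set S e|surf. mpp_flux S u FH \<xi> e x)
      = (LINT x:facet_set S e|surf. low_flux S u e x) + ?\<theta> * (LINT x:facet_set S e|surf. FH e x - low_flux S u e x)"
    if e: "e \<in> facets_of \<xi>" for e
  proof -
    have e': "e \<in> macro_facets S M" using e \<xi> facets_of_faces[OF d2 dom mesh mac M] by blast
    note il = low_flux_integrable[OF M e'] and d = set_integral_diff(1)[OF high_flux_integrable_facet[OF M e'] low_flux_integrable[OF M e']]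
    have "mpp_flux S u FH \<xi> e x = low_flux S u e x + ?\<theta> * (FH e x - low_flux S u e x)" for x
      by (simp add: mpp_flux_def algebra_simps)
    then show ?thesis using set_integral_add(2)[OF il set_integrable_mult_right[of ?\<theta>, OF d]] by simp
  qed
  then show ?thesis by (simp add: face_integral_def beta_def sum.distrib sum_distrib_left)
qed

lemma mpp_update_in_bounds:
  assumes M: "M \<in> macros S"
  shows "mpp_update S u FH M \<in> {u_min S..u_max S}"
proof -
  let ?c = "dt S / macro_vol S M" and ?\<theta> = "theta S u FH" and ?\<beta> = "beta S u FH"
  have c: "0 \<le> ?c" using dt by (simp add: macro_vol_def)
  have upd: "mpp_update S u FH M = mean S u M - ?c * low_total S u M - ?c * (\<Sum>\<xi>\<in>faces S M. ?\<theta> \<xi> * ?\<beta> \<xi>)"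
    using mpp_face_integral[OF M] by (simp add: mpp_update_def low_total_def sum.distrib distrib_left)
  have th: "?\<theta> \<xi> \<le> Lambda_min S u FH M \<xi>" "?\<theta> \<xi> \<le> Lambda_max S u FH M \<xi>" if "\<xi> \<in> faces S M" for \<xi>
    using theta_bounds(2)[OF M that] by (auto simp: theta_macro_def)
  have "?c * (\<Sum>\<xi>\<in>faces S M. ?\<theta> \<xi> * ?\<beta> \<xi>) \<le> B_min S u M"
  proof (rule limited_sum_le[OF c low_order_bounds(1)[OF M], of "1 / 10 ^ 40"])
    show "C_min S u FH M = ?c * (\<Sum>\<xi>\<in>faces S M. max (?\<beta> \<xi>) 0)" by (rule C_min_def)
    show "?\<theta> \<xi> \<le> B_min S u M / (C_min S u FH M + 1 / 10 ^ 40)" if "\<xi> \<in> faces S M" "0 \<le> ?\<beta> \<xi>" for \<xi>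
      using th(1)[OF that(1)] that(2) by (simp add: Lambda_min_def)
  qed (use theta_bounds(1)[OF M] in auto)
  moreover have "?c * (\<Sum>\<xi>\<in>faces S M. ?\<theta> \<xi> * - ?\<beta> \<xi>) \<le> B_max S u M"
  proof (rule limited_sum_le[OF c low_order_bounds(2)[OF M], of "1 / 10 ^ 40"])
    show "C_max S u FH M = ?c * (\<Sum>\<xi>\<in>faces S M. max (- ?\<beta> \<xi>) 0)" by (rule C_max_def)
    show "?\<theta> \<xi> \<le> B_max S u M / (C_max S u FH M + 1 / 10 ^ 40)" if "\<xi> \<in> faces S M" "0 \<le> - ?\<beta> \<xi>" for \<xi>
      using th(2)[OF that(1)] that(2) by (simp add: Lambda_max_def)
  qed (use theta_bounds(1)[OF M] in auto)
  ultimately show ?thesis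
    unfolding upd B_min_def B_max_def by (simp add: sum_negf)
qed

end

theorem theorem3p6:
  fixes S :: "('d::finite) cut_dg"
    and u :: "'d pw"
    and FH :: "'d facet \<Rightarrow> real ^ 'd \<Rightarrow> real"
  assumes "CARD('d) \<ge> 2"
    and "convex_domain (Omega S)"
    and "flux S C1_differentiable_on UNIV"
    and "bounded (init S ` Omega S)"
    and "background_mesh S"
    and "macro_elements S"
    and "boundary_conditions S"
    and "\<And>k. Cin S k > 1"
    and "gamma0 S > 0" and "gamma1 S > 0"
    and "u \<in> Vh S"
    and "high_flux S u FH"
    and lam: "\<And>M \<xi> e x v. \<lbrakk>M \<in> macros S; \<xi> \<in> faces S M; e \<in> facets_of \<xi>; x \<in> facet_set S e;
                  v \<in> {u_min S..u_max S}\<rbrakk> \<Longrightarrow>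
                \<bar>vector_derivative (flux S) (at v) \<bullet> normal S e x\<bar> \<le> lam S"
    and means: "\<And>M. M \<in> macros S \<Longrightarrow> mean S u M \<in> {u_min S..u_max S}"
    and inflow: "\<And>x. x \<in> inflow S \<Longrightarrow> datum S x \<in> {u_min S..u_max S}"
    and "dt S > 0"
    and CFL: "(MAX M \<in> macros S. perimeter S M / macro_vol S M) * lam S * dt S \<le> 1"
  shows "\<forall>M \<in> macros S. mpp_update S u FH M \<in> {u_min S..u_max S}"
proof
  fix M assume M: "M \<in> macros S"
  show "mpp_update S u FH M \<in> {u_min S..u_max S}"
    by (rule mpp_update_in_bounds[OF assms(1-3,5-7,11,12) _ _ _ assms(16) CFL M]) (rule lam means inflow; assumption)+
qed

end
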